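(* Let $T$ be the nonunitary representation of the Iwasawa group $P$ in the Hilbert space $L^2(S,\nu;K)$, let $b(p)=T(p)f-f$, $p\in P$, be its $1$-cocycle with $f(s)=e^{-\operatorname{tr}(ss^* )}\mathbf 1$, and let $L$ be the linear span of the vectors $b(p)$, $p\in P$. Then the representation of $P$ in $L$ and the $1$-cocycle $b$ can be extended to the whole group $U(p,q)$; that is, there exist a representation $\widetilde T$ of $U(p,q)$ by linear operators on $L$ with $\widetilde T(g)=T(g)|_L$ for all $g\in P$, and a map $\widetilde b:U(p,q)\to L$ with $\widetilde b(g_1g_2)=\widetilde T(g_1)\widetilde b(g_2)+\widetilde b(g_1)$ for all $g_1,g_2\in U(p,q)$ and $\widetilde b|_P=b$.
   Context: Let $q\ge p\ge 1$ be integers; $*$ is the conjugate transpose. $U(p,q)$ is the group of complex $(p+q)\times(p+q)$ matrices $g$ with $g\sigma g^*=\sigma$, where, in block form with diagonal blocks of orders $p,\,q-p,\,p$, $\sigma=\begin{pmatrix} 0&0&e_p \\ 0&e_{q-p}&0 \\ {e_p}&0&0 \end{pmatrix}$ ($e_k$ is the identity matrix). $S$ is the group of complex lower triangular $p\times p$ matrices with real positive diagonal, embedded in $U(p,q)$ by $s\mapsto\operatorname{diag}((s^* )^{-1},e_{q-p},s)$. $N$ is the Heisenberg group of pairs $(n,z)$, $n$ a skew-Hermitian $p\times p$ matrix, $z$ a complex $p\times(q-p)$ matrix, with $(n_1,z_1)(n_2,z_2)=(n_1+n_2-\frac12(z_1z_2^*-z_2z_1^* ),z_1+z_2)$, embedded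 in $U(p,q)$ by $(n,z)\mapsto\begin{pmatrix} e_p&0&0 \\ -z^*&e_{q-p}&0 \\ {n}-\frac12zz^*&z&e_p \end{pmatrix}$. The Iwasawa subgroup is $P=SN\subset U(p,q)$, a semidirect product in which $s(n,z)s^{-1}=(n,z)^s:=(sns^*,sz)$. Let $Z$ be the space of complex $p\times(q-p)$ matrices with Gaussian probability measure $\mu(dz)=e^{-\operatorname{tr}zz^*}dz$ ($dz$ suitably normalized Lebesgue measure). $K$ is the space of holomorphic functions in $L^2(Z,\mu)$, with $\mathbf 1\in K$ the constant function $1$. $N$ acts unitarily in $K$ by $T^1(n^0,z^0)f(z)=\exp(\operatorname{tr}n^0-\frac12\operatorname{tr}z^0z^{0*}-\operatorname{tr}zz^{0*})f(z+z^0)$. $\nu$ is the measure $d\nu(s)=|s|^{-p^2}ds$ on $S$, where $|s|^2=\operatorname{tr}(ss^* )$ and $ds$ is Lebesgue measure on $S$. The representation $T$ of $P$ in $L^2(S,\nu;K)$ is given by bounded operators $(T(g)F)(s)=T^1(g^s)F(s)$ for $g\in N$ and $(T(s_0)F)(s)=F(ss_0)$ for $s_0\in S$. The same formulas are applied to the function $f$ (which does not belong to $L^2(S,\nu;K)$); the differences $b(p)=T(p)f-f$ do lie in $L^2(S,\nu;K)$ and satisfy $b(p_1p_2)=T(p_1)b(p_2)+b(p_1)$. The operators $\widetilde T(g)$ are not required to be bounded. *)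

theory Defs
  imports
    "HOL-Analysis.Analysis"
    "Jordan_Normal_Form.Schur_Decomposition"
    "Jordan_Normal_Form.Gauss_Jordan_Elimination"
    "Jordan_Normal_Form.VS_Connect"
begin

text \<open>
  Throughout \<open>m\<close> stands for \<open>q - p\<close>, which may be \<open>0\<close>; this is why matrices are those with
  explicit dimensions (\<^typ>\<open>complex mat\<close>) rather than matrices indexed by types.
\<close>

subsection \<open>Matrices\<close>

definition mat_trace :: "complex mat \<Rightarrow> complex" where
  "mat_trace A = (\<Sum>i<dim_row A. A $$ (i, i))"

definition hs_norm :: "complex mat \<Rightarrow> real" where
  "hs_norm A = sqrt (Re (mat_trace (A * mat_adjoint A)))"

definition three_block_mat ::
  "complex mat \<Rightarrow> complex mat \<Rightarrow> complex mat \<Rightarrow>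
   complex mat \<Rightarrow> complex mat \<Rightarrow> complex mat \<Rightarrow>
   complex mat \<Rightarrow> complex mat \<Rightarrow> complex mat \<Rightarrow> complex mat" where
  "three_block_mat A11 A12 A13 A21 A22 A23 A31 A32 A33 =
     four_block_mat
       (four_block_mat A11 A12 A21 A22)
       (A13 @\<^sub>r A23)
       (four_block_mat A31 A32 (0\<^sub>m 0 (dim_col A31)) (0\<^sub>m 0 (dim_col A32)))
       A33"

subsection \<open>The groups\<close>

definition sigma_mat :: "nat \<Rightarrow> nat \<Rightarrow> complex mat" where
  "sigma_mat p m = three_block_mat
     (0\<^sub>m p p) (0\<^sub>m p m) (1\<^sub>m p)
     (0\<^sub>m m p) (1\<^sub>m m)   (0\<^sub>m m p)
     (1\<^sub>m p)   (0\<^sub>m p m) (0\<^sub>m p p)"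

definition U_group :: "nat \<Rightarrow> nat \<Rightarrow> complex mat set" where
  "U_group p q = {g \<in> carrier_mat (p + q) (p + q).
     g * sigma_mat p (q - p) * mat_adjoint g = sigma_mat p (q - p)}"

definition S_group :: "nat \<Rightarrow> complex mat set" where
  "S_group p = {s \<in> carrier_mat p p.
     (\<forall>i<p. \<forall>j<p. i < j \<longrightarrow> s $$ (i, j) = 0) \<and>
     (\<forall>i<p. s $$ (i, i) \<in> \<real> \<and> 0 < Re (s $$ (i, i)))}"

definition S_embed :: "nat \<Rightarrow> nat \<Rightarrow> complex mat \<Rightarrow> complex mat" where
  "S_embed p m s = three_block_mat
     (the (mat_inverse (mat_adjoint s))) (0\<^sub>m p m) (0\<^sub>m p p)
     (0\<^sub>m m p)                           (1\<^sub>m m)   (0\<^sub>m m p)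
     (0\<^sub>m p p)                           (0\<^sub>m p m) s"

definition N_group :: "nat \<Rightarrow> nat \<Rightarrow> (complex mat \<times> complex mat) set" where
  "N_group p m = {n \<in> carrier_mat p p. mat_adjoint n = - n} \<times> carrier_mat p m"

fun N_embed :: "nat \<Rightarrow> nat \<Rightarrow> complex mat \<times> complex mat \<Rightarrow> complex mat" where
  "N_embed p m (n, z) = three_block_mat
     (1\<^sub>m p)                                   (0\<^sub>m p m) (0\<^sub>m p p)
     (- mat_adjoint z)                        (1\<^sub>m m)   (0\<^sub>m m p)
     (n - (1 / 2) \<cdot>\<^sub>m (z * mat_adjoint z)) z        (1\<^sub>m p)"

text \<open>The conjugation action \<open>g\<^sup>s = s g s\<^sup>-\<^sup>1\<close> of \<open>S\<close> on \<open>N\<close>, in coordinates.\<close>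

fun N_conj :: "complex mat \<Rightarrow> complex mat \<times> complex mat \<Rightarrow> complex mat \<times> complex mat" where
  "N_conj s (n, z) = (s * n * mat_adjoint s, s * z)"

definition P_group :: "nat \<Rightarrow> nat \<Rightarrow> complex mat set" where
  "P_group p q = {S_embed p (q - p) s * N_embed p (q - p) h | s h.
     s \<in> S_group p \<and> h \<in> N_group p (q - p)}"

text \<open>The (unique) factors of an element of \<open>P = SN\<close>.\<close>

definition P_factors :: "nat \<Rightarrow> nat \<Rightarrow> complex mat \<Rightarrow> complex mat \<times> (complex mat \<times> complex mat)" where
  "P_factors p q g = (THE (s, h). s \<in> S_group p \<and> h \<in> N_group p (q - p) \<and>
     g = S_embed p (q - p) s * N_embed p (q - p) h)"

subsection \<open>Measures on matrix spaces\<close>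

definition mat_borel :: "nat \<Rightarrow> nat \<Rightarrow> complex mat measure" where
  "mat_borel k m = vimage_algebra (carrier_mat k m)
     (\<lambda>A. \<lambda>ij\<in>{..<k} \<times> {..<m}. A $$ ij) (Pi\<^sub>M ({..<k} \<times> {..<m}) (\<lambda>_. borel))"

definition mat_lebesgue :: "nat \<Rightarrow> nat \<Rightarrow> complex mat measure" where
  "mat_lebesgue k m =
     distr (Pi\<^sub>M ({..<k} \<times> {..<m}) (\<lambda>_. lborel)) (mat_borel k m) (mat k m)"

text \<open>The factor \<open>\<pi>\<^sup>-\<^sup>k\<^sup>m\<close> makes this a probability measure, since the integral of
  \<open>exp (- |w|\<^sup>2)\<close> over the complex plane is \<open>\<pi>\<close>.\<close>

definition gauss_measure :: "nat \<Rightarrow> nat \<Rightarrow> complex mat measure" where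
  "gauss_measure k m = density (mat_lebesgue k m)
     (\<lambda>z. ennreal (exp (- Re (mat_trace (z * mat_adjoint z))) / pi ^ (k * m)))"

definition tri_index :: "nat \<Rightarrow> (nat \<times> nat) set" where
  "tri_index p = {(i, j). j \<le> i \<and> i < p}"

text \<open>Lebesgue measure on the positive half-line, transported to the complex numbers.\<close>

definition pos_lebesgue :: "complex measure" where
  "pos_lebesgue = distr (restrict_space lborel {0<..})
     (restrict_space borel (complex_of_real ` {0<..})) complex_of_real"

definition S_lebesgue :: "nat \<Rightarrow> complex mat measure" where
  "S_lebesgue p = distr
     (Pi\<^sub>M (tri_index p) (\<lambda>(i, j). if i = j then pos_lebesgue else lborel))
     (restrict_space (mat_borel p p) (S_group p))
     (\<lambda>x. mat p p (\<lambda>ij. if ij \<in> tri_index p then x ij else 0))"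

definition nu_measure :: "nat \<Rightarrow> complex mat measure" where
  "nu_measure p = density (S_lebesgue p) (\<lambda>s. ennreal (1 / hs_norm s ^ (p\<^sup>2)))"

subsection \<open>The Hilbert space \<open>K\<close>\<close>

text \<open>Complex Frechet differentiability everywhere; the complex linear functionals on \<open>k \<times> m\<close>
  matrices are the maps \<open>h \<mapsto> tr (h D)\<close> with \<open>D\<close> an \<open>m \<times> k\<close> matrix. Only the values of
  \<open>f\<close> on \<^term>\<open>carrier_mat k m\<close> matter.\<close>

definition holomorphic_mat :: "nat \<Rightarrow> nat \<Rightarrow> (complex mat \<Rightarrow> complex) \<Rightarrow> bool" where
  "holomorphic_mat k m f \<longleftrightarrow> (\<forall>z \<in> carrier_mat k m. \<exists>D \<in> carrier_mat m k. \<forall>e>0. \<exists>d>0.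
     \<forall>h \<in> carrier_mat k m. hs_norm h < d \<longrightarrow>
       cmod (f (z + h) - f z - mat_trace (h * D)) \<le> e * hs_norm h)"

definition K_space :: "nat \<Rightarrow> nat \<Rightarrow> (complex mat \<Rightarrow> complex) set" where
  "K_space k m = {f. holomorphic_mat k m f \<and> f \<in> borel_measurable (gauss_measure k m) \<and>
     integrable (gauss_measure k m) (\<lambda>z. (cmod (f z))\<^sup>2)}"

definition K_norm :: "nat \<Rightarrow> nat \<Rightarrow> (complex mat \<Rightarrow> complex) \<Rightarrow> real" where
  "K_norm k m f = sqrt (\<integral>z. (cmod (f z))\<^sup>2 \<partial>gauss_measure k m)"

subsection \<open>The Hilbert space \<open>L\<^sup>2(S, \<nu>; K)\<close>\<close>

type_synonym vfun = "complex mat \<Rightarrow> complex mat \<Rightarrow> complex"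

text \<open>Square integrable, strongly (Bochner) measurable functions from \<open>S\<close> to \<open>K\<close>.\<close>

definition square_int_fun :: "nat \<Rightarrow> nat \<Rightarrow> vfun set" where
  "square_int_fun p q = {F.
     (\<forall>s \<in> S_group p. F s \<in> K_space p (q - p)) \<and>
     (\<exists>G. (\<forall>i::nat. simple_function (nu_measure p) (G i) \<and>
              (\<forall>s \<in> S_group p. G i s \<in> K_space p (q - p))) \<and>
          (\<forall>s \<in> S_group p. (\<lambda>i. K_norm p (q - p) (\<lambda>z. G i s z - F s z)) \<longlonglongrightarrow> 0)) \<and>
     integrable (nu_measure p) (\<lambda>s. (K_norm p (q - p) (F s))\<^sup>2)}"

text \<open>The class of \<open>F\<close> modulo equality almost everywhere, as a set of square integrable functions.
  Elements of \<open>K\<close> are equal iff they agree on \<^term>\<open>carrier_mat p (q - p)\<close>.\<close>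

definition ae_class :: "nat \<Rightarrow> nat \<Rightarrow> vfun \<Rightarrow> vfun set" where
  "ae_class p q F = {G \<in> square_int_fun p q.
     AE s in nu_measure p. \<forall>z \<in> carrier_mat p (q - p). G s z = F s z}"

text \<open>The vector space of classes, as a module record over \<^term>\<open>class_ring :: complex ring\<close>. The
  ring fields \<open>mult\<close> and \<open>one\<close> play no role.\<close>

definition L2_space :: "nat \<Rightarrow> nat \<Rightarrow> (complex, vfun set) module" where
  "L2_space p q = \<lparr>
     carrier = ae_class p q ` square_int_fun p q,
     mult = undefined,
     one = undefined,
     zero = ae_class p q (\<lambda>s z. 0),
     add = (\<lambda>X Y. \<Union>F\<in>X. \<Union>G\<in>Y. ae_class p q (\<lambda>s z. F s z + G s z)),
     smult = (\<lambda>c X. \<Union>F\<in>X. ae_class p q (\<lambda>s z. c * F s z))\<rparr>"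

subsection \<open>The representation and the cocycle\<close>

fun T1 :: "complex mat \<times> complex mat \<Rightarrow> (complex mat \<Rightarrow> complex) \<Rightarrow> complex mat \<Rightarrow> complex" where
  "T1 (n0, z0) f z =
     exp (mat_trace n0 - mat_trace (z0 * mat_adjoint z0) / 2 - mat_trace (z * mat_adjoint z0)) *
     f (z + z0)"

definition T_S :: "complex mat \<Rightarrow> vfun \<Rightarrow> vfun" where
  "T_S s0 F = (\<lambda>s. F (s * s0))"

definition T_N :: "complex mat \<times> complex mat \<Rightarrow> vfun \<Rightarrow> vfun" where
  "T_N h F = (\<lambda>s. T1 (N_conj s h) (F s))"

text \<open>The operator of an element of \<open>P\<close> on arbitrary functions, and on classes.\<close>

definition T_fun :: "nat \<Rightarrow> nat \<Rightarrow> complex mat \<Rightarrow> vfun \<Rightarrow> vfun" where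
  "T_fun p q g F = (case P_factors p q g of (s, h) \<Rightarrow> T_S s (T_N h F))"

definition T_rep :: "nat \<Rightarrow> nat \<Rightarrow> complex mat \<Rightarrow> vfun set \<Rightarrow> vfun set" where
  "T_rep p q g X = (\<Union>F\<in>X. ae_class p q (T_fun p q g F))"

definition f_vac :: vfun where
  "f_vac = (\<lambda>s z. exp (- mat_trace (s * mat_adjoint s)))"

definition b_cocycle :: "nat \<Rightarrow> nat \<Rightarrow> complex mat \<Rightarrow> vfun set" where
  "b_cocycle p q g = ae_class p q (\<lambda>s z. T_fun p q g f_vac s z - f_vac s z)"

definition L_space :: "nat \<Rightarrow> nat \<Rightarrow> (complex, vfun set) module" where
  "L_space p q = (L2_space p q)
     \<lparr>carrier := module.span class_ring (L2_space p q) (b_cocycle p q ` P_group p q)\<rparr>"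

end

theory Submission
  imports Defs "HOL-Probability.Distributions"
begin

text \<open>
  Write \<open>m = q - p\<close>. The vector \<open>f\<close> is one member of a family of functions permuted by \<open>P\<close>,
  and the index set of the family carries an action of all of \<open>U(p,q)\<close>. The index set is the Siegel
  domain: the set of \<open>p\<close>-dimensional subspaces on which the hermitian form \<open>\<sigma>\<close> is negative definite.
  Such a subspace is spanned by the columns of a unique matrix \<open>v\<close> with block rows \<open>1, B, C\<close>, and
  \<open>U(p,q)\<close> acts on these matrices by \<open>v \<mapsto> g v a\<^sup>-\<^sup>1\<close>, where \<open>a\<close> is the first block row of \<open>g v\<close>
  (\<open>act_siegel\<close>, \<open>act_comp\<close>). Put
  \<open>\<phi>\<^sub>v(s, z) = exp (tr (s C s\<^sup>* ) + tr (z B s\<^sup>* ))\<close>. A direct computation gives \<open>T(g) \<phi>\<^sub>v = \<phi>\<close> at the point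
  \<open>g v\<close>, for \<open>g\<close> in \<open>P\<close> (\<open>T_fun_phi\<close>), and \<open>f\<close> is the function of the base point \<open>B = 0, C = -1\<close>.
  By the Cholesky decomposition \<open>P\<close> is transitive on the domain (\<open>P_transitive\<close>), so the vectors \<open>b(g)\<close>
  are exactly the differences \<open>\<phi>\<^sub>v - f\<close>, and \<open>L\<close> consists of the classes of the finite combinations
  \<open>\<Sum> c\<^sub>v \<phi>\<^sub>v\<close> with \<open>\<Sum> c\<^sub>v = 0\<close> (\<open>L_carrier\<close>).

  The functions \<open>\<phi>\<^sub>v\<close> are linearly independent, even modulo null sets (\<open>comb_class_inj\<close>): by continuity an
  almost everywhere relation holds everywhere, some point \<open>(s, z)\<close> gives distinct exponents to all the
  functions involved, and along the ray through that point one is left with exponentials of distinct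
  rates (\<open>phi_independent\<close>). Hence \<open>L\<close> is isomorphic to the space of finitely supported functions with
  sum zero on the domain, and any permutation of the domain induces a linear operator on it. No bound on the
  operator is needed. The action of \<open>U(p,q)\<close> on the domain thus extends the representation, and
  \<open>g \<mapsto> g f - f\<close>, meaning \<open>\<phi>\<close> at the image of the base point under \<open>g\<close> minus \<open>\<phi>\<close> at the base point,
  extends the cocycle.

  The analytic content is that these objects live in \<open>L\<^sup>2(S, \<nu>; K)\<close>. The norm of \<open>\<phi>\<^sub>v(s)\<close> in \<open>K\<close> is
  a Gaussian integral and decays rapidly for large \<open>s\<close>. It tends to \<open>1\<close> for small \<open>s\<close>, so
  \<open>\<phi>\<^sub>v\<close> itself is not square integrable: \<open>S\<close> has real dimension \<open>p\<^sup>2\<close>, which is just the exponent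
  in the density of \<open>\<nu>\<close>. A difference of two of the functions is of first order in \<open>s\<close>, however, and is
  therefore square integrable (\<open>phi_diff_bound\<close>, \<open>nn_integral_nu_min\<close>, \<open>phi_diff_square_int\<close>).
  Finally, \<open>T\<close> acts on classes because right translations of \<open>S\<close> preserve the null sets of \<open>\<nu>\<close>
  (\<open>nu_right_mult\<close>).
\<close>

section \<open>Adjoint, trace and Hilbert-Schmidt norm\<close>

lemma adj_dims [simp]:
  "dim_row (mat_adjoint A) = dim_col A" "dim_col (mat_adjoint A) = dim_row A"
  unfolding mat_adjoint_def by auto

lemma adj_index [simp]:
  fixes A :: "complex mat"
  assumes "i < dim_col A" "j < dim_row A"
  shows "mat_adjoint A $$ (i, j) = cnj (A $$ (j, i))"
  using assms unfolding mat_adjoint_def by (simp add: mat_of_rows_index)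

lemma adj_carrier [intro, simp]: "A \<in> carrier_mat n k \<Longrightarrow> mat_adjoint A \<in> carrier_mat k n"
  by (intro carrier_matI) simp_all

lemma adj_adj [simp]: "mat_adjoint (mat_adjoint A) = (A :: complex mat)"
  by (rule eq_matI) auto

lemma adj_mult:
  fixes A B :: "complex mat"
  assumes "A \<in> carrier_mat n k" "B \<in> carrier_mat k l"
  shows "mat_adjoint (A * B) = mat_adjoint B * mat_adjoint A"
  using assms by (intro eq_matI) (auto simp: scalar_prod_def mult.commute intro!: sum.cong)

lemma adj_add:
  fixes A B :: "complex mat"
  assumes "A \<in> carrier_mat n k" "B \<in> carrier_mat n k"
  shows "mat_adjoint (A + B) = mat_adjoint A + mat_adjoint B"
  using assms by (intro eq_matI) auto

lemma adj_minus:
  fixes A B :: "complex mat"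
  assumes "A \<in> carrier_mat n k" "B \<in> carrier_mat n k"
  shows "mat_adjoint (A - B) = mat_adjoint A - mat_adjoint B"
  using assms by (intro eq_matI) auto

lemma adj_uminus: "mat_adjoint (- A) = - mat_adjoint (A :: complex mat)"
  by (intro eq_matI) auto

lemma adj_smult: "mat_adjoint (c \<cdot>\<^sub>m A) = cnj c \<cdot>\<^sub>m mat_adjoint A"
  by (intro eq_matI) auto

lemma adj_one [simp]: "mat_adjoint (1\<^sub>m n :: complex mat) = 1\<^sub>m n"
  by (intro eq_matI) auto

lemma adj_zero [simp]: "mat_adjoint (0\<^sub>m n k :: complex mat) = 0\<^sub>m k n"
  by (intro eq_matI) auto

lemma trace_mult:
  assumes "A \<in> carrier_mat n k" "B \<in> carrier_mat k n"
  shows "mat_trace (A * B) = (\<Sum>i<n. \<Sum>j<k. A $$ (i, j) * B $$ (j, i))"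
  using assms unfolding mat_trace_def
  by (auto simp: scalar_prod_def atLeast0LessThan intro!: sum.cong)

lemma trace_comm:
  assumes "A \<in> carrier_mat n k" "B \<in> carrier_mat k n"
  shows "mat_trace (A * B) = mat_trace (B * A)"
  unfolding trace_mult[OF assms] trace_mult[OF assms(2,1)]
  by (subst sum.swap) (simp add: mult.commute)

lemma trace_add:
  assumes "A \<in> carrier_mat n n" "B \<in> carrier_mat n n"
  shows "mat_trace (A + B) = mat_trace A + mat_trace B"
  using assms unfolding mat_trace_def by (auto simp: sum.distrib)

lemma trace_minus:
  assumes "A \<in> carrier_mat n n" "B \<in> carrier_mat n n"
  shows "mat_trace (A - B) = mat_trace A - mat_trace B"
  using assms unfolding mat_trace_def by (auto simp: sum_subtractf)

lemma trace_smult: "mat_trace (c \<cdot>\<^sub>m A) = c * mat_trace A" if "A \<in> carrier_mat n n"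
  using that unfolding mat_trace_def by (auto simp: sum_distrib_left)

lemma trace_uminus: "mat_trace (- A) = - mat_trace A" if "A \<in> carrier_mat n n"
  using that unfolding mat_trace_def by (auto simp: sum_negf)

lemma trace_adj: "mat_trace (mat_adjoint A) = cnj (mat_trace A)" if "A \<in> carrier_mat n n"
  using that unfolding mat_trace_def by auto

lemma trace_mult_adj_entries:
  assumes "A \<in> carrier_mat n k"
  shows "mat_trace (A * mat_adjoint A) = of_real (\<Sum>i<n. \<Sum>j<k. (cmod (A $$ (i, j)))\<^sup>2)"
proof -
  have "mat_trace (A * mat_adjoint A) = (\<Sum>i<n. \<Sum>j<k. A $$ (i, j) * mat_adjoint A $$ (j, i))"
    by (rule trace_mult) (use assms in auto)
  also have "\<dots> = (\<Sum>i<n. \<Sum>j<k. of_real ((cmod (A $$ (i, j)))\<^sup>2))"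
    using assms by (intro sum.cong) (auto simp: complex_norm_square[symmetric])
  finally show ?thesis by simp
qed

lemma hs_norm_square:
  assumes "A \<in> carrier_mat n k"
  shows "(hs_norm A)\<^sup>2 = (\<Sum>i<n. \<Sum>j<k. (cmod (A $$ (i, j)))\<^sup>2)"
  unfolding hs_norm_def trace_mult_adj_entries[OF assms] by (simp add: sum_nonneg)

lemma hs_norm_nonneg [simp]: "0 \<le> hs_norm A"
proof -
  have "0 \<le> Re (mat_trace (A * mat_adjoint A))"
    by (subst trace_mult_adj_entries[of A "dim_row A" "dim_col A"]) (auto intro!: sum_nonneg)
  then show ?thesis unfolding hs_norm_def by simp
qed

lemma hs_norm_L2:
  assumes "A \<in> carrier_mat n k"
  shows "hs_norm A = L2_set (\<lambda>(i, j). cmod (A $$ (i, j))) ({..<n} \<times> {..<k})"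
proof -
  have "(hs_norm A)\<^sup>2 = (\<Sum>x\<in>{..<n} \<times> {..<k}. (case x of (i, j) \<Rightarrow> cmod (A $$ (i, j)))\<^sup>2)"
    unfolding hs_norm_square[OF assms] sum.cartesian_product by (intro sum.cong) auto
  then show ?thesis unfolding L2_set_def by (metis hs_norm_nonneg real_sqrt_unique)
qed

lemma trace_mult_adj:
  assumes "A \<in> carrier_mat n k"
  shows "mat_trace (A * mat_adjoint A) = of_real ((hs_norm A)\<^sup>2)"
  using assms by (simp only: trace_mult_adj_entries hs_norm_square)

lemma trace_adj_mult:
  assumes "A \<in> carrier_mat n k"
  shows "mat_trace (mat_adjoint A * A) = of_real ((hs_norm A)\<^sup>2)"
  using trace_comm[of A n k "mat_adjoint A"] trace_mult_adj[OF assms] assms by auto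

lemma hs_norm_adj: "hs_norm (mat_adjoint A) = hs_norm A"
proof -
  have "of_real ((hs_norm (mat_adjoint A))\<^sup>2) = (of_real ((hs_norm A)\<^sup>2) :: complex)"
    using trace_adj_mult[of A "dim_row A" "dim_col A"]
      trace_mult_adj[of "mat_adjoint A" "dim_col A" "dim_row A"]
    by auto
  then have "(hs_norm (mat_adjoint A))\<^sup>2 = (hs_norm A)\<^sup>2" using of_real_eq_iff by blast
  then show ?thesis by (simp add: power2_eq_iff_nonneg)
qed

lemma norm_index_le_hs_norm:
  assumes "A \<in> carrier_mat n k" "i < n" "j < k"
  shows "cmod (A $$ (i, j)) \<le> hs_norm A"
  using member_le_L2_set[of "{..<n} \<times> {..<k}" "(i, j)" "\<lambda>(i, j). cmod (A $$ (i, j))"] assms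
  by (auto simp: hs_norm_L2[OF assms(1)])

lemma hs_norm_eq_0_iff:
  assumes "A \<in> carrier_mat n k"
  shows "hs_norm A = 0 \<longleftrightarrow> A = 0\<^sub>m n k"
proof
  assume "hs_norm A = 0"
  then show "A = 0\<^sub>m n k"
    using norm_index_le_hs_norm[OF assms] assms by (intro eq_matI) force+
next
  assume "A = 0\<^sub>m n k"
  then show "hs_norm A = 0" using hs_norm_square[OF assms] by simp
qed

lemma norm_trace_mult_le:
  assumes "A \<in> carrier_mat n k" "B \<in> carrier_mat k n"
  shows "cmod (mat_trace (A * B)) \<le> hs_norm A * hs_norm B"
proof -
  let ?I = "{..<n} \<times> {..<k}"
  have B: "hs_norm B = L2_set (\<lambda>(i, j). cmod (B $$ (j, i))) ?I"
    using assms(2) hs_norm_L2[of "mat_adjoint B" n k]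
    by (auto simp: hs_norm_adj intro!: L2_set_cong)
  have "cmod (mat_trace (A * B)) = cmod (\<Sum>(i, j)\<in>?I. A $$ (i, j) * B $$ (j, i))"
    by (simp add: trace_mult[OF assms] sum.cartesian_product)
  also have "\<dots> \<le> (\<Sum>(i, j)\<in>?I. cmod (A $$ (i, j)) * cmod (B $$ (j, i)))"
    by (rule order_trans[OF norm_sum]) (auto simp: norm_mult intro!: sum_mono)
  also have "\<dots> \<le> hs_norm A * hs_norm B"
    using L2_set_mult_ineq[of "\<lambda>(i, j). cmod (A $$ (i, j))" "\<lambda>(i, j). cmod (B $$ (j, i))" ?I]
    by (simp add: hs_norm_L2[OF assms(1)] B case_prod_unfold)
  finally show ?thesis .
qed

lemma hs_norm_mult_le:
  assumes "A \<in> carrier_mat n k" "B \<in> carrier_mat k l"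
  shows "hs_norm (A * B) \<le> hs_norm A * hs_norm B"
proof -
  have AB: "A * B \<in> carrier_mat n l" using assms by auto
  have entry: "(cmod ((A * B) $$ (i, j)))\<^sup>2
      \<le> (\<Sum>k'<k. (cmod (A $$ (i, k')))\<^sup>2) * (\<Sum>k'<k. (cmod (B $$ (k', j)))\<^sup>2)"
    if ij: "i < n" "j < l" for i j
  proof -
    have "cmod ((A * B) $$ (i, j)) = cmod (\<Sum>k'<k. A $$ (i, k') * B $$ (k', j))"
      using assms ij by (simp add: scalar_prod_def atLeast0LessThan)
    also have "\<dots> \<le> (\<Sum>k'<k. \<bar>cmod (A $$ (i, k'))\<bar> * \<bar>cmod (B $$ (k', j))\<bar>)"
      by (rule order_trans[OF norm_sum]) (auto simp: norm_mult)
    also have "\<dots> \<le> L2_set (\<lambda>k'. cmod (A $$ (i, k'))) {..<k} * L2_set (\<lambda>k'. cmod (B $$ (k', j))) {..<k}"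
      by (rule L2_set_mult_ineq)
    finally have "(cmod ((A * B) $$ (i, j)))\<^sup>2 \<le>
      (L2_set (\<lambda>k'. cmod (A $$ (i, k'))) {..<k} * L2_set (\<lambda>k'. cmod (B $$ (k', j))) {..<k})\<^sup>2"
      by (intro power_mono) auto
    then show ?thesis by (simp add: power_mult_distrib L2_set_def sum_nonneg)
  qed
  have "(hs_norm (A * B))\<^sup>2 \<le> (\<Sum>i<n. \<Sum>j<l.
      (\<Sum>k'<k. (cmod (A $$ (i, k')))\<^sup>2) * (\<Sum>k'<k. (cmod (B $$ (k', j)))\<^sup>2))"
    unfolding hs_norm_square[OF AB] by (intro sum_mono) (use entry in auto)
  also have "\<dots> = (hs_norm A)\<^sup>2 * (hs_norm B)\<^sup>2"
  proof -
    have "(hs_norm B)\<^sup>2 = (\<Sum>j<l. \<Sum>k'<k. (cmod (B $$ (k', j)))\<^sup>2)"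
      unfolding hs_norm_square[OF assms(2)] by (rule sum.swap)
    then show ?thesis unfolding hs_norm_square[OF assms(1)] by (simp only: sum_product)
  qed
  finally have "(hs_norm (A * B))\<^sup>2 \<le> (hs_norm A * hs_norm B)\<^sup>2" by (simp add: power_mult_distrib)
  then show ?thesis by (rule power2_le_imp_le) simp
qed

text \<open>Associativity in terms of the dimensions, which the simplifier can compute.\<close>

lemma massoc:
  fixes A B C :: "complex mat"
  assumes "dim_col A = dim_row B" "dim_col B = dim_row C"
  shows "A * B * C = A * (B * C)"
  using assms by (intro assoc_mult_mat[of A "dim_row A" "dim_row B" B "dim_row C" C "dim_col C"] carrier_matI) simp_all

section \<open>Matrix inverses\<close>

text \<open>The inverse of an invertible matrix; its value at a singular matrix is unspecified.\<close>

abbreviation minv :: "complex mat \<Rightarrow> complex mat" where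
  "minv A \<equiv> the (mat_inverse A)"

lemma minv_props:
  assumes "A \<in> carrier_mat n n" "det A \<noteq> 0"
  shows "minv A \<in> carrier_mat n n" "A * minv A = 1\<^sub>m n" "minv A * A = 1\<^sub>m n"
proof -
  have "A \<in> Units (ring_mat TYPE(complex) n (0 :: nat))"
    by (rule det_non_zero_imp_unit[OF assms])
  then obtain B where B: "mat_inverse A = Some B"
    using mat_inverse(1)[OF assms(1)] by (metis not_None_eq)
  from mat_inverse(2)[OF assms(1) B]
  have "B \<in> carrier_mat n n" "A * B = 1\<^sub>m n" "B * A = 1\<^sub>m n" by simp_all
  then show "minv A \<in> carrier_mat n n" "A * minv A = 1\<^sub>m n" "minv A * A = 1\<^sub>m n"
    by (simp_all only: B option.sel)
qed

lemma det_nonzero_if_trivial_kernel: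
  fixes A :: "complex mat"
  assumes A: "A \<in> carrier_mat n n"
    and ker: "\<And>Y. Y \<in> carrier_mat n 1 \<Longrightarrow> A * Y = 0\<^sub>m n 1 \<Longrightarrow> Y = 0\<^sub>m n 1"
  shows "det A \<noteq> 0"
proof
  assume "det A = 0"
  then obtain y where y: "y \<in> carrier_vec n" "y \<noteq> 0\<^sub>v n" "A *\<^sub>v y = 0\<^sub>v n"
    using det_0_iff_vec_prod_zero_field[OF A] by auto
  let ?Y = "mat n 1 (\<lambda>(i, _). y $ i)"
  have "A * ?Y = 0\<^sub>m n 1"
  proof (rule eq_matI)
    fix i j assume "i < dim_row (0\<^sub>m n 1 :: complex mat)" "j < dim_col (0\<^sub>m n 1 :: complex mat)"
    then have ij: "i < n" "j = 0" by auto
    have "(A * ?Y) $$ (i, j) = (A *\<^sub>v y) $ i"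
      using ij A y(1) by (auto simp: scalar_prod_def intro!: sum.cong)
    then show "(A * ?Y) $$ (i, j) = 0\<^sub>m n 1 $$ (i, j)" using ij y(3) by simp
  qed (use A in auto)
  then have Y0: "?Y = 0\<^sub>m n 1" by (rule ker[OF mat_carrier])
  have "y $ i = 0" if "i < n" for i
  proof -
    have "?Y $$ (i, 0) = (0\<^sub>m n 1 :: complex mat) $$ (i, 0)" using Y0 by simp
    then show ?thesis using that by simp
  qed
  then have "y = 0\<^sub>v n" using y(1) by (intro eq_vecI) auto
  with y(2) show False by simp
qed

lemma det_nonzero_if_left_inverse:
  fixes A :: "complex mat"
  assumes "A \<in> carrier_mat n n" "B \<in> carrier_mat n n" "B * A = 1\<^sub>m n"
  shows "det A \<noteq> 0"
proof -
  have "det B * det A = 1" by (simp only: det_mult[OF assms(2,1), symmetric] assms(3) det_one)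
  then show ?thesis by force
qed

lemma det_adj_nonzero:
  fixes A :: "complex mat"
  assumes "A \<in> carrier_mat n n" "det A \<noteq> 0"
  shows "det (mat_adjoint A) \<noteq> 0"
proof (rule det_nonzero_if_left_inverse[of _ n "mat_adjoint (minv A)"])
  show "mat_adjoint (minv A) * mat_adjoint A = 1\<^sub>m n"
    by (simp only: adj_mult[OF assms(1) minv_props(1)[OF assms], symmetric] minv_props(2)[OF assms] adj_one)
qed (use assms minv_props[OF assms] in auto)

section \<open>Block coordinates\<close>

text \<open>The matrix that selects the \<open>k\<close> rows from \<open>off\<close> on of a matrix with \<open>n\<close> rows.\<close>

definition rsel :: "nat \<Rightarrow> nat \<Rightarrow> nat \<Rightarrow> complex mat" where
  "rsel k off n = mat k n (\<lambda>(i, j). if j = off + i then 1 else 0)"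

lemma rsel_carrier [simp, intro]: "rsel k off n \<in> carrier_mat k n"
  unfolding rsel_def by auto

lemma rsel_dims [simp]: "dim_row (rsel k off n) = k" "dim_col (rsel k off n) = n"
  unfolding rsel_def by auto

lemma rsel_mult_index:
  assumes "M \<in> carrier_mat n l" "off + k \<le> n" "i < k" "j < l"
  shows "(rsel k off n * M) $$ (i, j) = M $$ (off + i, j)"
proof -
  have "(rsel k off n * M) $$ (i, j) = (\<Sum>x<n. rsel k off n $$ (i, x) * M $$ (x, j))"
    using assms by (auto simp: scalar_prod_def atLeast0LessThan)
  also have "\<dots> = (\<Sum>x<n. if x = off + i then M $$ (x, j) else 0)"
    using assms by (intro sum.cong) (auto simp: rsel_def)
  also have "\<dots> = M $$ (off + i, j)" using assms by simp
  finally show ?thesis .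
qed

lemma mult_rsel_index:
  assumes "M \<in> carrier_mat l k" "i < l" "j < n"
  shows "(M * rsel k off n) $$ (i, j) = (if off \<le> j \<and> j < off + k then M $$ (i, j - off) else 0)"
proof -
  have "(M * rsel k off n) $$ (i, j) = (\<Sum>x<k. M $$ (i, x) * rsel k off n $$ (x, j))"
    using assms by (auto simp: scalar_prod_def atLeast0LessThan)
  also have "\<dots> = (\<Sum>x<k. if off \<le> j \<and> x = j - off then M $$ (i, x) else 0)"
    using assms by (intro sum.cong) (auto simp: rsel_def)
  also have "\<dots> = (if off \<le> j \<and> j < off + k then M $$ (i, j - off) else 0)"
  proof (cases "off \<le> j")
    case True
    then show ?thesis by (simp add: less_diff_conv2)
  qed auto
  finally show ?thesis .
qed

text \<open>Left multiplication by \<open>E1\<close>, \<open>E2\<close>, \<open>E3\<close> extracts the three block rows, of heights \<open>p\<close>, \<open>m\<close>, \<open>p\<close>.\<close>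

abbreviation E1 :: "nat \<Rightarrow> nat \<Rightarrow> complex mat" where "E1 p m \<equiv> rsel p 0 (p + m + p)"
abbreviation E2 :: "nat \<Rightarrow> nat \<Rightarrow> complex mat" where "E2 p m \<equiv> rsel m p (p + m + p)"
abbreviation E3 :: "nat \<Rightarrow> nat \<Rightarrow> complex mat" where "E3 p m \<equiv> rsel p (p + m) (p + m + p)"

text \<open>A matrix with \<open>p + m + p\<close> rows is determined by its three block rows.\<close>

lemma eq_by_blocks:
  assumes "M \<in> carrier_mat (p + m + p) l" "M' \<in> carrier_mat (p + m + p) l"
    and "E1 p m * M = E1 p m * M'" "E2 p m * M = E2 p m * M'" "E3 p m * M = E3 p m * M'"
  shows "M = M'"
proof (rule eq_matI)
  fix i j assume ij: "i < dim_row M'" "j < dim_col M'"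
  then have ij': "i < p + m + p" "j < l" using assms by auto
  consider "i < p" | "p \<le> i" "i < p + m" | "p + m \<le> i" by linarith
  then show "M $$ (i, j) = M' $$ (i, j)"
  proof cases
    case 1
    then show ?thesis
      using rsel_mult_index[OF assms(1), of 0 p i j] rsel_mult_index[OF assms(2), of 0 p i j]
        assms(3) ij' by simp
  next
    case 2
    then show ?thesis
      using rsel_mult_index[OF assms(1), of p m "i - p" j] rsel_mult_index[OF assms(2), of p m "i - p" j]
        assms(4) ij' by simp
  next
    case 3
    then show ?thesis
      using rsel_mult_index[OF assms(1), of "p + m" p "i - (p + m)" j]
        rsel_mult_index[OF assms(2), of "p + m" p "i - (p + m)" j] assms(5) ij' by simp
  qed
qed (use assms in auto)

text \<open>The column matrix with given block rows.\<close>

definition blocks :: "nat \<Rightarrow> nat \<Rightarrow> nat \<Rightarrow> complex mat \<Rightarrow> complex mat \<Rightarrow> complex mat \<Rightarrow> complex mat" where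
  "blocks p m l X1 X2 X3 = mat (p + m + p) l (\<lambda>(i, j).
     if i < p then X1 $$ (i, j) else if i < p + m then X2 $$ (i - p, j) else X3 $$ (i - (p + m), j))"

lemma blocks_carrier [simp, intro]: "blocks p m l X1 X2 X3 \<in> carrier_mat (p + m + p) l"
  unfolding blocks_def by auto

lemma E_blocks:
  assumes "X1 \<in> carrier_mat p l" "X2 \<in> carrier_mat m l" "X3 \<in> carrier_mat p l"
  shows "E1 p m * blocks p m l X1 X2 X3 = X1" "E2 p m * blocks p m l X1 X2 X3 = X2"
    "E3 p m * blocks p m l X1 X2 X3 = X3"
proof -
  have d: "dim_row (blocks p m l X1 X2 X3) = p + m + p" "dim_col (blocks p m l X1 X2 X3) = l"
    by (simp_all add: blocks_def)
  have ix: "blocks p m l X1 X2 X3 $$ (i, j) = (if i < p then X1 $$ (i, j)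
      else if i < p + m then X2 $$ (i - p, j) else X3 $$ (i - (p + m), j))"
    if "i < p + m + p" "j < l" for i j
    using that by (simp add: blocks_def)
  note r = rsel_mult_index[OF blocks_carrier[of p m l X1 X2 X3]] d ix
  show "E1 p m * blocks p m l X1 X2 X3 = X1" "E2 p m * blocks p m l X1 X2 X3 = X2"
    "E3 p m * blocks p m l X1 X2 X3 = X3"
    by (rule eq_matI; use assms in \<open>auto simp: r simp del: index_mult_mat(1)\<close>)+
qed

lemma three_block_carrier:
  assumes "A11 \<in> carrier_mat p p" "A12 \<in> carrier_mat p m" "A13 \<in> carrier_mat p p"
    "A21 \<in> carrier_mat m p" "A22 \<in> carrier_mat m m" "A23 \<in> carrier_mat m p"
    "A31 \<in> carrier_mat p p" "A32 \<in> carrier_mat p m" "A33 \<in> carrier_mat p p"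
  shows "three_block_mat A11 A12 A13 A21 A22 A23 A31 A32 A33 \<in> carrier_mat (p + m + p) (p + m + p)"
  using assms unfolding three_block_mat_def four_block_mat_def Let_def by auto

lemma three_block_index:
  assumes "A11 \<in> carrier_mat p p" "A12 \<in> carrier_mat p m" "A13 \<in> carrier_mat p p"
    "A21 \<in> carrier_mat m p" "A22 \<in> carrier_mat m m" "A23 \<in> carrier_mat m p"
    "A31 \<in> carrier_mat p p" "A32 \<in> carrier_mat p m" "A33 \<in> carrier_mat p p"
    "i < p + m + p" "j < p + m + p"
  shows "three_block_mat A11 A12 A13 A21 A22 A23 A31 A32 A33 $$ (i, j) =
    (if i < p then if j < p then A11 $$ (i, j) else if j < p + m then A12 $$ (i, j - p) else A13 $$ (i, j - (p + m))
     else if i < p + m then if j < p then A21 $$ (i - p, j) else if j < p + m then A22 $$ (i - p, j - p)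
       else A23 $$ (i - p, j - (p + m))
     else if j < p then A31 $$ (i - (p + m), j) else if j < p + m then A32 $$ (i - (p + m), j - p)
       else A33 $$ (i - (p + m), j - (p + m)))"
  using assms unfolding three_block_mat_def by (auto simp: append_rows_def four_block_mat_def Let_def)

lemma E_three_block:
  assumes "A11 \<in> carrier_mat p p" "A12 \<in> carrier_mat p m" "A13 \<in> carrier_mat p p"
    "A21 \<in> carrier_mat m p" "A22 \<in> carrier_mat m m" "A23 \<in> carrier_mat m p"
    "A31 \<in> carrier_mat p p" "A32 \<in> carrier_mat p m" "A33 \<in> carrier_mat p p"
  defines "M \<equiv> three_block_mat A11 A12 A13 A21 A22 A23 A31 A32 A33"
  shows "E1 p m * M = A11 * E1 p m + A12 * E2 p m + A13 * E3 p m"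
    and "E2 p m * M = A21 * E1 p m + A22 * E2 p m + A23 * E3 p m"
    and "E3 p m * M = A31 * E1 p m + A32 * E2 p m + A33 * E3 p m"
proof -
  have M: "M \<in> carrier_mat (p + m + p) (p + m + p)"
    unfolding M_def by (rule three_block_carrier[OF assms(1-9)])
  note ix = three_block_index[OF assms(1-9), folded M_def]
  note ms = mult_rsel_index[OF assms(1)] mult_rsel_index[OF assms(2)] mult_rsel_index[OF assms(3)]
    mult_rsel_index[OF assms(4)] mult_rsel_index[OF assms(5)] mult_rsel_index[OF assms(6)]
    mult_rsel_index[OF assms(7)] mult_rsel_index[OF assms(8)] mult_rsel_index[OF assms(9)]
  show "E1 p m * M = A11 * E1 p m + A12 * E2 p m + A13 * E3 p m"
  proof (rule eq_matI)
    fix i j assume "i < dim_row (A11 * E1 p m + A12 * E2 p m + A13 * E3 p m)"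
      "j < dim_col (A11 * E1 p m + A12 * E2 p m + A13 * E3 p m)"
    then have "i < p" "j < p + m + p" using assms by auto
    then show "(E1 p m * M) $$ (i, j) = (A11 * E1 p m + A12 * E2 p m + A13 * E3 p m) $$ (i, j)"
      using assms(1-9) by (simp add: rsel_mult_index[OF M] ix ms del: index_mult_mat(1))
  qed (use assms M in auto)
  show "E2 p m * M = A21 * E1 p m + A22 * E2 p m + A23 * E3 p m"
  proof (rule eq_matI)
    fix i j assume "i < dim_row (A21 * E1 p m + A22 * E2 p m + A23 * E3 p m)"
      "j < dim_col (A21 * E1 p m + A22 * E2 p m + A23 * E3 p m)"
    then have "i < m" "j < p + m + p" using assms by auto
    then show "(E2 p m * M) $$ (i, j) = (A21 * E1 p m + A22 * E2 p m + A23 * E3 p m) $$ (i, j)"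
      using assms(1-9) by (simp add: rsel_mult_index[OF M] ix ms del: index_mult_mat(1))
  qed (use assms M in auto)
  show "E3 p m * M = A31 * E1 p m + A32 * E2 p m + A33 * E3 p m"
  proof (rule eq_matI)
    fix i j assume "i < dim_row (A31 * E1 p m + A32 * E2 p m + A33 * E3 p m)"
      "j < dim_col (A31 * E1 p m + A32 * E2 p m + A33 * E3 p m)"
    then have "i < p" "j < p + m + p" using assms by auto
    then show "(E3 p m * M) $$ (i, j) = (A31 * E1 p m + A32 * E2 p m + A33 * E3 p m) $$ (i, j)"
      using assms(1-9) by (simp add: rsel_mult_index[OF M] ix ms del: index_mult_mat(1))
  qed (use assms M in auto)
qed

lemma E_three_block_mult:
  assumes "A11 \<in> carrier_mat p p" "A12 \<in> carrier_mat p m" "A13 \<in> carrier_mat p p"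
    "A21 \<in> carrier_mat m p" "A22 \<in> carrier_mat m m" "A23 \<in> carrier_mat m p"
    "A31 \<in> carrier_mat p p" "A32 \<in> carrier_mat p m" "A33 \<in> carrier_mat p p"
    and X: "X \<in> carrier_mat (p + m + p) l"
  defines "M \<equiv> three_block_mat A11 A12 A13 A21 A22 A23 A31 A32 A33"
  shows "E1 p m * (M * X) = A11 * (E1 p m * X) + A12 * (E2 p m * X) + A13 * (E3 p m * X)"
    and "E2 p m * (M * X) = A21 * (E1 p m * X) + A22 * (E2 p m * X) + A23 * (E3 p m * X)"
    and "E3 p m * (M * X) = A31 * (E1 p m * X) + A32 * (E2 p m * X) + A33 * (E3 p m * X)"
proof -
  have M: "M \<in> carrier_mat (p + m + p) (p + m + p)"
    unfolding M_def by (rule three_block_carrier[OF assms(1-9)])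
  note as = assoc_mult_mat[OF rsel_carrier M X, symmetric] E_three_block[OF assms(1-9), folded M_def]
  have gen: "(P * E1 p m + Q * E2 p m + R * E3 p m) * X = P * (E1 p m * X) + Q * (E2 p m * X) + R * (E3 p m * X)"
    if "P \<in> carrier_mat k p" "Q \<in> carrier_mat k m" "R \<in> carrier_mat k p" for P Q R k
  proof -
    have "(P * E1 p m + Q * E2 p m + R * E3 p m) * X = P * E1 p m * X + Q * E2 p m * X + R * E3 p m * X"
      using that X by (subst add_mult_distrib_mat[of _ k "p + m + p"], auto)+
    then show ?thesis using that X by (simp add: assoc_mult_mat[OF _ rsel_carrier X])
  qed
  show "E1 p m * (M * X) = A11 * (E1 p m * X) + A12 * (E2 p m * X) + A13 * (E3 p m * X)"
    unfolding as by (rule gen[OF assms(1-3)])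
  show "E2 p m * (M * X) = A21 * (E1 p m * X) + A22 * (E2 p m * X) + A23 * (E3 p m * X)"
    unfolding as by (rule gen[OF assms(4-6)])
  show "E3 p m * (M * X) = A31 * (E1 p m * X) + A32 * (E2 p m * X) + A33 * (E3 p m * X)"
    unfolding as by (rule gen[OF assms(7-9)])
qed

text \<open>Products with adjoints decompose along the block rows.\<close>

lemma adj_mult_blocks:
  assumes X: "X \<in> carrier_mat (p + m + p) k" and Y: "Y \<in> carrier_mat (p + m + p) l"
  shows "mat_adjoint X * Y = mat_adjoint (E1 p m * X) * (E1 p m * Y)
    + mat_adjoint (E2 p m * X) * (E2 p m * Y) + mat_adjoint (E3 p m * X) * (E3 p m * Y)"
proof (rule eq_matI)
  fix i j assume "i < dim_row (mat_adjoint (E1 p m * X) * (E1 p m * Y)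
    + mat_adjoint (E2 p m * X) * (E2 p m * Y) + mat_adjoint (E3 p m * X) * (E3 p m * Y))"
    "j < dim_col (mat_adjoint (E1 p m * X) * (E1 p m * Y)
    + mat_adjoint (E2 p m * X) * (E2 p m * Y) + mat_adjoint (E3 p m * X) * (E3 p m * Y))"
  then have ij: "i < k" "j < l" using X Y by auto
  let ?f = "\<lambda>x. cnj (X $$ (x, i)) * Y $$ (x, j)"
  have blk: "(mat_adjoint (rsel n off (p + m + p) * X) * (rsel n off (p + m + p) * Y)) $$ (i, j)
      = (\<Sum>x<n. ?f (off + x))" if "off + n \<le> p + m + p" for n off
  proof -
    have "(mat_adjoint (rsel n off (p + m + p) * X) * (rsel n off (p + m + p) * Y)) $$ (i, j)
      = (\<Sum>x<n. mat_adjoint (rsel n off (p + m + p) * X) $$ (i, x) * (rsel n off (p + m + p) * Y) $$ (x, j))"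
      using ij X Y by (simp add: index_mult_mat(1)[of i "mat_adjoint _"] scalar_prod_def atLeast0LessThan
        del: adj_index)
    also have "\<dots> = (\<Sum>x<n. ?f (off + x))"
      using ij X Y that by (intro sum.cong refl)
        (simp add: rsel_mult_index[OF X] rsel_mult_index[OF Y] del: index_mult_mat(1))
    finally show ?thesis .
  qed
  have "(mat_adjoint X * Y) $$ (i, j) = (\<Sum>x<p + m + p. ?f x)"
    using ij X Y by (simp add: scalar_prod_def atLeast0LessThan)
  also have "\<dots> = (\<Sum>x<p. ?f x) + (\<Sum>x<m. ?f (p + x)) + (\<Sum>x<p. ?f (p + m + x))"
    by (simp add: sum.nat_group[symmetric] lessThan_atLeast0 sum.atLeastLessThan_concat[of 0 "p + m" "p + m + p", symmetric]
        sum.atLeastLessThan_concat[of 0 p "p + m", symmetric] sum.shift_bounds_nat_ivl[of _ 0 _ m, symmetric]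
        sum.atLeastLessThan_shift_0[of _ p "p + m"] sum.atLeastLessThan_shift_0[of _ "p + m" "p + m + p"])
  finally show "(mat_adjoint X * Y) $$ (i, j) = (mat_adjoint (E1 p m * X) * (E1 p m * Y)
    + mat_adjoint (E2 p m * X) * (E2 p m * Y) + mat_adjoint (E3 p m * X) * (E3 p m * Y)) $$ (i, j)"
    using ij X Y blk[of 0 p] blk[of p m] blk[of "p + m" p]
    by (simp del: index_mult_mat(1) add: index_add_mat(1))
qed (use X Y in auto)

section \<open>The action of the group on the Siegel domain\<close>

lemma sigma_carrier [simp, intro]: "sigma_mat p m \<in> carrier_mat (p + m + p) (p + m + p)"
  unfolding sigma_mat_def by (rule three_block_carrier) auto

lemma E_sigma:
  assumes "X \<in> carrier_mat (p + m + p) l"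
  shows "E1 p m * (sigma_mat p m * X) = E3 p m * X"
    and "E2 p m * (sigma_mat p m * X) = E2 p m * X"
    and "E3 p m * (sigma_mat p m * X) = E1 p m * X"
proof -
  have c: "E1 p m * X \<in> carrier_mat p l" "E2 p m * X \<in> carrier_mat m l" "E3 p m * X \<in> carrier_mat p l"
    using assms by auto
  note e = E_three_block_mult[of "0\<^sub>m p p" p "0\<^sub>m p m" m "1\<^sub>m p" "0\<^sub>m m p" "1\<^sub>m m" "0\<^sub>m m p"
      "1\<^sub>m p" "0\<^sub>m p m" "0\<^sub>m p p" X l, folded sigma_mat_def, OF _ _ _ _ _ _ _ _ _ assms]
  show "E1 p m * (sigma_mat p m * X) = E3 p m * X"
    and "E2 p m * (sigma_mat p m * X) = E2 p m * X"
    and "E3 p m * (sigma_mat p m * X) = E1 p m * X"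
    using c by (simp_all add: e left_mult_zero_mat[OF c(1)] left_mult_zero_mat[OF c(2)] left_mult_zero_mat[OF c(3)]
        left_mult_one_mat[OF c(1)] left_mult_one_mat[OF c(2)] left_mult_one_mat[OF c(3)]
        left_add_zero_mat[OF c(1)] left_add_zero_mat[OF c(2)] left_add_zero_mat[OF c(3)]
        right_add_zero_mat[OF c(1)] right_add_zero_mat[OF c(2)] right_add_zero_mat[OF c(3)])
qed

lemma sigma_square: "sigma_mat p m * sigma_mat p m = 1\<^sub>m (p + m + p)"
proof (rule eq_by_blocks[of _ p m "p + m + p"])
  have one: "sigma_mat p m = sigma_mat p m * 1\<^sub>m (p + m + p)" by (rule right_mult_one_mat[symmetric]) auto
  note s = E_sigma[of "sigma_mat p m" p m "p + m + p"] E_sigma[of "1\<^sub>m (p + m + p)" p m "p + m + p", folded one]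
  show "E1 p m * (sigma_mat p m * sigma_mat p m) = E1 p m * 1\<^sub>m (p + m + p)"
    "E2 p m * (sigma_mat p m * sigma_mat p m) = E2 p m * 1\<^sub>m (p + m + p)"
    "E3 p m * (sigma_mat p m * sigma_mat p m) = E3 p m * 1\<^sub>m (p + m + p)"
    by (simp_all add: s)
qed (auto intro!: mult_carrier_mat[OF sigma_carrier])

text \<open>The indefinite form on \<open>(p + m + p) \<times> k\<close> matrices (for \<open>k = 1\<close>: on column vectors).\<close>

definition sig_form :: "nat \<Rightarrow> nat \<Rightarrow> complex mat \<Rightarrow> real" where
  "sig_form p m X = Re (mat_trace (mat_adjoint X * (sigma_mat p m * X)))"

lemma sig_form_blocks:
  assumes "X \<in> carrier_mat (p + m + p) k"
  shows "sig_form p m X = 2 * Re (mat_trace (mat_adjoint (E1 p m * X) * (E3 p m * X))) + (hs_norm (E2 p m * X))\<^sup>2"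
proof -
  let ?A = "E1 p m * X" and ?B = "E2 p m * X" and ?C = "E3 p m * X"
  have c: "?A \<in> carrier_mat p k" "?B \<in> carrier_mat m k" "?C \<in> carrier_mat p k" using assms by auto
  have "mat_adjoint X * (sigma_mat p m * X)
      = mat_adjoint ?A * ?C + mat_adjoint ?B * ?B + mat_adjoint ?C * ?A"
    by (rule adj_mult_blocks[OF assms mult_carrier_mat[OF sigma_carrier assms], unfolded E_sigma[OF assms]])
  moreover have "mat_trace (mat_adjoint ?C * ?A) = cnj (mat_trace (mat_adjoint ?A * ?C))"
  proof -
    have "mat_adjoint ?C * ?A = mat_adjoint (mat_adjoint ?A * ?C)"
      by (simp only: adj_mult[OF adj_carrier[OF c(1)] c(3)] adj_adj)
    moreover have "mat_adjoint ?A * ?C \<in> carrier_mat k k" by (rule mult_carrier_mat[OF adj_carrier[OF c(1)] c(3)])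
    ultimately show ?thesis using trace_adj[of "mat_adjoint ?A * ?C" k] by simp
  qed
  moreover have "mat_trace (mat_adjoint ?B * ?B) = of_real ((hs_norm ?B)\<^sup>2)"
    by (rule trace_adj_mult[OF c(2)])
  moreover have "mat_trace (mat_adjoint ?A * ?C + mat_adjoint ?B * ?B + mat_adjoint ?C * ?A)
    = mat_trace (mat_adjoint ?A * ?C) + mat_trace (mat_adjoint ?B * ?B) + mat_trace (mat_adjoint ?C * ?A)"
    using mult_carrier_mat[OF adj_carrier[OF c(1)] c(3)] mult_carrier_mat[OF adj_carrier[OF c(2)] c(2)]
      mult_carrier_mat[OF adj_carrier[OF c(3)] c(1)]
    by (simp add: trace_add[of _ k])
  ultimately show ?thesis unfolding sig_form_def by simp
qed

lemma U_group_carrier: "g \<in> U_group p (p + m) \<Longrightarrow> g \<in> carrier_mat (p + m + p) (p + m + p)"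
  unfolding U_group_def by (auto simp: ac_simps)

text \<open>The defining relation \<open>g \<sigma> g\<^sup>* = \<sigma>\<close> implies \<open>g\<^sup>* \<sigma> g = \<sigma>\<close> because \<open>\<sigma>\<close> is an involution; it is
  the second relation that makes \<open>g\<close> preserve the form on column vectors.\<close>

lemma U_group_adj:
  assumes "g \<in> U_group p (p + m)"
  shows "mat_adjoint g * (sigma_mat p m * g) = sigma_mat p m"
proof -
  let ?s = "sigma_mat p m" and ?n = "p + m + p"
  have g: "g \<in> carrier_mat ?n ?n" and gs: "g * ?s * mat_adjoint g = ?s"
    using assms U_group_carrier unfolding U_group_def by auto
  note d = carrier_matD[OF g] carrier_matD[OF sigma_carrier[of p m]] massoc
  have "g * (?s * (mat_adjoint g * ?s)) = 1\<^sub>m ?n"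
  proof -
    have "g * (?s * (mat_adjoint g * ?s)) = (g * ?s * mat_adjoint g) * ?s"
      by (simp add: d)
    then show ?thesis by (simp only: gs sigma_square)
  qed
  then have "(?s * (mat_adjoint g * ?s)) * g = 1\<^sub>m ?n"
    by (rule mat_mult_left_right_inverse[rotated 2]) (auto intro!: carrier_matI simp: d)
  then have 1: "?s * (mat_adjoint g * (?s * g)) = 1\<^sub>m ?n"
    by (simp add: d)
  have "?s = ?s * (?s * (mat_adjoint g * (?s * g)))"
    unfolding 1 by (rule right_mult_one_mat[OF sigma_carrier, symmetric])
  also have "\<dots> = (?s * ?s) * (mat_adjoint g * (?s * g))"
    by (simp add: d)
  also have "\<dots> = mat_adjoint g * (?s * g)"
    unfolding sigma_square by (rule left_mult_one_mat) (auto intro!: carrier_matI simp: d)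
  finally show ?thesis by simp
qed

lemma sig_form_U_group:
  assumes "g \<in> U_group p (p + m)" "X \<in> carrier_mat (p + m + p) k"
  shows "sig_form p m (g * X) = sig_form p m X"
proof -
  let ?s = "sigma_mat p m" and ?n = "p + m + p"
  have g: "g \<in> carrier_mat ?n ?n" by (rule U_group_carrier[OF assms(1)])
  have "mat_adjoint (g * X) * (?s * (g * X)) = (mat_adjoint X * mat_adjoint g) * (?s * (g * X))"
    using adj_mult[OF g assms(2)] by simp
  also have "\<dots> = mat_adjoint X * ((mat_adjoint g * (?s * g)) * X)"
    by (simp add: massoc carrier_matD[OF g] carrier_matD[OF assms(2)] carrier_matD[OF sigma_carrier])
  also have "\<dots> = mat_adjoint X * (?s * X)" by (simp only: U_group_adj[OF assms(1)])
  finally show ?thesis unfolding sig_form_def by simp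
qed

text \<open>Points of the Siegel domain: a negative subspace of dimension \<open>p\<close>, given by the unique
  matrix whose columns span it and whose first block row is the identity.\<close>

definition siegel :: "nat \<Rightarrow> nat \<Rightarrow> complex mat set" where
  "siegel p m = {v \<in> carrier_mat (p + m + p) p. E1 p m * v = 1\<^sub>m p \<and>
     (\<forall>Y \<in> carrier_mat p 1. Y \<noteq> 0\<^sub>m p 1 \<longrightarrow> sig_form p m (v * Y) < 0)}"

text \<open>The action on subspaces: multiply by \<open>g\<close> and renormalise.\<close>

definition act :: "nat \<Rightarrow> nat \<Rightarrow> complex mat \<Rightarrow> complex mat \<Rightarrow> complex mat" where
  "act p m g v = g * v * minv (E1 p m * (g * v))"

lemma siegel_carrier: "v \<in> siegel p m \<Longrightarrow> v \<in> carrier_mat (p + m + p) p"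
  unfolding siegel_def by auto

lemma siegel_E1: "v \<in> siegel p m \<Longrightarrow> E1 p m * v = 1\<^sub>m p"
  unfolding siegel_def by auto

lemma act_eqI:
  assumes g: "g \<in> carrier_mat (p + m + p) (p + m + p)" and v: "v \<in> carrier_mat (p + m + p) p"
    and v': "v' \<in> carrier_mat (p + m + p) p" "E1 p m * v' = 1\<^sub>m p"
    and A: "A \<in> carrier_mat p p" "det A \<noteq> 0" and eq: "g * v = v' * A"
  shows "act p m g v = v'"
proof -
  have "E1 p m * (g * v) = (E1 p m * v') * A"
    unfolding eq by (simp add: massoc carrier_matD[OF v'(1)] carrier_matD[OF A(1)])
  also have "\<dots> = A" using A by (simp add: v')
  finally have "act p m g v = v' * A * minv A" unfolding act_def eq by simp
  also have "\<dots> = v' * (A * minv A)"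
    by (simp add: massoc carrier_matD[OF v'(1)] carrier_matD[OF A(1)] carrier_matD[OF minv_props(1)[OF A]])
  also have "\<dots> = v'" using minv_props[OF A] v' by simp
  finally show ?thesis .
qed

text \<open>The action is well defined on the domain: the first block row of \<open>g v\<close> is invertible.\<close>

lemma act_props:
  assumes g: "g \<in> U_group p (p + m)" and v: "v \<in> siegel p m"
  shows act_siegel: "act p m g v \<in> siegel p m"
    and act_denom: "E1 p m * (g * v) \<in> carrier_mat p p" "det (E1 p m * (g * v)) \<noteq> 0"
    and act_mult: "g * v = act p m g v * (E1 p m * (g * v))"
proof -
  let ?n = "p + m + p" and ?A = "E1 p m * (g * v)"
  note gc = U_group_carrier[OF g] and vc = siegel_carrier[OF v]
  note d = carrier_matD[OF gc] carrier_matD[OF vc] massoc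
  have gv: "g * v \<in> carrier_mat ?n p" by (rule mult_carrier_mat[OF gc vc])
  show A: "?A \<in> carrier_mat p p" by (rule mult_carrier_mat[OF rsel_carrier gv])
  have neg: "sig_form p m ((g * v) * Y) < 0" if "Y \<in> carrier_mat p 1" "Y \<noteq> 0\<^sub>m p 1" for Y
  proof -
    have "(g * v) * Y = g * (v * Y)" using carrier_matD[OF that(1)] by (simp add: d)
    then have "sig_form p m ((g * v) * Y) = sig_form p m (v * Y)"
      using sig_form_U_group[OF g, of "v * Y" 1] vc that by auto
    then show ?thesis using v that unfolding siegel_def by auto
  qed
  \<comment> \<open>A vector with vanishing first block row has a nonnegative form, so a kernel vector \<open>Y\<close> would
    contradict the negativity of the form on \<open>g v Y\<close>.\<close>
  show dA: "det ?A \<noteq> 0"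
  proof (rule det_nonzero_if_trivial_kernel[OF A], rule ccontr)
    fix Y assume Y: "Y \<in> carrier_mat p 1" and AY: "?A * Y = 0\<^sub>m p 1" and "Y \<noteq> 0\<^sub>m p 1"
    then have "sig_form p m ((g * v) * Y) < 0" using neg by blast
    moreover have "E1 p m * ((g * v) * Y) = 0\<^sub>m p 1"
      using AY carrier_matD[OF Y] by (simp add: d)
    moreover have "(g * v) * Y \<in> carrier_mat ?n 1" by (rule mult_carrier_mat[OF gv Y])
    moreover have "mat_trace (mat_adjoint (0\<^sub>m p 1) * (E3 p m * ((g * v) * Y))) = 0"
      using carrier_matD[OF calculation(3)] by (subst adj_zero, subst left_mult_zero_mat[of _ p 1]) (auto intro!: carrier_matI simp: mat_trace_def)
    ultimately show False by (simp add: sig_form_blocks)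
  qed
  note I = minv_props[OF A dA]
  note d = d carrier_matD[OF I(1)] carrier_matD[OF A]
  have ac: "act p m g v \<in> carrier_mat ?n p" unfolding act_def by (rule mult_carrier_mat[OF gv I(1)])
  show "g * v = act p m g v * ?A"
  proof -
    have "act p m g v * ?A = (g * v) * (minv ?A * ?A)" unfolding act_def
      by (rule assoc_mult_mat[OF gv I(1) A])
    then show ?thesis by (simp only: I right_mult_one_mat[OF gv])
  qed
  have "E1 p m * act p m g v = 1\<^sub>m p"
  proof -
    have "E1 p m * act p m g v = ?A * minv ?A"
      unfolding act_def by (rule assoc_mult_mat[OF rsel_carrier gv I(1), symmetric])
    then show ?thesis by (simp only: I)
  qed
  moreover have "sig_form p m (act p m g v * Y) < 0" if Y: "Y \<in> carrier_mat p 1" "Y \<noteq> 0\<^sub>m p 1" for Y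
  proof -
    have Y': "minv ?A * Y \<in> carrier_mat p 1" by (rule mult_carrier_mat[OF I(1) Y(1)])
    have "act p m g v * Y = (g * v) * (minv ?A * Y)"
      unfolding act_def by (rule assoc_mult_mat[OF gv I(1) Y(1)])
    moreover have "minv ?A * Y \<noteq> 0\<^sub>m p 1"
    proof
      assume 0: "minv ?A * Y = 0\<^sub>m p 1"
      have "Y = (?A * minv ?A) * Y" unfolding I(2) using Y(1) by simp
      also have "\<dots> = ?A * (minv ?A * Y)" by (rule assoc_mult_mat[OF A I(1) Y(1)])
      also have "\<dots> = 0\<^sub>m p 1" unfolding 0 by (rule right_mult_zero_mat[OF A])
      finally show False using Y by simp
    qed
    ultimately show ?thesis using neg[OF Y'] by simp
  qed
  ultimately show "act p m g v \<in> siegel p m" unfolding siegel_def using ac by auto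
qed

lemma act_one:
  assumes "v \<in> siegel p m"
  shows "act p m (1\<^sub>m (p + m + p)) v = v"
  by (rule act_eqI[where A = "1\<^sub>m p"]) (use siegel_carrier[OF assms] siegel_E1[OF assms] in auto)

lemma act_comp:
  assumes "g \<in> U_group p (p + m)" "h \<in> U_group p (p + m)" "v \<in> siegel p m"
  shows "act p m (g * h) v = act p m g (act p m h v)"
proof -
  let ?n = "p + m + p" and ?w = "act p m h v"
  let ?B = "E1 p m * (h * v)" and ?A = "E1 p m * (g * ?w)"
  note w = act_siegel[OF assms(2,3)]
  note gc = U_group_carrier[OF assms(1)] and hc = U_group_carrier[OF assms(2)]
    and vc = siegel_carrier[OF assms(3)] and wc = siegel_carrier[OF w]
  note B = act_denom[OF assms(2,3)] and A = act_denom[OF assms(1) w]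
  note x = siegel_carrier[OF act_siegel[OF assms(1) w]] siegel_E1[OF act_siegel[OF assms(1) w]]
  have "(g * h) * v = g * (h * v)" by (rule assoc_mult_mat[OF gc hc vc])
  also have "\<dots> = g * (?w * ?B)" using act_mult[OF assms(2,3)] by simp
  also have "\<dots> = (g * ?w) * ?B" by (rule assoc_mult_mat[OF gc wc B(1), symmetric])
  also have "\<dots> = (act p m g ?w * ?A) * ?B" using act_mult[OF assms(1) w] by simp
  also have "\<dots> = act p m g ?w * (?A * ?B)" by (rule assoc_mult_mat[OF x(1) A(1) B(1)])
  finally have eq: "(g * h) * v = act p m g ?w * (?A * ?B)" .
  have AB: "?A * ?B \<in> carrier_mat p p" "det (?A * ?B) \<noteq> 0"
    using mult_carrier_mat[OF A(1) B(1)] A(2) B(2) by (simp_all add: det_mult[OF A(1) B(1)])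
  have "g * h \<in> carrier_mat ?n ?n" by (rule mult_carrier_mat[OF gc hc])
  then show ?thesis by (rule act_eqI[OF _ vc x AB eq])
qed

section \<open>The Iwasawa subgroup\<close>

lemma S_group_carrier: "s \<in> S_group p \<Longrightarrow> s \<in> carrier_mat p p"
  unfolding S_group_def by auto

lemma S_group_det:
  assumes "s \<in> S_group p"
  shows "det s \<noteq> 0"
proof -
  note c = S_group_carrier[OF assms]
  have "det s = prod_list (diag_mat s)"
    by (rule det_lower_triangular[OF _ c]) (use assms in \<open>auto simp: S_group_def\<close>)
  moreover have "0 \<notin> set (diag_mat s)"
  proof -
    have "s $$ (i, i) \<noteq> 0" if "i < p" for i
    proof
      assume "s $$ (i, i) = 0"
      moreover have "0 < Re (s $$ (i, i))" using assms that unfolding S_group_def by blast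
      ultimately show False by simp
    qed
    moreover have "set (diag_mat s) = (\<lambda>i. s $$ (i, i)) ` {0..<p}"
      unfolding diag_mat_def carrier_matD(1)[OF c] by simp
    ultimately show ?thesis by force
  qed
  ultimately show ?thesis by (simp add: prod_list_zero_iff)
qed

lemma S_group_one: "1\<^sub>m p \<in> S_group p"
  unfolding S_group_def by auto

lemma S_adj_inv:
  assumes "s \<in> S_group p"
  shows "minv (mat_adjoint s) \<in> carrier_mat p p" "mat_adjoint s * minv (mat_adjoint s) = 1\<^sub>m p"
    "minv (mat_adjoint s) * mat_adjoint s = 1\<^sub>m p" "det (minv (mat_adjoint s)) \<noteq> 0"
proof -
  note c = S_group_carrier[OF assms]
  note i = minv_props[OF adj_carrier[OF c] det_adj_nonzero[OF c S_group_det[OF assms]]]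
  show "minv (mat_adjoint s) \<in> carrier_mat p p" "mat_adjoint s * minv (mat_adjoint s) = 1\<^sub>m p"
    "minv (mat_adjoint s) * mat_adjoint s = 1\<^sub>m p" by (rule i)+
  show "det (minv (mat_adjoint s)) \<noteq> 0"
    by (rule det_nonzero_if_left_inverse[OF i(1) adj_carrier[OF c] i(2)])
qed

lemma S_embed_blocks:
  assumes s: "s \<in> S_group p" and X: "X \<in> carrier_mat (p + m + p) l"
  shows "E1 p m * (S_embed p m s * X) = minv (mat_adjoint s) * (E1 p m * X)"
    and "E2 p m * (S_embed p m s * X) = E2 p m * X"
    and "E3 p m * (S_embed p m s * X) = s * (E3 p m * X)"
proof -
  note c = S_group_carrier[OF s] and i = S_adj_inv(1)[OF s]
  have d: "E1 p m * X \<in> carrier_mat p l" "E2 p m * X \<in> carrier_mat m l" "E3 p m * X \<in> carrier_mat p l"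
    "minv (mat_adjoint s) * (E1 p m * X) \<in> carrier_mat p l" "s * (E3 p m * X) \<in> carrier_mat p l"
    using X c i by auto
  note e = E_three_block_mult[OF i zero_carrier_mat[of p m] zero_carrier_mat[of p p] zero_carrier_mat[of m p]
      one_carrier_mat[of m] zero_carrier_mat[of m p] zero_carrier_mat[of p p] zero_carrier_mat[of p m] c X,
      folded S_embed_def]
  show "E1 p m * (S_embed p m s * X) = minv (mat_adjoint s) * (E1 p m * X)"
    "E2 p m * (S_embed p m s * X) = E2 p m * X"
    "E3 p m * (S_embed p m s * X) = s * (E3 p m * X)"
    unfolding e using d by auto
qed

lemma S_embed_carrier: "s \<in> S_group p \<Longrightarrow> S_embed p m s \<in> carrier_mat (p + m + p) (p + m + p)"
  unfolding S_embed_def using S_adj_inv(1)[of s p] S_group_carrier[of s p] by (intro three_block_carrier) auto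

text \<open>The bottom left block of an element of \<open>N\<close>.\<close>

definition N_corner :: "complex mat \<Rightarrow> complex mat \<Rightarrow> complex mat" where
  "N_corner n z = n - (1 / 2) \<cdot>\<^sub>m (z * mat_adjoint z)"

lemma N_corner_carrier [simp, intro]:
  "n \<in> carrier_mat p p \<Longrightarrow> z \<in> carrier_mat p m \<Longrightarrow> N_corner n z \<in> carrier_mat p p"
  unfolding N_corner_def by auto

lemma N_embed_blocks:
  assumes n: "n \<in> carrier_mat p p" and z: "z \<in> carrier_mat p m" and X: "X \<in> carrier_mat (p + m + p) l"
  shows "E1 p m * (N_embed p m (n, z) * X) = E1 p m * X"
    and "E2 p m * (N_embed p m (n, z) * X) = E2 p m * X - mat_adjoint z * (E1 p m * X)"
    and "E3 p m * (N_embed p m (n, z) * X) = N_corner n z * (E1 p m * X) + z * (E2 p m * X) + E3 p m * X"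
proof -
  have d: "E1 p m * X \<in> carrier_mat p l" "E2 p m * X \<in> carrier_mat m l" "E3 p m * X \<in> carrier_mat p l"
    using X by auto
  have nz: "- mat_adjoint z \<in> carrier_mat m p" using z by auto
  note e = E_three_block_mult[OF one_carrier_mat[of p] zero_carrier_mat[of p m] zero_carrier_mat[of p p] nz
      one_carrier_mat[of m] zero_carrier_mat[of m p] N_corner_carrier[OF n z] z one_carrier_mat[of p] X,
      unfolded N_corner_def, folded N_embed.simps]
  show "E1 p m * (N_embed p m (n, z) * X) = E1 p m * X"
    unfolding e using d by auto
  show "E3 p m * (N_embed p m (n, z) * X) = N_corner n z * (E1 p m * X) + z * (E2 p m * X) + E3 p m * X"
    unfolding e N_corner_def using d by auto
  have "- mat_adjoint z * (E1 p m * X) = - (mat_adjoint z * (E1 p m * X))"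
    using z d by (intro uminus_mult_left_mat) auto
  then show "E2 p m * (N_embed p m (n, z) * X) = E2 p m * X - mat_adjoint z * (E1 p m * X)"
    unfolding e using d z by (intro eq_matI) (auto simp del: index_mult_mat(1))
qed

lemma N_embed_carrier:
  assumes "n \<in> carrier_mat p p" "z \<in> carrier_mat p m"
  shows "N_embed p m (n, z) \<in> carrier_mat (p + m + p) (p + m + p)"
  unfolding N_embed.simps using assms by (intro three_block_carrier) auto

lemma P_block_row3:
  assumes s: "s \<in> S_group p" and n: "n \<in> carrier_mat p p" and z: "z \<in> carrier_mat p m"
    and X: "X \<in> carrier_mat (p + m + p) l"
  shows "E3 p m * ((S_embed p m s * N_embed p m (n, z)) * X)
    = s * (N_corner n z * (E1 p m * X) + z * (E2 p m * X) + E3 p m * X)"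
proof -
  have "(S_embed p m s * N_embed p m (n, z)) * X = S_embed p m s * (N_embed p m (n, z) * X)"
    by (rule assoc_mult_mat[OF S_embed_carrier[OF s] N_embed_carrier[OF n z] X])
  then show ?thesis
    using S_embed_blocks(3)[OF s mult_carrier_mat[OF N_embed_carrier[OF n z] X]] N_embed_blocks(3)[OF n z X]
    by simp
qed

lemma mat_left_cancel:
  fixes s :: "complex mat"
  assumes "s \<in> carrier_mat p p" "det s \<noteq> 0" "X \<in> carrier_mat p l" "Y \<in> carrier_mat p l" "s * X = s * Y"
  shows "X = Y"
proof -
  note i = minv_props[OF assms(1,2)]
  have "minv s * s * X = minv s * s * Y"
    using assms(5) by (simp only: assoc_mult_mat[OF i(1) assms(1) assms(3)] assoc_mult_mat[OF i(1) assms(1) assms(4)])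
  then show ?thesis using assms(3,4) by (simp only: i left_mult_one_mat)
qed

text \<open>The factors of an element of \<open>P\<close> are read off from its last block row.\<close>

lemma P_factors_eq:
  assumes s: "s \<in> S_group p" and h: "h \<in> N_group p m"
  shows "P_factors p (p + m) (S_embed p m s * N_embed p m h) = (s, h)"
proof -
  have uniq: "s' = s \<and> h' = h" if s': "s' \<in> S_group p" and h': "h' \<in> N_group p m"
    and eq: "S_embed p m s * N_embed p m h = S_embed p m s' * N_embed p m h'" for s' h'
  proof -
    obtain n z n' z' where hz: "h = (n, z)" "h' = (n', z')" by fastforce
    have c: "n \<in> carrier_mat p p" "z \<in> carrier_mat p m" "n' \<in> carrier_mat p p" "z' \<in> carrier_mat p m"
      using h h' unfolding N_group_def hz by auto
    note sc = S_group_carrier[OF s] S_group_carrier[OF s']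
    have row: "s * (N_corner n z * X1 + z * X2 + X3) = s' * (N_corner n' z' * X1 + z' * X2 + X3)"
      if "X1 \<in> carrier_mat p l" "X2 \<in> carrier_mat m l" "X3 \<in> carrier_mat p l" for X1 X2 X3 l
      using P_block_row3[OF s c(1,2) blocks_carrier[of p m l X1 X2 X3]]
        P_block_row3[OF s' c(3,4) blocks_carrier[of p m l X1 X2 X3]]
      unfolding eq[unfolded hz] E_blocks[OF that] by simp
    have cz: "N_corner n z \<in> carrier_mat p p" "N_corner n' z' \<in> carrier_mat p p" using c by auto
    have "s = s'" using row[of "0\<^sub>m p p" p "0\<^sub>m m p" "1\<^sub>m p"] sc c cz by auto
    moreover have "s * z = s' * z'" using row[of "0\<^sub>m p m" m "1\<^sub>m m" "0\<^sub>m p m"] sc c cz by auto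
    moreover have "s * N_corner n z = s' * N_corner n' z'"
      using row[of "1\<^sub>m p" p "0\<^sub>m m p" "0\<^sub>m p p"] sc c cz by auto
    ultimately have "s = s'" "z = z'" "N_corner n z = N_corner n' z'"
      using mat_left_cancel[OF sc(1) S_group_det[OF s]] c cz by metis+
    moreover from this have "n = n'"
    proof -
      have "n = N_corner n z + (1 / 2) \<cdot>\<^sub>m (z * mat_adjoint z)"
        unfolding N_corner_def using c by (intro eq_matI) auto
      also have "\<dots> = N_corner n' z' + (1 / 2) \<cdot>\<^sub>m (z' * mat_adjoint z')"
        using \<open>z = z'\<close> \<open>N_corner n z = N_corner n' z'\<close> by simp
      also have "\<dots> = n'" unfolding N_corner_def using c by (intro eq_matI) auto
      finally show ?thesis .
    qed
    ultimately show ?thesis unfolding hz by simp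
  qed
  show ?thesis unfolding P_factors_def
    by (rule the_equality) (use s h uniq in auto)
qed

text \<open>The action of \<open>P\<close> on the Siegel domain in block coordinates.\<close>

lemma act_P:
  assumes s: "s \<in> S_group p" and n: "n \<in> carrier_mat p p" and z: "z \<in> carrier_mat p m"
    and v: "v \<in> carrier_mat (p + m + p) p" "E1 p m * v = 1\<^sub>m p"
  shows "act p m (S_embed p m s * N_embed p m (n, z)) v = blocks p m p (1\<^sub>m p)
     ((E2 p m * v - mat_adjoint z) * mat_adjoint s)
     (s * (N_corner n z + z * (E2 p m * v) + E3 p m * v) * mat_adjoint s)" (is "_ = ?w")
proof -
  let ?g = "S_embed p m s * N_embed p m (n, z)" and ?a = "minv (mat_adjoint s)"
  let ?B = "E2 p m * v - mat_adjoint z" and ?C = "N_corner n z + z * (E2 p m * v) + E3 p m * v"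
  note sc = S_group_carrier[OF s] and I = S_adj_inv[OF s]
  note Sc = S_embed_carrier[OF s, of m] and Nc = N_embed_carrier[OF n z]
  have Nv: "N_embed p m (n, z) * v \<in> carrier_mat (p + m + p) p" by (rule mult_carrier_mat[OF Nc v(1)])
  have B: "?B \<in> carrier_mat m p" using v z by auto
  have C: "?C \<in> carrier_mat p p" using v z n by auto
  have gv: "?g * v = S_embed p m s * (N_embed p m (n, z) * v)" by (rule assoc_mult_mat[OF Sc Nc v(1)])
  have w: "1\<^sub>m p \<in> carrier_mat p p" "?B * mat_adjoint s \<in> carrier_mat m p" "s * ?C * mat_adjoint s \<in> carrier_mat p p"
    using B C sc by auto
  note Ew = E_blocks[OF w]
  have wa: "E1 p m * (?w * ?a) = E1 p m * ?w * ?a" "E2 p m * (?w * ?a) = E2 p m * ?w * ?a"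
    "E3 p m * (?w * ?a) = E3 p m * ?w * ?a"
    by (rule assoc_mult_mat[OF rsel_carrier blocks_carrier I(1), symmetric])+
  have eq: "?g * v = ?w * ?a"
  proof (rule eq_by_blocks[of _ p m p])
    show "?g * v \<in> carrier_mat (p + m + p) p" unfolding gv by (rule mult_carrier_mat[OF Sc Nv])
    show "?w * ?a \<in> carrier_mat (p + m + p) p" by (rule mult_carrier_mat[OF blocks_carrier I(1)])
    show "E1 p m * (?g * v) = E1 p m * (?w * ?a)"
      unfolding gv wa Ew S_embed_blocks[OF s Nv] N_embed_blocks[OF n z v(1)] v(2) using I(1) by auto
    have "?B * mat_adjoint s * ?a = ?B"
      by (simp only: assoc_mult_mat[OF B adj_carrier[OF sc] I(1)] I(2) right_mult_one_mat[OF B])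
    then show "E2 p m * (?g * v) = E2 p m * (?w * ?a)"
      unfolding gv wa Ew S_embed_blocks[OF s Nv] N_embed_blocks[OF n z v(1)] v(2) using z by simp
    have "s * ?C * mat_adjoint s * ?a = s * ?C"
      by (simp only: assoc_mult_mat[OF mult_carrier_mat[OF sc C] adj_carrier[OF sc] I(1)] I(2)
          right_mult_one_mat[OF mult_carrier_mat[OF sc C]])
    then show "E3 p m * (?g * v) = E3 p m * (?w * ?a)"
      unfolding gv wa Ew S_embed_blocks[OF s Nv] N_embed_blocks[OF n z v(1)] v(2)
      using N_corner_carrier[OF n z] by simp
  qed
  show ?thesis
    by (rule act_eqI[OF mult_carrier_mat[OF Sc Nc] v(1) blocks_carrier Ew(1) I(1) I(4) eq])
qed

text \<open>Traces \<open>tr (s X s\<^sup>* )\<close> make up the forms and the exponents below.\<close>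

lemma trace_conj_add:
  assumes "s \<in> carrier_mat k p" "X \<in> carrier_mat p p" "Y \<in> carrier_mat p p"
  shows "mat_trace (s * (X + Y) * mat_adjoint s) = mat_trace (s * X * mat_adjoint s) + mat_trace (s * Y * mat_adjoint s)"
proof -
  have "s * (X + Y) * mat_adjoint s = s * X * mat_adjoint s + s * Y * mat_adjoint s"
    by (simp only: mult_add_distrib_mat[OF assms]
        add_mult_distrib_mat[OF mult_carrier_mat[OF assms(1,2)] mult_carrier_mat[OF assms(1,3)] adj_carrier[OF assms(1)]])
  then show ?thesis
    by (simp only: trace_add[OF mult_carrier_mat[OF mult_carrier_mat[OF assms(1,2)] adj_carrier[OF assms(1)]]
          mult_carrier_mat[OF mult_carrier_mat[OF assms(1,3)] adj_carrier[OF assms(1)]]])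
qed

lemma trace_conj_minus:
  assumes "s \<in> carrier_mat k p" "X \<in> carrier_mat p p" "Y \<in> carrier_mat p p"
  shows "mat_trace (s * (X - Y) * mat_adjoint s) = mat_trace (s * X * mat_adjoint s) - mat_trace (s * Y * mat_adjoint s)"
proof -
  have "s * (X - Y) * mat_adjoint s = s * X * mat_adjoint s - s * Y * mat_adjoint s"
    by (simp only: mult_minus_distrib_mat[OF assms]
        minus_mult_distrib_mat[OF mult_carrier_mat[OF assms(1,2)] mult_carrier_mat[OF assms(1,3)] adj_carrier[OF assms(1)]])
  then show ?thesis
    by (simp only: trace_minus[OF mult_carrier_mat[OF mult_carrier_mat[OF assms(1,2)] adj_carrier[OF assms(1)]]
          mult_carrier_mat[OF mult_carrier_mat[OF assms(1,3)] adj_carrier[OF assms(1)]]])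
qed

lemma trace_conj_smult:
  assumes "s \<in> carrier_mat k p" "X \<in> carrier_mat p p"
  shows "mat_trace (s * (c \<cdot>\<^sub>m X) * mat_adjoint s) = c * mat_trace (s * X * mat_adjoint s)"
proof -
  have "s * (c \<cdot>\<^sub>m X) * mat_adjoint s = c \<cdot>\<^sub>m (s * X * mat_adjoint s)"
    by (simp only: mult_smult_distrib[OF assms] mult_smult_assoc_mat[OF mult_carrier_mat[OF assms] adj_carrier[OF assms(1)]])
  then show ?thesis by (simp only: trace_smult[OF mult_carrier_mat[OF mult_carrier_mat[OF assms] adj_carrier[OF assms(1)]]])
qed

lemma trace_conj_N_corner:
  assumes s: "s \<in> carrier_mat k p" and n: "n \<in> carrier_mat p p" and z: "z \<in> carrier_mat p m"
    and B: "B \<in> carrier_mat m p" and C: "C \<in> carrier_mat p p"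
  shows "mat_trace (s * (N_corner n z + z * B + C) * mat_adjoint s)
    = mat_trace (s * n * mat_adjoint s) - mat_trace ((s * z) * mat_adjoint (s * z)) / 2
      + mat_trace ((s * z) * (B * mat_adjoint s)) + mat_trace (s * C * mat_adjoint s)"
proof -
  have c: "z * B \<in> carrier_mat p p" "z * mat_adjoint z \<in> carrier_mat p p" "N_corner n z \<in> carrier_mat p p"
    using z B n by auto
  have 1: "s * (z * mat_adjoint z) * mat_adjoint s = (s * z) * mat_adjoint (s * z)"
    using s z by (simp add: adj_mult[OF s z] massoc)
  have 2: "s * (z * B) * mat_adjoint s = (s * z) * (B * mat_adjoint s)"
    using s z B by (simp add: massoc)
  have "mat_trace (s * (N_corner n z + z * B + C) * mat_adjoint s)
    = mat_trace (s * N_corner n z * mat_adjoint s) + mat_trace (s * (z * B) * mat_adjoint s)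
      + mat_trace (s * C * mat_adjoint s)"
    using c C by (simp add: trace_conj_add[OF s])
  also have "mat_trace (s * N_corner n z * mat_adjoint s)
    = mat_trace (s * n * mat_adjoint s) - mat_trace (s * (z * mat_adjoint z) * mat_adjoint s) / 2"
    unfolding N_corner_def using c n by (simp add: trace_conj_minus[OF s] trace_conj_smult[OF s])
  finally show ?thesis unfolding 1 2 .
qed

text \<open>The form on the subspace of a point of the Siegel domain. The coordinates \<open>B\<close>, \<open>C\<close> are the
  second and third block rows.\<close>

lemma sig_form_point:
  assumes v: "v \<in> carrier_mat (p + m + p) p" "E1 p m * v = 1\<^sub>m p" and Y: "Y \<in> carrier_mat p k"
  shows "sig_form p m (v * Y)
    = 2 * Re (mat_trace (mat_adjoint Y * (E3 p m * v) * Y)) + (hs_norm (E2 p m * v * Y))\<^sup>2"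
proof -
  have "E1 p m * (v * Y) = Y" "E2 p m * (v * Y) = E2 p m * v * Y" "E3 p m * (v * Y) = E3 p m * v * Y"
    using assoc_mult_mat[OF rsel_carrier v(1) Y, symmetric] v(2) Y by auto
  then show ?thesis
    using sig_form_blocks[OF mult_carrier_mat[OF v(1) Y]] v(1) Y by (simp add: massoc)
qed

text \<open>The action of \<open>sh\<close> transforms the form by \<open>Y \<mapsto> s\<^sup>* Y\<close>.\<close>

lemma act_P_form:
  assumes s: "s \<in> S_group p" and h: "h \<in> N_group p m"
    and vc: "v \<in> carrier_mat (p + m + p) p" "E1 p m * v = 1\<^sub>m p"
  defines "w \<equiv> act p m (S_embed p m s * N_embed p m h) v"
  shows "w \<in> carrier_mat (p + m + p) p" "E1 p m * w = 1\<^sub>m p"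
    and "\<And>Y k. Y \<in> carrier_mat p k \<Longrightarrow> sig_form p m (w * Y) = sig_form p m (v * (mat_adjoint s * Y))"
proof -
  obtain n z where hz: "h = (n, z)" by fastforce
  have n: "n \<in> carrier_mat p p" "mat_adjoint n = - n" and z: "z \<in> carrier_mat p m"
    using h unfolding N_group_def hz by auto
  note sc = S_group_carrier[OF s]
  define B C where "B = E2 p m * v" and "C = E3 p m * v"
  have B: "B \<in> carrier_mat m p" and C: "C \<in> carrier_mat p p" using vc unfolding B_def C_def by auto
  let ?M = "N_corner n z + z * B + C"
  have M: "?M \<in> carrier_mat p p" using n z B C by auto
  have w_eq: "w = blocks p m p (1\<^sub>m p) ((B - mat_adjoint z) * mat_adjoint s) (s * ?M * mat_adjoint s)"
    unfolding w_def hz B_def C_def by (rule act_P[OF s n(1) z vc])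
  have "1\<^sub>m p \<in> carrier_mat p p" "(B - mat_adjoint z) * mat_adjoint s \<in> carrier_mat m p"
    "s * ?M * mat_adjoint s \<in> carrier_mat p p"
    using B z sc M by auto
  note Ew = E_blocks[OF this, folded w_eq]
  show wc: "w \<in> carrier_mat (p + m + p) p" unfolding w_eq by auto
  show "E1 p m * w = 1\<^sub>m p" by (rule Ew(1))
  show "sig_form p m (w * Y) = sig_form p m (v * (mat_adjoint s * Y))" if Y: "Y \<in> carrier_mat p k" for Y k
  proof -
    define Y' where "Y' = mat_adjoint s * Y"
    have Y': "Y' \<in> carrier_mat p k" using sc Y unfolding Y'_def by auto
    define b \<zeta> where "b = B * Y'" and "\<zeta> = mat_adjoint z * Y'"
    have bz: "b \<in> carrier_mat m k" "\<zeta> \<in> carrier_mat m k" using B z Y' unfolding b_def \<zeta>_def by auto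
    let ?t = "mat_adjoint Y'"
    have t: "?t \<in> carrier_mat k p" using Y' by auto
    have e3: "mat_adjoint Y * (s * ?M * mat_adjoint s) * Y = ?t * ?M * mat_adjoint ?t"
    proof -
      have "?t = mat_adjoint Y * s" unfolding Y'_def by (simp add: adj_mult[OF adj_carrier[OF sc] Y])
      moreover have "mat_adjoint ?t = mat_adjoint s * Y" unfolding Y'_def by simp
      ultimately show ?thesis using Y sc M by (simp only: massoc index_mult_mat adj_dims carrier_matD)
    qed
    have e2: "(B - mat_adjoint z) * mat_adjoint s * Y = b - \<zeta>"
    proof -
      have "(B - mat_adjoint z) * mat_adjoint s * Y = (B - mat_adjoint z) * Y'"
        using Y sc B z unfolding Y'_def by (simp add: massoc)
      also have "\<dots> = b - \<zeta>" unfolding b_def \<zeta>_def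
        by (rule minus_mult_distrib_mat[OF B adj_carrier[OF z] Y'])
      finally show ?thesis .
    qed
    have tz: "mat_adjoint (?t * z) = \<zeta>" unfolding \<zeta>_def using adj_mult[OF t z] by simp
    then have tz': "?t * z = mat_adjoint \<zeta>" by (metis adj_adj)
    have trM: "mat_trace (?t * ?M * mat_adjoint ?t) = mat_trace (?t * n * mat_adjoint ?t)
        - of_real ((hs_norm \<zeta>)\<^sup>2) / 2 + mat_trace (mat_adjoint \<zeta> * b) + mat_trace (?t * C * mat_adjoint ?t)"
      using trace_conj_N_corner[OF t n(1) z B C] unfolding tz'
      by (simp add: trace_adj_mult[OF bz(2)] b_def)
    have skew: "Re (mat_trace (?t * n * mat_adjoint ?t)) = 0"
    proof -
      have tn: "?t * n * mat_adjoint ?t \<in> carrier_mat k k"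
        by (rule mult_carrier_mat[OF mult_carrier_mat[OF t n(1)] adj_carrier[OF t]])
      have "mat_adjoint (?t * n * mat_adjoint ?t) = ?t * (mat_adjoint n * mat_adjoint ?t)"
        by (subst adj_mult[OF mult_carrier_mat[OF t n(1)] adj_carrier[OF t]], subst adj_mult[OF t n(1)]) simp
      also have "\<dots> = ?t * mat_adjoint n * mat_adjoint ?t"
        by (rule assoc_mult_mat[OF t adj_carrier[OF n(1)] adj_carrier[OF t], symmetric])
      also have "\<dots> = - (?t * n * mat_adjoint ?t)"
      proof -
        have "?t * (- n) = - (?t * n)" using t n(1) by (intro eq_matI) auto
        moreover have "- (?t * n) * mat_adjoint ?t = - (?t * n * mat_adjoint ?t)"
          using t n(1) by (intro eq_matI) auto
        ultimately show ?thesis using n(2) by simp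
      qed
      finally have "cnj (mat_trace (?t * n * mat_adjoint ?t)) = - mat_trace (?t * n * mat_adjoint ?t)"
        using trace_adj[OF tn] trace_uminus[OF tn] by simp
      then have "Re (cnj (mat_trace (?t * n * mat_adjoint ?t))) = Re (- mat_trace (?t * n * mat_adjoint ?t))"
        by simp
      then show ?thesis by simp
    qed
    have square: "(hs_norm (b - \<zeta>))\<^sup>2 = (hs_norm b)\<^sup>2 - 2 * Re (mat_trace (mat_adjoint \<zeta> * b)) + (hs_norm \<zeta>)\<^sup>2"
    proof -
      have d: "b - \<zeta> \<in> carrier_mat m k" "mat_adjoint b \<in> carrier_mat k m" "mat_adjoint \<zeta> \<in> carrier_mat k m"
        using bz by auto
      have c: "mat_adjoint b * b \<in> carrier_mat k k" "mat_adjoint b * \<zeta> \<in> carrier_mat k k"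
        "mat_adjoint \<zeta> * b \<in> carrier_mat k k" "mat_adjoint \<zeta> * \<zeta> \<in> carrier_mat k k"
        using bz by auto
      have "mat_adjoint (b - \<zeta>) * (b - \<zeta>)
        = (mat_adjoint b * b - mat_adjoint b * \<zeta>) - (mat_adjoint \<zeta> * b - mat_adjoint \<zeta> * \<zeta>)"
        using d bz by (simp add: adj_minus[OF bz] minus_mult_distrib_mat[OF d(2,3)] mult_minus_distrib_mat[of _ k m])
      then have "mat_trace (mat_adjoint (b - \<zeta>) * (b - \<zeta>)) = mat_trace (mat_adjoint b * b)
        - mat_trace (mat_adjoint b * \<zeta>) - mat_trace (mat_adjoint \<zeta> * b) + mat_trace (mat_adjoint \<zeta> * \<zeta>)"
        by (simp add: trace_minus[OF minus_carrier_mat[OF c(2)] minus_carrier_mat[OF c(4)]]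
            trace_minus[OF c(1,2)] trace_minus[OF c(3,4)])
      moreover have "mat_trace (mat_adjoint b * \<zeta>) = cnj (mat_trace (mat_adjoint \<zeta> * b))"
        using trace_adj[OF c(3)] adj_mult[OF d(3) bz(1)] by simp
      ultimately have "complex_of_real ((hs_norm (b - \<zeta>))\<^sup>2) = of_real ((hs_norm b)\<^sup>2)
          - cnj (mat_trace (mat_adjoint \<zeta> * b)) - mat_trace (mat_adjoint \<zeta> * b) + of_real ((hs_norm \<zeta>)\<^sup>2)"
        by (simp only: trace_adj_mult[OF d(1)] trace_adj_mult[OF bz(1)] trace_adj_mult[OF bz(2)])
      then show ?thesis by (metis (no_types, lifting) Re_complex_of_real complex.sel(1) complex_cnj cnj.simps(1)
        diff_diff_eq minus_complex.simps(1) mult_2 plus_complex.simps(1))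
    qed
    have "sig_form p m (w * Y) = 2 * Re (mat_trace (?t * ?M * mat_adjoint ?t)) + (hs_norm (b - \<zeta>))\<^sup>2"
      using sig_form_point[OF wc Ew(1) Y] unfolding Ew e3 e2 by simp
    also have "\<dots> = 2 * Re (mat_trace (?t * C * mat_adjoint ?t)) + (hs_norm b)\<^sup>2"
      unfolding trM square using skew by simp
    also have "\<dots> = sig_form p m (v * Y')"
      using sig_form_point[OF vc Y'] unfolding b_def B_def C_def by simp
    finally show ?thesis unfolding Y'_def .
  qed
qed

lemma act_P_siegel:
  assumes s: "s \<in> S_group p" and h: "h \<in> N_group p m" and v: "v \<in> siegel p m"
  shows "act p m (S_embed p m s * N_embed p m h) v \<in> siegel p m"
proof -
  note f = act_P_form[OF s h siegel_carrier[OF v] siegel_E1[OF v]] and sc = S_group_carrier[OF s]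
  have "sig_form p m (v * (mat_adjoint s * Y)) < 0" if Y: "Y \<in> carrier_mat p 1" "Y \<noteq> 0\<^sub>m p 1" for Y
  proof -
    have c: "mat_adjoint s * Y \<in> carrier_mat p 1" using sc Y by auto
    have "mat_adjoint s * Y \<noteq> 0\<^sub>m p 1"
    proof
      assume "mat_adjoint s * Y = 0\<^sub>m p 1"
      then have "mat_adjoint s * Y = mat_adjoint s * 0\<^sub>m p 1" using sc by simp
      then have "Y = 0\<^sub>m p 1"
        by (intro mat_left_cancel[OF adj_carrier[OF sc] det_adj_nonzero[OF sc S_group_det[OF s]] Y(1)]) auto
      with Y show False by simp
    qed
    then show ?thesis using v c unfolding siegel_def by auto
  qed
  then show ?thesis using f unfolding siegel_def by auto
qed

section \<open>Transitivity\<close>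

text \<open>Cholesky decomposition, by induction on the size, splitting off the first row and column.\<close>

lemma cholesky_aux:
  fixes H :: "nat \<Rightarrow> nat \<Rightarrow> complex"
  assumes "\<And>i j. i < n \<Longrightarrow> j < n \<Longrightarrow> H j i = cnj (H i j)"
    and "\<And>y. (\<exists>i<n. y i \<noteq> 0) \<Longrightarrow> 0 < Re (\<Sum>i<n. \<Sum>j<n. cnj (y i) * H i j * y j)"
  shows "\<exists>s :: nat \<Rightarrow> nat \<Rightarrow> complex. (\<forall>i j. i < j \<longrightarrow> s i j = 0) \<and> (\<forall>i<n. s i i \<in> \<real> \<and> 0 < Re (s i i)) \<and>
    (\<forall>i<n. \<forall>k<n. (\<Sum>j<n. s i j * cnj (s k j)) = H i k)"
  using assms
proof (induction n arbitrary: H)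
  case 0
  then show ?case by (intro exI[of _ "\<lambda>_ _. 0"]) auto
next
  case (Suc n)
  have a: "0 < Re (H 0 0)" "H 0 0 = of_real (Re (H 0 0))"
  proof -
    have "0 < Re (\<Sum>i<Suc n. \<Sum>j<Suc n. cnj (if i = 0 then 1 else 0) * H i j * (if j = 0 then 1 else 0))"
      by (rule Suc.prems(2)) auto
    then show "0 < Re (H 0 0)" by (simp add: sum.lessThan_Suc_shift del: sum.lessThan_Suc)
    have "H 0 0 = cnj (H 0 0)" by (rule Suc.prems(1)) auto
    then show "H 0 0 = of_real (Re (H 0 0))" by (simp add: complex_eq_iff)
  qed
  define \<alpha> where "\<alpha> = sqrt (Re (H 0 0))"
  have \<alpha>: "0 < \<alpha>" "H 0 0 = of_real \<alpha> * of_real \<alpha>"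
    using a unfolding \<alpha>_def by (auto simp flip: of_real_mult)
  define w where "w i = H (Suc i) 0 / of_real \<alpha>" for i
  have w: "H (Suc i) 0 = of_real \<alpha> * w i" for i using \<alpha>(1) unfolding w_def by simp
  have w': "H 0 (Suc i) = of_real \<alpha> * cnj (w i)" if "i < n" for i
    using Suc.prems(1)[of "Suc i" 0] that \<alpha>(1) unfolding w_def by simp
  define H' where "H' i j = H (Suc i) (Suc j) - w i * cnj (w j)" for i j
  have "\<exists>s :: nat \<Rightarrow> nat \<Rightarrow> complex. (\<forall>i j. i < j \<longrightarrow> s i j = 0) \<and> (\<forall>i<n. s i i \<in> \<real> \<and> 0 < Re (s i i)) \<and>
    (\<forall>i<n. \<forall>k<n. (\<Sum>j<n. s i j * cnj (s k j)) = H' i k)"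
  proof (rule Suc.IH)
    show "H' j i = cnj (H' i j)" if "i < n" "j < n" for i j
      using Suc.prems(1)[of "Suc i" "Suc j"] that unfolding H'_def by (simp add: mult.commute)
    fix y :: "nat \<Rightarrow> complex" assume y: "\<exists>i<n. y i \<noteq> 0"
    define \<beta> where "\<beta> = (\<Sum>j<n. cnj (w j) * y j)"
    \<comment> \<open>The first coordinate that minimises the form of \<open>H\<close>.\<close>
    define y' where "y' = case_nat (- \<beta> / of_real \<alpha>) y"
    have "\<exists>i<Suc n. y' i \<noteq> 0" using y unfolding y'_def by (metis Suc_less_eq old.nat.simps(5))
    then have "0 < Re (\<Sum>i<Suc n. \<Sum>j<Suc n. cnj (y' i) * H i j * y' j)" by (rule Suc.prems(2))
    also have "(\<Sum>i<Suc n. \<Sum>j<Suc n. cnj (y' i) * H i j * y' j)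
      = cnj (y' 0) * H 0 0 * y' 0 + (\<Sum>j<n. cnj (y' 0) * H 0 (Suc j) * y j)
        + ((\<Sum>i<n. cnj (y i) * H (Suc i) 0 * y' 0) + (\<Sum>i<n. \<Sum>j<n. cnj (y i) * H (Suc i) (Suc j) * y j))"
      unfolding sum.lessThan_Suc_shift sum.distrib by (simp add: y'_def)
    also have "(\<Sum>j<n. cnj (y' 0) * H 0 (Suc j) * y j) = cnj (y' 0) * of_real \<alpha> * \<beta>"
      unfolding \<beta>_def sum_distrib_left by (intro sum.cong) (auto simp: w')
    also have "(\<Sum>i<n. cnj (y i) * H (Suc i) 0 * y' 0) = cnj \<beta> * of_real \<alpha> * y' 0"
      unfolding \<beta>_def by (simp add: sum_distrib_left sum_distrib_right w mult_ac)
    also have "(\<Sum>i<n. \<Sum>j<n. cnj (y i) * H (Suc i) (Suc j) * y j)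
      = (\<Sum>i<n. \<Sum>j<n. cnj (y i) * H' i j * y j) + cnj \<beta> * \<beta>"
      unfolding \<beta>_def H'_def by (simp add: sum_product sum.distrib[symmetric] algebra_simps)
    also have "cnj (y' 0) * H 0 0 * y' 0 + cnj (y' 0) * of_real \<alpha> * \<beta> + (cnj \<beta> * of_real \<alpha> * y' 0 +
        ((\<Sum>i<n. \<Sum>j<n. cnj (y i) * H' i j * y j) + cnj \<beta> * \<beta>))
      = (\<Sum>i<n. \<Sum>j<n. cnj (y i) * H' i j * y j)"
      unfolding \<alpha>(2) y'_def using \<alpha>(1) by (simp add: field_simps)
    finally show "0 < Re (\<Sum>i<n. \<Sum>j<n. cnj (y i) * H' i j * y j)" .
  qed
  then obtain s where s: "\<And>i j. i < j \<Longrightarrow> s i j = 0" "\<And>i. i < n \<Longrightarrow> s i i \<in> \<real> \<and> 0 < Re (s i i)"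
    "\<And>i k. i < n \<Longrightarrow> k < n \<Longrightarrow> (\<Sum>j<n. s i j * cnj (s k j)) = H' i k" by blast
  define s' where "s' i j = (case i of 0 \<Rightarrow> (if j = 0 then of_real \<alpha> else 0)
    | Suc i' \<Rightarrow> (case j of 0 \<Rightarrow> w i' | Suc j' \<Rightarrow> s i' j'))" for i j
  show ?case
  proof (intro exI[of _ s'] conjI allI impI)
    fix i j :: nat assume "i < j"
    then show "s' i j = 0" unfolding s'_def by (auto split: nat.splits simp: s(1))
  next
    fix i assume "i < Suc n"
    then show "s' i i \<in> \<real>" "0 < Re (s' i i)" unfolding s'_def using s(2) \<alpha>(1) by (auto split: nat.splits)
  next
    fix i k assume ik: "i < Suc n" "k < Suc n"
    have 0: "(\<Sum>j<Suc n. s' i j * cnj (s' k j)) = s' i 0 * cnj (s' k 0) + (\<Sum>j<n. s' i (Suc j) * cnj (s' k (Suc j)))"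
      by (rule sum.lessThan_Suc_shift)
    show "(\<Sum>j<Suc n. s' i j * cnj (s' k j)) = H i k"
      unfolding 0 using ik \<alpha>(2) s(3) w w' unfolding s'_def H'_def by (auto split: nat.splits)
  qed
qed

lemma cholesky:
  assumes H: "H \<in> carrier_mat p p" "mat_adjoint H = H"
    and pos: "\<And>Y. Y \<in> carrier_mat p 1 \<Longrightarrow> Y \<noteq> 0\<^sub>m p 1 \<Longrightarrow> 0 < Re (mat_trace (mat_adjoint Y * H * Y))"
  obtains s where "s \<in> S_group p" "s * mat_adjoint s = H"
proof -
  have "\<exists>s :: nat \<Rightarrow> nat \<Rightarrow> complex. (\<forall>i j. i < j \<longrightarrow> s i j = 0) \<and> (\<forall>i<p. s i i \<in> \<real> \<and> 0 < Re (s i i)) \<and>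
    (\<forall>i<p. \<forall>k<p. (\<Sum>j<p. s i j * cnj (s k j)) = H $$ (i, k))"
  proof (rule cholesky_aux)
    show "H $$ (j, i) = cnj (H $$ (i, j))" if "i < p" "j < p" for i j
      using arg_cong[OF H(2), of "\<lambda>M. M $$ (j, i)"] that H(1) by simp
    fix y :: "nat \<Rightarrow> complex" assume y: "\<exists>i<p. y i \<noteq> 0"
    let ?Y = "mat p 1 (\<lambda>(i, _). y i)"
    have Y: "?Y \<in> carrier_mat p 1" by auto
    have "?Y \<noteq> 0\<^sub>m p 1"
    proof
      assume "?Y = 0\<^sub>m p 1"
      then have "?Y $$ (i, 0) = 0\<^sub>m p 1 $$ (i, 0)" for i by simp
      moreover have "?Y $$ (i, 0) = y i" "0\<^sub>m p 1 $$ (i, 0) = (0 :: complex)" if "i < p" for i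
        using that by simp_all
      ultimately have "y i = 0" if "i < p" for i using that by metis
      then show False using y by blast
    qed
    then have "0 < Re (mat_trace (mat_adjoint ?Y * H * ?Y))" by (rule pos[OF Y])
    also have "mat_trace (mat_adjoint ?Y * H * ?Y) = mat_trace (mat_adjoint ?Y * (H * ?Y))"
      using Y H by (simp add: massoc)
    also have "\<dots> = (\<Sum>i<1. \<Sum>j<p. mat_adjoint ?Y $$ (i, j) * (H * ?Y) $$ (j, i))"
      by (rule trace_mult[OF adj_carrier[OF Y] mult_carrier_mat[OF H(1) Y]])
    also have "\<dots> = (\<Sum>i<p. \<Sum>j<p. cnj (y i) * H $$ (i, j) * y j)"
      using H(1) by (auto simp: scalar_prod_def atLeast0LessThan sum_distrib_left mult.assoc intro!: sum.cong)
    finally show "0 < Re (\<Sum>i<p. \<Sum>j<p. cnj (y i) * H $$ (i, j) * y j)" .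
  qed
  then obtain s where s: "\<And>i j. i < j \<Longrightarrow> s i j = 0" "\<And>i. i < p \<Longrightarrow> s i i \<in> \<real> \<and> 0 < Re (s i i)"
    "\<And>i k. i < p \<Longrightarrow> k < p \<Longrightarrow> (\<Sum>j<p. s i j * cnj (s k j)) = H $$ (i, k)" by blast
  let ?s = "mat p p (\<lambda>(i, j). s i j)"
  show ?thesis
  proof
    show "?s \<in> S_group p" unfolding S_group_def using s(1,2) by auto
    show "?s * mat_adjoint ?s = H"
      by (rule eq_matI) (use H(1) s(3) in \<open>auto simp: scalar_prod_def atLeast0LessThan\<close>)
  qed
qed

text \<open>The base point, whose stabiliser is the maximal compact subgroup.\<close>

definition base :: "nat \<Rightarrow> nat \<Rightarrow> complex mat" where
  "base p m = blocks p m p (1\<^sub>m p) (0\<^sub>m m p) (- 1\<^sub>m p)"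

lemma base_blocks:
  "E1 p m * base p m = 1\<^sub>m p" "E2 p m * base p m = 0\<^sub>m m p" "E3 p m * base p m = - 1\<^sub>m p"
  unfolding base_def by (rule E_blocks; simp)+

lemma base_carrier: "base p m \<in> carrier_mat (p + m + p) p"
  unfolding base_def by simp

lemma sig_form_base:
  assumes Y: "Y \<in> carrier_mat p k"
  shows "sig_form p m (base p m * Y) = - 2 * (hs_norm Y)\<^sup>2"
proof -
  have 1: "mat_adjoint Y * (- 1\<^sub>m p) * Y = - (mat_adjoint Y * Y)"
  proof -
    have "mat_adjoint Y * (- 1\<^sub>m p) = - mat_adjoint Y"
      using Y uminus_mult_right_mat[of "mat_adjoint Y" "1\<^sub>m p"] by auto
    then show ?thesis using Y uminus_mult_left_mat[of "mat_adjoint Y" Y] by auto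
  qed
  have 2: "0\<^sub>m m p * Y = 0\<^sub>m m k" by (rule left_mult_zero_mat[OF Y])
  have 3: "hs_norm (0\<^sub>m m k) = 0" using hs_norm_eq_0_iff[of "0\<^sub>m m k" m k] by simp
  show ?thesis
    unfolding sig_form_point[OF base_carrier base_blocks(1) Y] base_blocks 1 2 3
    by (simp add: trace_uminus[OF mult_carrier_mat[OF adj_carrier[OF Y] Y]] trace_adj_mult[OF Y])
qed

lemma base_siegel: "base p m \<in> siegel p m"
  using sig_form_base hs_norm_eq_0_iff base_carrier base_blocks(1) unfolding siegel_def by auto

text \<open>\<open>P\<close> acts transitively. For a point with block rows \<open>1, B, C\<close> the matrix
  \<open>H = - (C + C\<^sup>* + B\<^sup>* B) / 2\<close> is positive definite, so \<open>H = s s\<^sup>*\<close> with \<open>s\<close> in \<open>S\<close>. The block formula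
  for the action then forces \<open>z = - s\<^sup>-\<^sup>1 B\<^sup>*\<close> and determines \<open>n\<close>, which is skew-Hermitian by the choice of
  \<open>H\<close>.\<close>

lemma P_transitive:
  assumes v: "v \<in> siegel p m"
  obtains s h where "s \<in> S_group p" "h \<in> N_group p m"
    "act p m (S_embed p m s * N_embed p m h) (base p m) = v"
proof -
  note vc = siegel_carrier[OF v] siegel_E1[OF v]
  define B C where "B = E2 p m * v" and "C = E3 p m * v"
  have B: "B \<in> carrier_mat m p" and C: "C \<in> carrier_mat p p" using vc unfolding B_def C_def by auto
  have B': "mat_adjoint B \<in> carrier_mat p m" and C': "mat_adjoint C \<in> carrier_mat p p" using B C by auto
  have BB: "mat_adjoint B * B \<in> carrier_mat p p" using B by auto
  let ?G = "C + mat_adjoint C + mat_adjoint B * B"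
  have G: "?G \<in> carrier_mat p p" "C + mat_adjoint C \<in> carrier_mat p p" using C BB by auto
  define H where "H = (- 1 / 2) \<cdot>\<^sub>m ?G"
  have H: "H \<in> carrier_mat p p" unfolding H_def using G by auto
  have Hadj: "mat_adjoint H = H"
  proof -
    have "mat_adjoint ?G = mat_adjoint C + mat_adjoint (mat_adjoint C) + mat_adjoint (mat_adjoint B * B)"
      by (simp only: adj_add[OF G(2) BB] adj_add[OF C C'])
    also have "\<dots> = ?G" using C adj_mult[OF B' B] by (simp add: comm_add_mat[OF C C'])
    finally show ?thesis unfolding H_def by (simp add: adj_smult)
  qed
  have pos: "0 < Re (mat_trace (mat_adjoint Y * H * Y))" if Y: "Y \<in> carrier_mat p 1" "Y \<noteq> 0\<^sub>m p 1" for Y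
  proof -
    let ?t = "mat_adjoint Y"
    have t: "?t \<in> carrier_mat 1 p" using Y by auto
    have "mat_trace (?t * H * mat_adjoint ?t) = - (mat_trace (?t * C * mat_adjoint ?t)
      + mat_trace (?t * mat_adjoint C * mat_adjoint ?t) + mat_trace (?t * (mat_adjoint B * B) * mat_adjoint ?t)) / 2"
      unfolding H_def trace_conj_smult[OF t G(1)] trace_conj_add[OF t G(2) BB] trace_conj_add[OF t C C']
      by (simp add: field_simps)
    moreover have "mat_trace (?t * mat_adjoint C * mat_adjoint ?t) = cnj (mat_trace (?t * C * mat_adjoint ?t))"
    proof -
      have "mat_adjoint (?t * C * mat_adjoint ?t) = ?t * (mat_adjoint C * mat_adjoint ?t)"
        by (subst adj_mult[OF mult_carrier_mat[OF t C] adj_carrier[OF t]], subst adj_mult[OF t C]) simp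
      also have "\<dots> = ?t * mat_adjoint C * mat_adjoint ?t"
        by (rule assoc_mult_mat[OF t C' adj_carrier[OF t], symmetric])
      finally show ?thesis
        using trace_adj[OF mult_carrier_mat[OF mult_carrier_mat[OF t C] adj_carrier[OF t]]] by simp
    qed
    moreover have "mat_trace (?t * (mat_adjoint B * B) * mat_adjoint ?t) = of_real ((hs_norm (B * Y))\<^sup>2)"
    proof -
      have "?t * (mat_adjoint B * B) * mat_adjoint ?t = (?t * mat_adjoint B) * (B * Y)"
        using Y B by (simp add: massoc)
      also have "?t * mat_adjoint B = mat_adjoint (B * Y)" by (rule adj_mult[OF B Y(1), symmetric])
      finally show ?thesis using trace_adj_mult[OF mult_carrier_mat[OF B Y(1)]] by simp
    qed
    moreover have "sig_form p m (v * Y) < 0" using v Y unfolding siegel_def by auto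
    then have neg: "2 * Re (mat_trace (?t * C * mat_adjoint ?t)) + (hs_norm (B * Y))\<^sup>2 < 0"
      unfolding sig_form_point[OF vc Y(1)] B_def C_def by simp
    ultimately have "mat_trace (?t * H * mat_adjoint ?t) = - (mat_trace (?t * C * mat_adjoint ?t)
        + cnj (mat_trace (?t * C * mat_adjoint ?t)) + of_real ((hs_norm (B * Y))\<^sup>2)) / 2"
      by (simp only:)
    then have "Re (mat_trace (?t * H * mat_adjoint ?t))
        = - (2 * Re (mat_trace (?t * C * mat_adjoint ?t)) + (hs_norm (B * Y))\<^sup>2) / 2"
      by (simp only: Re_divide_numeral uminus_complex.simps plus_complex.simps cnj.simps Re_complex_of_real mult_2)
    then show ?thesis using neg by simp
  qed
  obtain s where s: "s \<in> S_group p" and ss: "s * mat_adjoint s = H"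
    by (rule cholesky[OF H Hadj pos])
  note sc = S_group_carrier[OF s]
  note I = minv_props[OF sc S_group_det[OF s]]
  let ?a = "minv s"
  let ?b = "mat_adjoint ?a"
  have b: "?b \<in> carrier_mat p p" using I by auto
  have bs: "?b * mat_adjoint s = 1\<^sub>m p" using adj_mult[OF sc I(1)] I(2) by simp
  have sb: "mat_adjoint s * ?b = 1\<^sub>m p" using adj_mult[OF I(1) sc] I(3) by simp
  define M where "M = ?a * C * ?b"
  define z where "z = - (?a * mat_adjoint B)"
  define n where "n = M + (1 / 2) \<cdot>\<^sub>m (z * mat_adjoint z) + 1\<^sub>m p"
  have aC: "?a * C \<in> carrier_mat p p" "?a * mat_adjoint C \<in> carrier_mat p p" "?a * mat_adjoint B \<in> carrier_mat p m"
    using I C B by auto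
  have M: "M \<in> carrier_mat p p" unfolding M_def by (rule mult_carrier_mat[OF aC(1) b])
  have z: "z \<in> carrier_mat p m" unfolding z_def using aC by auto
  have zz: "z * mat_adjoint z \<in> carrier_mat p p" using z by auto
  have n: "n \<in> carrier_mat p p" unfolding n_def using M zz by auto
  have zz_eq: "z * mat_adjoint z = ?a * (mat_adjoint B * B) * ?b"
  proof -
    have "mat_adjoint z = - (B * ?b)" unfolding z_def adj_uminus adj_mult[OF I(1) B'] by simp
    moreover have "(- (?a * mat_adjoint B)) * (- (B * ?b)) = ?a * mat_adjoint B * (B * ?b)"
      using aC B b by (intro eq_matI) auto
    ultimately show ?thesis unfolding z_def using I(1) B b by (simp add: massoc)
  qed
  have one: "1\<^sub>m p = ?a * H * ?b"
  proof -
    have "?a * H * ?b = (?a * s) * (mat_adjoint s * ?b)" unfolding ss[symmetric] using I(1) sc by (simp add: massoc)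
    then show ?thesis unfolding I(3) sb by simp
  qed
  have Madj: "mat_adjoint M = ?a * mat_adjoint C * ?b"
  proof -
    have "mat_adjoint M = ?a * (mat_adjoint C * ?b)" unfolding M_def
      by (subst adj_mult[OF aC(1) b], subst adj_mult[OF I(1) C]) simp
    then show ?thesis using assoc_mult_mat[OF I(1) C' b] by simp
  qed
  have skew: "mat_adjoint n = - n"
  proof -
    have zz_adj: "mat_adjoint (z * mat_adjoint z) = z * mat_adjoint z"
      using adj_mult[OF z adj_carrier[OF z]] by simp
    have nadj: "mat_adjoint n = mat_adjoint M + (1 / 2) \<cdot>\<^sub>m (z * mat_adjoint z) + 1\<^sub>m p"
    proof -
      have c: "(1 / 2) \<cdot>\<^sub>m (z * mat_adjoint z) \<in> carrier_mat p p" using zz by auto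
      show ?thesis unfolding n_def adj_add[OF add_carrier_mat[OF c] one_carrier_mat] adj_add[OF M c] adj_smult zz_adj
        by simp
    qed
    have sum0: "M + mat_adjoint M + z * mat_adjoint z = - (2 \<cdot>\<^sub>m 1\<^sub>m p)"
    proof -
      have "M + mat_adjoint M + z * mat_adjoint z = ?a * ?G * ?b"
        unfolding M_def Madj[unfolded M_def] zz_eq
        by (simp only: mult_add_distrib_mat[OF I(1) G(2) BB] mult_add_distrib_mat[OF I(1) C C']
            add_mult_distrib_mat[OF add_carrier_mat[OF aC(2)] mult_carrier_mat[OF I(1) BB] b]
            add_mult_distrib_mat[OF aC(1) aC(2) b])
      also have "?G = (- 2) \<cdot>\<^sub>m H" unfolding H_def using G by (intro eq_matI) (auto simp: field_simps)
      also have "?a * ((- 2) \<cdot>\<^sub>m H) * ?b = (- 2) \<cdot>\<^sub>m (?a * H * ?b)"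
        by (simp only: mult_smult_distrib[OF I(1) H] mult_smult_assoc_mat[OF mult_carrier_mat[OF I(1) H] b])
      also have "\<dots> = - (2 \<cdot>\<^sub>m 1\<^sub>m p)" unfolding one[symmetric] by (intro eq_matI) auto
      finally show ?thesis .
    qed
    show ?thesis
    proof (rule eq_matI)
      fix i j assume "i < dim_row (- n)" "j < dim_col (- n)"
      then have ij: "i < p" "j < p" using n by auto
      have "(M + mat_adjoint M + z * mat_adjoint z) $$ (i, j) = (- (2 \<cdot>\<^sub>m 1\<^sub>m p)) $$ (i, j)" using sum0 by simp
      moreover have "(M + mat_adjoint M + z * mat_adjoint z) $$ (i, j)
          = M $$ (i, j) + mat_adjoint M $$ (i, j) + (z * mat_adjoint z) $$ (i, j)"
        using ij M z by (simp del: index_mult_mat(1) adj_index add: add.assoc)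
      moreover have "(- (2 \<cdot>\<^sub>m 1\<^sub>m p)) $$ (i, j) = - 2 * (1\<^sub>m p $$ (i, j) :: complex)" using ij by simp
      ultimately have e: "M $$ (i, j) + mat_adjoint M $$ (i, j) + (z * mat_adjoint z) $$ (i, j) = - 2 * 1\<^sub>m p $$ (i, j)"
        by simp
      have e1: "mat_adjoint n $$ (i, j) = mat_adjoint M $$ (i, j) + (z * mat_adjoint z) $$ (i, j) / 2 + 1\<^sub>m p $$ (i, j)"
        unfolding nadj using ij M z by (simp del: index_mult_mat(1) adj_index index_one_mat(1) add: add.assoc)
      have e2: "(- n) $$ (i, j) = - (M $$ (i, j) + (z * mat_adjoint z) $$ (i, j) / 2 + 1\<^sub>m p $$ (i, j))"
        using ij M z unfolding n_def by (simp del: index_mult_mat(1) adj_index index_one_mat(1) add: add.assoc)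
      have "a + w / 2 + d = - (x + w / 2 + d)" if "x + a + w = - 2 * d" for a d x w :: complex
        using that by (simp add: eq_neg_iff_add_eq_0 algebra_simps)
      from this[OF e] show "mat_adjoint n $$ (i, j) = (- n) $$ (i, j)" unfolding e1 e2 .
    qed (use n in auto)
  qed
  have Nz: "N_corner n z + z * 0\<^sub>m m p + - 1\<^sub>m p = M"
  proof -
    have "z * 0\<^sub>m m p = 0\<^sub>m p p" using z by simp
    then show ?thesis unfolding N_corner_def n_def using M zz
      by (intro eq_matI) (auto simp del: index_mult_mat(1))
  qed
  have "act p m (S_embed p m s * N_embed p m (n, z)) (base p m)
    = blocks p m p (1\<^sub>m p) ((0\<^sub>m m p - mat_adjoint z) * mat_adjoint s) (s * M * mat_adjoint s)"
    using act_P[OF s n z base_carrier base_blocks(1)] unfolding base_blocks Nz by simp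
  also have "(0\<^sub>m m p - mat_adjoint z) * mat_adjoint s = B"
  proof -
    have "0\<^sub>m m p - mat_adjoint z = B * ?b"
      unfolding z_def adj_uminus adj_mult[OF I(1) B'] using B b by (intro eq_matI) (auto simp del: index_mult_mat(1))
    then have "(0\<^sub>m m p - mat_adjoint z) * mat_adjoint s = B * (?b * mat_adjoint s)"
      using assoc_mult_mat[OF B b adj_carrier[OF sc]] by simp
    then show ?thesis unfolding bs using B by simp
  qed
  also have "s * M * mat_adjoint s = C"
  proof -
    have "s * M * mat_adjoint s = (s * ?a) * C * (?b * mat_adjoint s)"
      unfolding M_def using sc I(1) C by (simp add: massoc)
    then show ?thesis unfolding I(2) bs using C by simp
  qed
  also have "blocks p m p (1\<^sub>m p) B C = v"
    by (rule eq_by_blocks[OF blocks_carrier vc(1)])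
      (use E_blocks[OF one_carrier_mat B C] vc(2) in \<open>auto simp: B_def C_def\<close>)
  finally have "act p m (S_embed p m s * N_embed p m (n, z)) (base p m) = v" .
  moreover have "(n, z) \<in> N_group p m" unfolding N_group_def using n z skew by auto
  ultimately show ?thesis using that[OF s] by blast
qed

section \<open>The orbit of the vacuum function\<close>

text \<open>The function \<open>exp (tr (s C s\<^sup>* ) + tr (z B s\<^sup>* ))\<close> attached to the point with block rows \<open>1, B, C\<close>; the
  base point gives the vacuum. The exponent is a separate notion because it serves to tell the points apart.\<close>

definition expo :: "nat \<Rightarrow> nat \<Rightarrow> complex mat \<Rightarrow> complex mat \<Rightarrow> complex mat \<Rightarrow> complex" where
  "expo p m v s z = mat_trace (s * (E3 p m * v) * mat_adjoint s) + mat_trace (z * ((E2 p m * v) * mat_adjoint s))"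

definition phi :: "nat \<Rightarrow> nat \<Rightarrow> complex mat \<Rightarrow> vfun" where
  "phi p m v s z = exp (expo p m v s z)"

lemma phi_base:
  assumes "s \<in> carrier_mat p p" "z \<in> carrier_mat p m"
  shows "phi p m (base p m) s z = f_vac s z"
proof -
  have "s * (- 1\<^sub>m p) = - s" using assms uminus_mult_right_mat[of s "1\<^sub>m p"] by auto
  then have "s * (- 1\<^sub>m p) * mat_adjoint s = - (s * mat_adjoint s)"
    using assms uminus_mult_left_mat[of s "mat_adjoint s"] by auto
  moreover have "0\<^sub>m m p * mat_adjoint s = 0\<^sub>m m p" using assms by (intro left_mult_zero_mat) auto
  moreover have "mat_trace (z * 0\<^sub>m m p) = 0" using assms by (simp add: mat_trace_def)
  moreover have "mat_trace (- (s * mat_adjoint s)) = - mat_trace (s * mat_adjoint s)"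
    using assms by (intro trace_uminus[of _ p]) auto
  ultimately show ?thesis unfolding phi_def expo_def f_vac_def base_blocks by simp
qed

lemma T_fun_SN:
  assumes "s0 \<in> S_group p" "h \<in> N_group p m"
  shows "T_fun p (p + m) (S_embed p m s0 * N_embed p m h) F s z = T1 (N_conj (s * s0) h) (F (s * s0)) z"
  unfolding T_fun_def P_factors_eq[OF assms] T_S_def T_N_def by simp

text \<open>Equivariance: the representation permutes these functions as \<open>P\<close> permutes the points.\<close>

lemma T_fun_phi:
  assumes s0: "s0 \<in> S_group p" and h: "h \<in> N_group p m" and v: "v \<in> carrier_mat (p + m + p) p" "E1 p m * v = 1\<^sub>m p"
    and s: "s \<in> carrier_mat p p" and z: "z \<in> carrier_mat p m"
  shows "T_fun p (p + m) (S_embed p m s0 * N_embed p m h) (phi p m v) s z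
    = phi p m (act p m (S_embed p m s0 * N_embed p m h) v) s z"
proof -
  obtain n z0 where hz: "h = (n, z0)" by fastforce
  have n: "n \<in> carrier_mat p p" and z0: "z0 \<in> carrier_mat p m" using h unfolding N_group_def hz by auto
  note sc = S_group_carrier[OF s0]
  define B C where "B = E2 p m * v" and "C = E3 p m * v"
  have B: "B \<in> carrier_mat m p" and C: "C \<in> carrier_mat p p" using v unfolding B_def C_def by auto
  let ?\<sigma> = "s * s0" and ?M = "N_corner n z0 + z0 * B + C"
  have \<sigma>: "?\<sigma> \<in> carrier_mat p p" using s sc by auto
  have M: "?M \<in> carrier_mat p p" using n z0 B C by auto
  have w: "1\<^sub>m p \<in> carrier_mat p p" "(B - mat_adjoint z0) * mat_adjoint s0 \<in> carrier_mat m p"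
    "s0 * ?M * mat_adjoint s0 \<in> carrier_mat p p"
    using B z0 sc M by auto
  have \<sigma>z: "?\<sigma> * z0 \<in> carrier_mat p m" "B * mat_adjoint ?\<sigma> \<in> carrier_mat m p"
    "mat_adjoint (?\<sigma> * z0) \<in> carrier_mat m p" using \<sigma> z0 B by auto
  have "T_fun p (p + m) (S_embed p m s0 * N_embed p m h) (phi p m v) s z
    = exp ((mat_trace (?\<sigma> * n * mat_adjoint ?\<sigma>) - mat_trace ((?\<sigma> * z0) * mat_adjoint (?\<sigma> * z0)) / 2
        - mat_trace (z * mat_adjoint (?\<sigma> * z0)))
      + (mat_trace (?\<sigma> * C * mat_adjoint ?\<sigma>) + mat_trace ((z + ?\<sigma> * z0) * (B * mat_adjoint ?\<sigma>))))"
    unfolding T_fun_SN[OF s0 h] by (simp add: hz phi_def expo_def B_def C_def exp_add)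
  also have "mat_trace ((z + ?\<sigma> * z0) * (B * mat_adjoint ?\<sigma>))
    = mat_trace (z * (B * mat_adjoint ?\<sigma>)) + mat_trace ((?\<sigma> * z0) * (B * mat_adjoint ?\<sigma>))"
    unfolding add_mult_distrib_mat[OF z \<sigma>z(1) \<sigma>z(2)]
    by (rule trace_add[OF mult_carrier_mat[OF z \<sigma>z(2)] mult_carrier_mat[OF \<sigma>z(1,2)]])
  also have "(mat_trace (?\<sigma> * n * mat_adjoint ?\<sigma>) - mat_trace ((?\<sigma> * z0) * mat_adjoint (?\<sigma> * z0)) / 2
        - mat_trace (z * mat_adjoint (?\<sigma> * z0)))
      + (mat_trace (?\<sigma> * C * mat_adjoint ?\<sigma>) + (mat_trace (z * (B * mat_adjoint ?\<sigma>)) + mat_trace ((?\<sigma> * z0) * (B * mat_adjoint ?\<sigma>))))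
    = mat_trace (?\<sigma> * ?M * mat_adjoint ?\<sigma>)
      + (mat_trace (z * (B * mat_adjoint ?\<sigma>)) - mat_trace (z * mat_adjoint (?\<sigma> * z0)))"
    unfolding trace_conj_N_corner[OF \<sigma> n z0 B C] by simp
  also have "mat_trace (z * (B * mat_adjoint ?\<sigma>)) - mat_trace (z * mat_adjoint (?\<sigma> * z0))
    = mat_trace (z * ((B - mat_adjoint z0) * mat_adjoint s0 * mat_adjoint s))"
  proof -
    have "(B - mat_adjoint z0) * mat_adjoint s0 * mat_adjoint s = (B - mat_adjoint z0) * mat_adjoint ?\<sigma>"
      unfolding adj_mult[OF s sc] using B z0 sc s by (simp add: massoc)
    also have "\<dots> = B * mat_adjoint ?\<sigma> - mat_adjoint (?\<sigma> * z0)"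
      unfolding minus_mult_distrib_mat[OF B adj_carrier[OF z0] adj_carrier[OF \<sigma>]] adj_mult[OF \<sigma> z0] by simp
    finally have "z * ((B - mat_adjoint z0) * mat_adjoint s0 * mat_adjoint s)
      = z * (B * mat_adjoint ?\<sigma>) - z * mat_adjoint (?\<sigma> * z0)"
      by (simp only: mult_minus_distrib_mat[OF z \<sigma>z(2,3)])
    then show ?thesis
      by (simp only: trace_minus[OF mult_carrier_mat[OF z \<sigma>z(2)] mult_carrier_mat[OF z \<sigma>z(3)]])
  qed
  also have "?\<sigma> * ?M * mat_adjoint ?\<sigma> = s * (s0 * ?M * mat_adjoint s0) * mat_adjoint s"
    unfolding adj_mult[OF s sc] using s sc C by (simp add: massoc)
  finally show ?thesis
    unfolding phi_def expo_def hz act_P[OF s0 n z0 v, folded B_def C_def] E_blocks[OF w] .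
qed

section \<open>Linear independence\<close>

text \<open>A sesquilinear form that vanishes on the diagonal at all rows with positive last entry is zero.\<close>

lemma sesquilinear_zero:
  fixes D :: "nat \<Rightarrow> nat \<Rightarrow> complex"
  assumes f0: "\<And>r. r n \<in> \<real> \<Longrightarrow> 0 < Re (r n) \<Longrightarrow> (\<Sum>j<Suc n. \<Sum>k<Suc n. r j * D j k * cnj (r k)) = 0"
    and jk: "j < Suc n" "k < Suc n"
  shows "D j k = 0"
proof -
  define R where "R x y = (\<Sum>j<Suc n. \<Sum>k<Suc n. x j * D j k * cnj (y k))" for x y
  have add: "R (\<lambda>i. x i + x' i) y = R x y + R x' y" "R x (\<lambda>i. y i + y' i) = R x y + R x y'" for x x' y y'
    unfolding R_def by (simp_all add: algebra_simps sum.distrib del: sum.lessThan_Suc)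
  have scale: "R (\<lambda>i. c * x i) y = c * R x y" "R x (\<lambda>i. c * y i) = cnj c * R x y" for c x y
    unfolding R_def by (simp_all add: sum_distrib_left mult_ac del: sum.lessThan_Suc)
  let ?e = "\<lambda>a (i::nat). if i = a then 1 else (0::complex)"
  have unit: "R (?e a) (?e b) = D a b" if "a < Suc n" "b < Suc n" for a b
  proof -
    have "R (?e a) (?e b) = (\<Sum>j<Suc n. if j = a then D j b else 0)"
      unfolding R_def using that by (intro sum.cong refl)
        (auto simp: if_distrib[of cnj] if_distrib[of "\<lambda>x. _ * x"] simp del: sum.lessThan_Suc cong: if_cong)
    then show ?thesis using that by (simp del: sum.lessThan_Suc)
  qed
  \<comment> \<open>Polarisation: \<open>x + c y\<close> is admissible for every \<open>c\<close> since \<open>y\<close> does not change the last entry;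
    \<open>c = 1, -1, \<i>\<close> separate the terms.\<close>
  have cross: "R x y = 0 \<and> R y x = 0" if x: "x n \<in> \<real>" "0 < Re (x n)" and y: "y n = 0" for x y
  proof -
    have E: "cnj c * R x y + c * R y x + c * cnj c * R y y = 0" for c
    proof -
      have "R (\<lambda>i. x i + c * y i) (\<lambda>i. x i + c * y i) = 0"
        unfolding R_def by (rule f0) (use x y in auto)
      moreover have "R x x = 0" unfolding R_def by (rule f0) (use x in auto)
      ultimately show ?thesis by (simp add: add scale algebra_simps)
    qed
    from E[of 1] E[of "-1"] have "R y y = 0" "R x y + R y x = 0" by (simp_all add: algebra_simps add_eq_0_iff)
    moreover have "R y x - R x y = 0"
    proof -
      have "\<i> * (R y x - R x y) = 0" using E[of \<i>] \<open>R y y = 0\<close> by (simp add: algebra_simps)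
      then show ?thesis by simp
    qed
    ultimately have "2 * R x y = 0" "R y x = R x y" by (simp_all add: algebra_simps)
    then show ?thesis by simp
  qed
  have nn: "D n n = 0"
    using f0[of "?e n"] unit[of n n] unfolding R_def by (simp del: sum.lessThan_Suc)
  have n: "D n a = 0" "D a n = 0" if "a < n" for a
    using cross[of "?e n" "?e a"] unit[of n a] unit[of a n] that by auto
  have "D a b = 0" if "a < n" "b < n" for a b
  proof -
    have "R (\<lambda>i. ?e n i + ?e a i) (?e b) = 0" using cross[of "\<lambda>i. ?e n i + ?e a i" "?e b"] that by auto
    then show ?thesis using n(1)[OF that(2)] unit[of n b] unit[of a b] that by (simp add: add)
  qed
  then show ?thesis using jk n nn by (metis less_Suc_eq)
qed

lemma trace_conj_entries:
  assumes "s \<in> carrier_mat p p" "C \<in> carrier_mat p p"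
  shows "mat_trace (s * C * mat_adjoint s) = (\<Sum>i<p. \<Sum>j<p. \<Sum>k<p. s $$ (i, j) * C $$ (j, k) * cnj (s $$ (i, k)))"
proof -
  have sC: "s * C \<in> carrier_mat p p" using assms by auto
  have "mat_trace (s * C * mat_adjoint s) = (\<Sum>i<p. \<Sum>k<p. (s * C) $$ (i, k) * mat_adjoint s $$ (k, i))"
    by (rule trace_mult[OF sC adj_carrier[OF assms(1)]])
  also have "\<dots> = (\<Sum>i<p. \<Sum>k<p. (\<Sum>j<p. s $$ (i, j) * C $$ (j, k)) * cnj (s $$ (i, k)))"
    using assms by (intro sum.cong) (auto simp: scalar_prod_def atLeast0LessThan)
  also have "\<dots> = (\<Sum>i<p. \<Sum>j<p. \<Sum>k<p. s $$ (i, j) * C $$ (j, k) * cnj (s $$ (i, k)))"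
    unfolding sum_distrib_right by (intro sum.cong refl sum.swap)
  finally show ?thesis .
qed

lemma trace_conj_zero:
  assumes C: "C \<in> carrier_mat p p"
    and zero: "\<And>s. s \<in> S_group p \<Longrightarrow> mat_trace (s * C * mat_adjoint s) = 0"
  shows "C = 0\<^sub>m p p"
proof (cases p)
  case 0
  then show ?thesis using C by (intro eq_matI) auto
next
  case (Suc n)
  define f where "f r = (\<Sum>j<Suc n. \<Sum>k<Suc n. r j * C $$ (j, k) * cnj (r k))" for r
  define c where "c = (\<Sum>i<n. C $$ (i, i))"
  \<comment> \<open>Take the identity matrix with its last row replaced by \<open>r\<close>.\<close>
  have fc: "c + f r = 0" if r: "r n \<in> \<real>" "0 < Re (r n)" for r
  proof -
    let ?s = "mat p p (\<lambda>(i, j). if i = n then r j else if i = j then 1 else 0)"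
    have s: "?s \<in> S_group p" unfolding S_group_def using r Suc by auto
    have "0 = mat_trace (?s * C * mat_adjoint ?s)" using zero[OF s] by simp
    also have "\<dots> = (\<Sum>i<p. \<Sum>j<p. \<Sum>k<p. ?s $$ (i, j) * C $$ (j, k) * cnj (?s $$ (i, k)))"
      by (rule trace_conj_entries[OF S_group_carrier[OF s] C])
    also have "\<dots> = (\<Sum>i<n. \<Sum>j<p. \<Sum>k<p. ?s $$ (i, j) * C $$ (j, k) * cnj (?s $$ (i, k)))
      + (\<Sum>j<p. \<Sum>k<p. ?s $$ (n, j) * C $$ (j, k) * cnj (?s $$ (n, k)))"
      unfolding Suc by (simp only: sum.lessThan_Suc)
    also have "(\<Sum>j<p. \<Sum>k<p. ?s $$ (n, j) * C $$ (j, k) * cnj (?s $$ (n, k))) = f r"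
      unfolding f_def Suc[symmetric] using Suc by (intro sum.cong) auto
    also have "(\<Sum>i<n. \<Sum>j<p. \<Sum>k<p. ?s $$ (i, j) * C $$ (j, k) * cnj (?s $$ (i, k))) = c"
      unfolding c_def
    proof (intro sum.cong refl)
      fix i assume "i \<in> {..<n}"
      then have i: "i < p" "i \<noteq> n" using Suc by auto
      have "(\<Sum>j<p. \<Sum>k<p. ?s $$ (i, j) * C $$ (j, k) * cnj (?s $$ (i, k))) = (\<Sum>j<p. if j = i then C $$ (j, i) else 0)"
        using i by (intro sum.cong refl) (auto simp: if_distrib[of cnj] if_distrib[of "\<lambda>x. _ * x"] cong: if_cong)
      then show "(\<Sum>j<p. \<Sum>k<p. ?s $$ (i, j) * C $$ (j, k) * cnj (?s $$ (i, k))) = C $$ (i, i)" using i by simp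
    qed
    finally show ?thesis by simp
  qed
  \<comment> \<open>Doubling \<open>r\<close> multiplies \<open>f r\<close> by 4 and does not change \<open>c\<close>.\<close>
  have f0: "f r = 0" if r: "r n \<in> \<real>" "0 < Re (r n)" for r
  proof -
    have "f (\<lambda>i. 2 * r i) = 4 * f r" unfolding f_def by (simp add: sum_distrib_left mult_ac del: sum.lessThan_Suc)
    moreover have "c + f (\<lambda>i. 2 * r i) = 0" by (rule fc) (use r in auto)
    ultimately have "c + 4 * f r = c + f r" using fc[of r, OF r] by simp
    then show ?thesis by simp
  qed
  have "C $$ (j, k) = 0" if "j < Suc n" "k < Suc n" for j k
    by (rule sesquilinear_zero[of n "\<lambda>j k. C $$ (j, k)", OF f0[unfolded f_def] that])
  then show ?thesis using C Suc by (intro eq_matI) auto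
qed

lemma expo_separates:
  assumes v: "v \<in> siegel p m" and w: "w \<in> siegel p m" and ne: "v \<noteq> w"
  obtains s z where "s \<in> S_group p" "z \<in> carrier_mat p m" "expo p m v s z \<noteq> expo p m w s z"
proof (rule ccontr)
  assume "\<not> thesis"
  with that have eq: "expo p m v s z = expo p m w s z" if "s \<in> S_group p" "z \<in> carrier_mat p m" for s z
    using that by blast
  note vc = siegel_carrier[OF v] and wc = siegel_carrier[OF w]
  have c: "E2 p m * v \<in> carrier_mat m p" "E2 p m * w \<in> carrier_mat m p"
    "E3 p m * v \<in> carrier_mat p p" "E3 p m * w \<in> carrier_mat p p" using vc wc by auto
  have trz: "mat_trace (0\<^sub>m p m * (X * mat_adjoint s)) = 0" if "X \<in> carrier_mat m p" "s \<in> carrier_mat p p" for X s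
    using that by (simp add: left_mult_zero_mat[of _ m p] mat_trace_def)
  have 3: "mat_trace (s * (E3 p m * v) * mat_adjoint s) = mat_trace (s * (E3 p m * w) * mat_adjoint s)"
    if s: "s \<in> S_group p" for s
    using eq[OF s zero_carrier_mat] trz[OF c(1) S_group_carrier[OF s]] trz[OF c(2) S_group_carrier[OF s]]
    unfolding expo_def by simp
  have "E3 p m * v - E3 p m * w = 0\<^sub>m p p"
  proof (rule trace_conj_zero)
    show "E3 p m * v - E3 p m * w \<in> carrier_mat p p" by (rule minus_carrier_mat[OF c(4)])
    show "mat_trace (s * (E3 p m * v - E3 p m * w) * mat_adjoint s) = 0" if "s \<in> S_group p" for s
      using 3[OF that] trace_conj_minus[OF S_group_carrier[OF that] c(3,4)] by simp
  qed
  then have e3: "E3 p m * v = E3 p m * w"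
  proof (intro eq_matI)
    fix i j assume 0: "E3 p m * v - E3 p m * w = 0\<^sub>m p p" "i < dim_row (E3 p m * w)" "j < dim_col (E3 p m * w)"
    then have "(E3 p m * v - E3 p m * w) $$ (i, j) = 0" using c by auto
    then show "(E3 p m * v) $$ (i, j) = (E3 p m * w) $$ (i, j)"
      using 0(2,3) c by (simp del: index_mult_mat(1))
  qed (use vc wc in auto)
  have e2: "E2 p m * v = E2 p m * w"
  proof (rule eq_matI)
    fix i j assume "i < dim_row (E2 p m * w)" "j < dim_col (E2 p m * w)"
    then have ij: "i < m" "j < p" using wc by auto
    let ?z = "mat p m (\<lambda>(a, b). if a = j \<and> b = i then 1 else 0)"
    have z: "?z \<in> carrier_mat p m" by auto
    have tr: "mat_trace (?z * X) = X $$ (i, j)" if X: "X \<in> carrier_mat m p" for X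
    proof -
      have "mat_trace (?z * X) = (\<Sum>a<p. \<Sum>b<m. ?z $$ (a, b) * X $$ (b, a))" by (rule trace_mult[OF z X])
      also have "\<dots> = (\<Sum>a<p. if a = j then X $$ (i, a) else 0)"
        using ij by (intro sum.cong refl) (auto simp: if_distrib[of "\<lambda>x. x * _"] cong: if_cong)
      also have "\<dots> = X $$ (i, j)" using ij by simp
      finally show ?thesis .
    qed
    have "mat_trace (?z * (E2 p m * v)) = mat_trace (?z * (E2 p m * w))"
      using eq[OF S_group_one z] 3[OF S_group_one] unfolding expo_def adj_one
      by (simp add: right_mult_one_mat[OF c(1)] right_mult_one_mat[OF c(2)])
    then show "(E2 p m * v) $$ (i, j) = (E2 p m * w) $$ (i, j)" unfolding tr[OF c(1)] tr[OF c(2)] .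
  qed (use vc wc in auto)
  have "v = w"
    by (rule eq_by_blocks[OF vc wc]) (use siegel_E1[OF v] siegel_E1[OF w] e2 e3 in auto)
  with ne show False by simp
qed

lemma S_group_comb:
  assumes "s \<in> S_group p" "s' \<in> S_group p" "0 < t"
  shows "s + complex_of_real t \<cdot>\<^sub>m s' \<in> S_group p"
proof -
  note c = S_group_carrier[OF assms(1)] S_group_carrier[OF assms(2)]
  have "(s + complex_of_real t \<cdot>\<^sub>m s') $$ (i, j) = s $$ (i, j) + of_real t * s' $$ (i, j)" if "i < p" "j < p" for i j
    using that c by auto
  then show ?thesis using assms c unfolding S_group_def by (auto intro!: add_pos_pos)
qed

lemma S_group_smult:
  assumes "s \<in> S_group p" "0 < t"
  shows "complex_of_real t \<cdot>\<^sub>m s \<in> S_group p"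
proof -
  note c = S_group_carrier[OF assms(1)]
  have "(complex_of_real t \<cdot>\<^sub>m s) $$ (i, j) = of_real t * s $$ (i, j)" if "i < p" "j < p" for i j
    using that c by auto
  then show ?thesis using assms c unfolding S_group_def by auto
qed

lemma expo_entries:
  assumes "v \<in> carrier_mat (p + m + p) p" "s \<in> carrier_mat p p" "z \<in> carrier_mat p m"
  shows "expo p m v s z = (\<Sum>i<p. \<Sum>j<p. \<Sum>k<p. s $$ (i, j) * (E3 p m * v) $$ (j, k) * cnj (s $$ (i, k)))
    + (\<Sum>i<p. \<Sum>j<m. \<Sum>k<p. z $$ (i, j) * (E2 p m * v) $$ (j, k) * cnj (s $$ (i, k)))"
proof -
  have c: "E2 p m * v \<in> carrier_mat m p" "E3 p m * v \<in> carrier_mat p p" using assms by auto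
  have Bs: "E2 p m * v * mat_adjoint s \<in> carrier_mat m p" using c assms by auto
  have "mat_trace (z * (E2 p m * v * mat_adjoint s)) = (\<Sum>i<p. \<Sum>j<m. z $$ (i, j) * (E2 p m * v * mat_adjoint s) $$ (j, i))"
    by (rule trace_mult[OF assms(3) Bs])
  also have "\<dots> = (\<Sum>i<p. \<Sum>j<m. z $$ (i, j) * (\<Sum>k<p. (E2 p m * v) $$ (j, k) * cnj (s $$ (i, k))))"
  proof (intro sum.cong refl)
    fix i j assume "i \<in> {..<p}" "j \<in> {..<m}"
    then have "(E2 p m * v * mat_adjoint s) $$ (j, i) = (\<Sum>k<p. (E2 p m * v) $$ (j, k) * cnj (s $$ (i, k)))"
      using c assms by (subst index_mult_mat(1)) (auto simp: scalar_prod_def atLeast0LessThan simp del: index_mult_mat(1))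
    then show "z $$ (i, j) * (E2 p m * v * mat_adjoint s) $$ (j, i)
      = z $$ (i, j) * (\<Sum>k<p. (E2 p m * v) $$ (j, k) * cnj (s $$ (i, k)))" by simp
  qed
  finally show ?thesis
    unfolding expo_def trace_conj_entries[OF assms(2) c(2)] by (simp add: sum_distrib_left mult.assoc)
qed

text \<open>Along a line the exponent is a quadratic polynomial, whose leading coefficient is the exponent at the
  direction of the line.\<close>

lemma expo_line:
  assumes v: "v \<in> carrier_mat (p + m + p) p" and s: "s \<in> carrier_mat p p" "s' \<in> carrier_mat p p"
    and z: "z \<in> carrier_mat p m" "z' \<in> carrier_mat p m"
  obtains b where "\<And>t. expo p m v (s + complex_of_real t \<cdot>\<^sub>m s') (z + complex_of_real t \<cdot>\<^sub>m z')
    = expo p m v s z + b * of_real t + expo p m v s' z' * (of_real t)\<^sup>2"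
proof
  fix t :: real
  let ?t = "complex_of_real t"
  let ?C = "\<lambda>j k. (E3 p m * v) $$ (j, k)" and ?B = "\<lambda>j k. (E2 p m * v) $$ (j, k)"
  let ?c = "\<lambda>i j k. s $$ (i, j) * ?C j k * cnj (s' $$ (i, k)) + s' $$ (i, j) * ?C j k * cnj (s $$ (i, k))"
  let ?d = "\<lambda>i j k. z $$ (i, j) * ?B j k * cnj (s' $$ (i, k)) + z' $$ (i, j) * ?B j k * cnj (s $$ (i, k))"
  let ?b = "(\<Sum>i<p. \<Sum>j<p. \<Sum>k<p. ?c i j k) + (\<Sum>i<p. \<Sum>j<m. \<Sum>k<p. ?d i j k)"
  let ?s = "s + ?t \<cdot>\<^sub>m s'" and ?z = "z + ?t \<cdot>\<^sub>m z'"
  have cc: "?s \<in> carrier_mat p p" "?z \<in> carrier_mat p m" using s z by auto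
  have 1: "(\<Sum>i<p. \<Sum>j<p. \<Sum>k<p. ?s $$ (i, j) * ?C j k * cnj (?s $$ (i, k)))
    = (\<Sum>i<p. \<Sum>j<p. \<Sum>k<p. s $$ (i, j) * ?C j k * cnj (s $$ (i, k)) + ?c i j k * ?t
        + s' $$ (i, j) * ?C j k * cnj (s' $$ (i, k)) * ?t\<^sup>2)"
    using s by (intro sum.cong refl) (simp add: algebra_simps power2_eq_square del: index_mult_mat(1))
  have 2: "(\<Sum>i<p. \<Sum>j<m. \<Sum>k<p. ?z $$ (i, j) * ?B j k * cnj (?s $$ (i, k)))
    = (\<Sum>i<p. \<Sum>j<m. \<Sum>k<p. z $$ (i, j) * ?B j k * cnj (s $$ (i, k)) + ?d i j k * ?t
        + z' $$ (i, j) * ?B j k * cnj (s' $$ (i, k)) * ?t\<^sup>2)"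
    using s z by (intro sum.cong refl) (simp add: algebra_simps power2_eq_square del: index_mult_mat(1))
  have 3: "(\<Sum>i<p. \<Sum>j<n. \<Sum>k<p. X i j k + Y i j k * ?t + Z i j k * ?t\<^sup>2)
    = (\<Sum>i<p. \<Sum>j<n. \<Sum>k<p. X i j k) + (\<Sum>i<p. \<Sum>j<n. \<Sum>k<p. Y i j k) * ?t + (\<Sum>i<p. \<Sum>j<n. \<Sum>k<p. Z i j k) * ?t\<^sup>2"
    for X Y Z and n :: nat
    by (simp only: sum.distrib sum_distrib_right)
  have 4: "(x + y * ?t + w * ?t\<^sup>2) + (x' + y' * ?t + w' * ?t\<^sup>2) = (x + x') + (y + y') * ?t + (w + w') * ?t\<^sup>2"
    for x y w x' y' w' by (simp add: algebra_simps)
  show "expo p m v ?s ?z = expo p m v s z + ?b * ?t + expo p m v s' z' * ?t\<^sup>2"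
    unfolding expo_entries[OF v cc] expo_entries[OF v s(1) z(1)] expo_entries[OF v s(2) z(2)] 1 2 3 4 ..
qed

lemma finite_quadratic_roots:
  fixes a b c :: complex
  assumes "a \<noteq> 0 \<or> c \<noteq> 0"
  shows "finite {t :: real. a + b * of_real t + c * (of_real t)\<^sup>2 = 0}"
proof -
  have "finite {x. poly [:a, b, c:] x = 0}" by (rule poly_roots_finite) (use assms in auto)
  then have "finite (complex_of_real -` {x. poly [:a, b, c:] x = 0})"
    by (rule finite_vimageI) (simp add: inj_on_def)
  then show ?thesis by (rule rev_finite_subset) (auto simp: algebra_simps power2_eq_square)
qed

text \<open>Finitely many exponents are separated by one point: a quadratic perturbation along a segment
  separates one more pair without spoiling the others.\<close>

lemma expo_separates_finite:
  assumes "finite P" "\<And>v w. (v, w) \<in> P \<Longrightarrow> v \<in> siegel p m \<and> w \<in> siegel p m \<and> v \<noteq> w"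
  shows "\<exists>s \<in> S_group p. \<exists>z \<in> carrier_mat p m. \<forall>(v, w) \<in> P. expo p m v s z \<noteq> expo p m w s z"
  using assms
proof (induction P rule: finite_induct)
  case empty
  then show ?case using S_group_one[of p] zero_carrier_mat by blast
next
  case (insert x P)
  obtain v0 w0 where x: "x = (v0, w0)" by fastforce
  have "\<exists>s \<in> S_group p. \<exists>z \<in> carrier_mat p m. \<forall>(v, w) \<in> P. expo p m v s z \<noteq> expo p m w s z"
    by (rule insert.IH) (use insert.prems in blast)
  then obtain s z where sz: "s \<in> S_group p" "z \<in> carrier_mat p m"
    and P: "\<And>v w. (v, w) \<in> P \<Longrightarrow> expo p m v s z \<noteq> expo p m w s z" by blast
  obtain s' z' where sz': "s' \<in> S_group p" "z' \<in> carrier_mat p m" "expo p m v0 s' z' \<noteq> expo p m w0 s' z'"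
    using expo_separates[of v0 p m w0] insert.prems[of v0 w0] x by blast
  note c = S_group_carrier[OF sz(1)] S_group_carrier[OF sz'(1)] sz(2) sz'(2)
  define bad where "bad q = {t :: real. expo p m (fst q) (s + of_real t \<cdot>\<^sub>m s') (z + of_real t \<cdot>\<^sub>m z')
      = expo p m (snd q) (s + of_real t \<cdot>\<^sub>m s') (z + of_real t \<cdot>\<^sub>m z')}" for q
  have "finite (bad q)" if q: "q \<in> insert x P" for q
  proof -
    obtain v w where vw: "q = (v, w)" by fastforce
    have cv: "v \<in> carrier_mat (p + m + p) p" "w \<in> carrier_mat (p + m + p) p"
      using insert.prems q vw siegel_carrier by auto
    obtain b where b: "\<And>t. expo p m v (s + of_real t \<cdot>\<^sub>m s') (z + of_real t \<cdot>\<^sub>m z')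
        = expo p m v s z + b * of_real t + expo p m v s' z' * (of_real t)\<^sup>2"
      using expo_line[OF cv(1) c] by blast
    obtain b' where b': "\<And>t. expo p m w (s + of_real t \<cdot>\<^sub>m s') (z + of_real t \<cdot>\<^sub>m z')
        = expo p m w s z + b' * of_real t + expo p m w s' z' * (of_real t)\<^sup>2"
      using expo_line[OF cv(2) c] by blast
    have "expo p m v s z - expo p m w s z \<noteq> 0 \<or> expo p m v s' z' - expo p m w s' z' \<noteq> 0"
      using q P sz'(3) x vw by auto
    then have "finite {t :: real. (expo p m v s z - expo p m w s z) + (b - b') * of_real t
        + (expo p m v s' z' - expo p m w s' z') * (of_real t)\<^sup>2 = 0}"
      by (rule finite_quadratic_roots)
    then show ?thesis
      by (rule rev_finite_subset) (auto simp: bad_def vw b b' algebra_simps)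
  qed
  then have "finite (\<Union>q\<in>insert x P. bad q)" using insert.hyps by blast
  then have "infinite ({0::real<..} - (\<Union>q\<in>insert x P. bad q))"
    by (intro Diff_infinite_finite) (auto simp: infinite_Ioi)
  then obtain t where t: "t \<in> {0::real<..} - (\<Union>q\<in>insert x P. bad q)"
    using infinite_imp_nonempty by blast
  let ?s = "s + complex_of_real t \<cdot>\<^sub>m s'" and ?z = "z + complex_of_real t \<cdot>\<^sub>m z'"
  have "?s \<in> S_group p" by (rule S_group_comb) (use sz sz' t in auto)
  moreover have "?z \<in> carrier_mat p m" using c by auto
  moreover have "\<forall>(v, w) \<in> insert x P. expo p m v ?s ?z \<noteq> expo p m w ?s ?z"
  proof (clarify)
    fix v w assume "(v, w) \<in> insert x P" and e: "expo p m v ?s ?z = expo p m w ?s ?z"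
    then have "t \<notin> bad (v, w)" using t by blast
    with e show False unfolding bad_def by simp
  qed
  ultimately show ?case by blast
qed

text \<open>Exponentials of distinct rates are linearly independent on the positive half-line: divide the relation by
  one of them and differentiate, which removes that term.\<close>

lemma exponentials_independent:
  fixes a c :: "'i \<Rightarrow> complex"
  assumes "finite A" "inj_on a A" "\<And>\<tau> :: real. 0 < \<tau> \<Longrightarrow> (\<Sum>i\<in>A. c i * exp (of_real \<tau> * a i)) = 0" "i \<in> A"
  shows "c i = 0"
  using assms
proof (induction A arbitrary: a c i rule: finite_induct)
  case empty
  then show ?case by simp
next
  case (insert n A)
  define g where "g \<tau> = c n + (\<Sum>i\<in>A. c i * exp (of_real \<tau> * (a i - a n)))" for \<tau> :: real
  have g0: "g \<tau> = 0" if "0 < \<tau>" for \<tau>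
  proof -
    have "g \<tau> * exp (of_real \<tau> * a n) = (\<Sum>i\<in>insert n A. c i * exp (of_real \<tau> * a i))"
      using insert.hyps unfolding g_def
      by (simp add: distrib_right sum_distrib_right mult.assoc flip: exp_add) (simp add: algebra_simps)
    then show ?thesis using insert.prems(2)[OF that] by simp
  qed
  have d0: "(\<Sum>i\<in>A. (c i * (a i - a n)) * exp (of_real \<tau> * (a i - a n))) = 0" if \<tau>: "0 < \<tau>" for \<tau>
  proof -
    have e: "((\<lambda>\<tau>. c i * exp (of_real \<tau> * (a i - a n))) has_vector_derivative
        (c i * (a i - a n)) * exp (of_real \<tau> * (a i - a n))) (at \<tau>)" for i
    proof -
      have "((\<lambda>x. c i * exp (x * (a i - a n))) has_field_derivative
        (c i * (a i - a n)) * exp (of_real \<tau> * (a i - a n))) (at (of_real \<tau>))"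
        by (auto intro!: derivative_eq_intros)
      from has_vector_derivative_real_field[OF this] show ?thesis .
    qed
    have D1: "(g has_vector_derivative (0 + (\<Sum>i\<in>A. (c i * (a i - a n)) * exp (of_real \<tau> * (a i - a n))))) (at \<tau>)"
      unfolding g_def by (intro derivative_intros e)
    have D2: "(g has_vector_derivative 0) (at \<tau>)"
    proof (rule has_vector_derivative_transform_within_open[of "\<lambda>_. 0" 0 \<tau> "{0<..}"])
      show "((\<lambda>_. 0) has_vector_derivative 0) (at \<tau>)" by simp
    qed (use \<tau> g0 in auto)
    from vector_derivative_unique_at[OF D1 D2] show ?thesis by simp
  qed
  have inj: "inj_on (\<lambda>i. a i - a n) A" using insert.prems(1) by (auto simp: inj_on_def)
  have "c i * (a i - a n) = 0" if "i \<in> A" for i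
    by (rule insert.IH[OF inj d0 that])
  moreover have "a i \<noteq> a n" if "i \<in> A" for i using insert.prems(1) insert.hyps that by (auto simp: inj_on_def)
  ultimately have cA: "c i = 0" if "i \<in> A" for i using that by fastforce
  moreover have "c n = 0" using g0[of 1] cA unfolding g_def by simp
  ultimately show ?case using insert.prems by auto
qed

lemma phi_independent:
  assumes A: "finite A" "A \<subseteq> siegel p m"
    and zero: "\<And>s z. s \<in> S_group p \<Longrightarrow> z \<in> carrier_mat p m \<Longrightarrow> (\<Sum>v\<in>A. c v * phi p m v s z) = 0"
    and v: "v \<in> A"
  shows "c v = 0"
proof -
  have "\<exists>s \<in> S_group p. \<exists>z \<in> carrier_mat p m. \<forall>(v, w) \<in> {(v, w) \<in> A \<times> A. v \<noteq> w}. expo p m v s z \<noteq> expo p m w s z"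
    by (rule expo_separates_finite) (use A in \<open>auto intro: finite_subset[of _ "A \<times> A"]\<close>)
  then obtain s z where s: "s \<in> S_group p" and z: "z \<in> carrier_mat p m"
    and sep: "\<And>v w. v \<in> A \<Longrightarrow> w \<in> A \<Longrightarrow> v \<noteq> w \<Longrightarrow> expo p m v s z \<noteq> expo p m w s z" by blast
  note sc = S_group_carrier[OF s]
  \<comment> \<open>The exponent is homogeneous of degree 2 in \<open>(s, z)\<close>, so the ray through the separating point yields a
    relation between exponentials in one variable.\<close>
  have scale: "expo p m v (of_real t \<cdot>\<^sub>m s) (of_real t \<cdot>\<^sub>m z) = of_real (t\<^sup>2) * expo p m v s z" if "v \<in> A" for v t
  proof -
    have vc: "v \<in> carrier_mat (p + m + p) p" using that A siegel_carrier by auto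
    have c: "complex_of_real t \<cdot>\<^sub>m s \<in> carrier_mat p p" "complex_of_real t \<cdot>\<^sub>m z \<in> carrier_mat p m" using sc z by auto
    show ?thesis unfolding expo_entries[OF vc c] expo_entries[OF vc sc z] distrib_left sum_distrib_left
      using sc z by (intro arg_cong2[of _ _ _ _ "(+)"] sum.cong refl)
        (auto simp: power2_eq_square simp del: index_mult_mat(1))
  qed
  have "(\<Sum>v\<in>A. c v * exp (of_real \<tau> * expo p m v s z)) = 0" if "0 < \<tau>" for \<tau> :: real
  proof -
    have "(\<Sum>v\<in>A. c v * phi p m v (of_real (sqrt \<tau>) \<cdot>\<^sub>m s) (of_real (sqrt \<tau>) \<cdot>\<^sub>m z)) = 0"
      by (rule zero) (use s z that in \<open>auto intro!: S_group_smult\<close>)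
    then show ?thesis using that unfolding phi_def by (simp add: scale cong: sum.cong)
  qed
  moreover have "inj_on (\<lambda>v. expo p m v s z) A" using sep by (auto simp: inj_on_def)
  ultimately show ?thesis using exponentials_independent[OF A(1) _ _ v, of "\<lambda>v. expo p m v s z" c] by blast
qed

section \<open>Integration over matrices\<close>

lemma space_mat_borel [simp]: "space (mat_borel k m) = carrier_mat k m"
  unfolding mat_borel_def by simp

lemma measurable_mat_entry [measurable]:
  assumes "i < k" "j < m"
  shows "(\<lambda>A. A $$ (i, j)) \<in> borel_measurable (mat_borel k m)"
proof -
  have "(\<lambda>A. \<lambda>ij\<in>{..<k} \<times> {..<m}. A $$ ij) \<in> measurable (mat_borel k m) (Pi\<^sub>M ({..<k} \<times> {..<m}) (\<lambda>_. borel))"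
    unfolding mat_borel_def by (rule measurable_vimage_algebra1) (auto simp: space_PiM)
  from measurable_compose[OF this measurable_component_singleton[of "(i, j)"]] assms
  show ?thesis by auto
qed

lemma measurable_into_mat_borel:
  assumes "\<And>x. x \<in> space M \<Longrightarrow> f x \<in> carrier_mat k m"
    and "\<And>i j. i < k \<Longrightarrow> j < m \<Longrightarrow> (\<lambda>x. f x $$ (i, j)) \<in> borel_measurable M"
  shows "f \<in> measurable M (mat_borel k m)"
  unfolding mat_borel_def
proof (rule measurable_vimage_algebra2)
  show "f \<in> space M \<rightarrow> carrier_mat k m" using assms by auto
  show "(\<lambda>x. \<lambda>ij\<in>{..<k} \<times> {..<m}. f x $$ ij) \<in> measurable M (Pi\<^sub>M ({..<k} \<times> {..<m}) (\<lambda>_. borel))"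
    by (rule measurable_restrict) (use assms in auto)
qed

lemma measurable_mat [measurable]:
  "mat k m \<in> measurable (Pi\<^sub>M ({..<k} \<times> {..<m}) (\<lambda>_. lborel)) (mat_borel k m)"
proof (rule measurable_into_mat_borel)
  fix i j assume ij: "i < k" "j < m"
  have "(\<lambda>x. x (i, j)) \<in> measurable (Pi\<^sub>M ({..<k} \<times> {..<m}) (\<lambda>_. lborel :: complex measure)) lborel"
    by (rule measurable_component_singleton) (use ij in auto)
  then show "(\<lambda>x. mat k m x $$ (i, j)) \<in> borel_measurable (Pi\<^sub>M ({..<k} \<times> {..<m}) (\<lambda>_. lborel :: complex measure))"
    using ij by simp
qed auto

lemma sets_gauss [measurable_cong]: "sets (gauss_measure k m) = sets (mat_borel k m)"
  unfolding gauss_measure_def mat_lebesgue_def by simp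

lemma space_gauss [simp]: "space (gauss_measure k m) = carrier_mat k m"
  using sets_eq_imp_space_eq[OF sets_gauss[of k m]] by simp

lemma measurable_trace_gauss_weight:
  "(\<lambda>z. mat_trace (z * mat_adjoint z)) \<in> borel_measurable (mat_borel k m)"
proof (subst measurable_cong)
  show "mat_trace (z * mat_adjoint z) = of_real (\<Sum>i<k. \<Sum>j<m. (cmod (z $$ (i, j)))\<^sup>2)" if "z \<in> space (mat_borel k m)" for z
    using that by (simp only: space_mat_borel trace_mult_adj_entries)
  have [measurable]: "(\<lambda>A. A $$ (i, j)) \<in> borel_measurable (mat_borel k m)" if "i \<in> {..<k}" "j \<in> {..<m}" for i j
    using that by (intro measurable_mat_entry) auto
  show "(\<lambda>z. complex_of_real (\<Sum>i<k. \<Sum>j<m. (cmod (z $$ (i, j)))\<^sup>2)) \<in> borel_measurable (mat_borel k m)"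
    by measurable
qed

text \<open>A Gaussian integral of a product of functions of the entries.\<close>

lemma nn_integral_gauss_prod:
  fixes g :: "nat \<times> nat \<Rightarrow> complex \<Rightarrow> ennreal"
  assumes [measurable]: "\<And>ij. g ij \<in> borel_measurable borel"
  shows "(\<integral>\<^sup>+z. (\<Prod>ij\<in>{..<k} \<times> {..<m}. g ij (z $$ ij)) \<partial>gauss_measure k m)
    = (\<Prod>ij\<in>{..<k} \<times> {..<m}. \<integral>\<^sup>+w. ennreal (exp (- (cmod w)\<^sup>2) / pi) * g ij w \<partial>lborel)"
proof -
  let ?I = "{..<k} \<times> {..<m}"
  interpret product_sigma_finite "\<lambda>_ :: nat \<times> nat. lborel :: complex measure"
    by standard
  have [measurable]: "(\<lambda>z. g ij (z $$ ij)) \<in> borel_measurable (mat_borel k m)" if "ij \<in> ?I" for ij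
    using measurable_mat_entry[of "fst ij" k "snd ij" m] that by (auto intro!: measurable_compose[OF _ assms])
  have G: "(\<lambda>z. \<Prod>ij\<in>?I. g ij (z $$ ij)) \<in> borel_measurable (mat_borel k m)"
    by (rule borel_measurable_prod_ennreal) simp_all
  note W[measurable] = measurable_trace_gauss_weight[of k m]
  have "(\<integral>\<^sup>+z. (\<Prod>ij\<in>?I. g ij (z $$ ij)) \<partial>gauss_measure k m)
    = (\<integral>\<^sup>+z. ennreal (exp (- Re (mat_trace (z * mat_adjoint z))) / pi ^ (k * m)) * (\<Prod>ij\<in>?I. g ij (z $$ ij)) \<partial>mat_lebesgue k m)"
    unfolding gauss_measure_def using G
    by (subst nn_integral_density) (auto simp: mat_lebesgue_def)
  also have "\<dots> = (\<integral>\<^sup>+x. ennreal (exp (- Re (mat_trace (mat k m x * mat_adjoint (mat k m x)))) / pi ^ (k * m)) *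
      (\<Prod>ij\<in>?I. g ij (mat k m x $$ ij)) \<partial>Pi\<^sub>M ?I (\<lambda>_. lborel))"
    unfolding mat_lebesgue_def using G by (subst nn_integral_distr) (auto simp: measurable_mat)
  also have "\<dots> = (\<integral>\<^sup>+x. (\<Prod>ij\<in>?I. ennreal (exp (- (cmod (x ij))\<^sup>2) / pi) * g ij (x ij)) \<partial>Pi\<^sub>M ?I (\<lambda>_. lborel))"
  proof (rule nn_integral_cong)
    fix x :: "nat \<times> nat \<Rightarrow> complex"
    have "Re (mat_trace (mat k m x * mat_adjoint (mat k m x))) = (\<Sum>ij\<in>?I. (cmod (x ij))\<^sup>2)"
      by (subst trace_mult_adj_entries[of _ k m]) (auto simp: sum.cartesian_product intro!: sum.cong)
    then have "exp (- Re (mat_trace (mat k m x * mat_adjoint (mat k m x)))) / pi ^ (k * m) = (\<Prod>ij\<in>?I. exp (- (cmod (x ij))\<^sup>2) / pi)"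
      by (simp add: exp_sum sum_negf[symmetric] prod_dividef)
    moreover have "(\<Prod>ij\<in>?I. g ij (mat k m x $$ ij)) = (\<Prod>ij\<in>?I. g ij (x ij))"
      by (rule prod.cong) auto
    ultimately show "ennreal (exp (- Re (mat_trace (mat k m x * mat_adjoint (mat k m x)))) / pi ^ (k * m)) *
      (\<Prod>ij\<in>?I. g ij (mat k m x $$ ij)) = (\<Prod>ij\<in>?I. ennreal (exp (- (cmod (x ij))\<^sup>2) / pi) * g ij (x ij))"
      by (simp add: prod.distrib prod_ennreal)
  qed
  also have "\<dots> = (\<Prod>ij\<in>?I. \<integral>\<^sup>+w. ennreal (exp (- (cmod w)\<^sup>2) / pi) * g ij w \<partial>lborel)"
    by (rule product_nn_integral_prod) auto
  finally show ?thesis .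
qed

lemma nn_integral_gauss_real:
  "(\<integral>\<^sup>+x. ennreal (exp (- x\<^sup>2 + 2 * c * x) / sqrt pi) \<partial>lborel) = ennreal (exp (c\<^sup>2))"
proof -
  have "exp (- x\<^sup>2 + 2 * c * x) / sqrt pi = exp (c\<^sup>2) * normal_density c (1 / sqrt 2) x" for x
  proof -
    have "normal_density c (1 / sqrt 2) x = exp (- (x - c)\<^sup>2) / sqrt pi"
      unfolding normal_density_def by (simp add: power_divide)
    moreover have "exp (c\<^sup>2) * exp (- (x - c)\<^sup>2) = exp (- x\<^sup>2 + 2 * c * x)"
      by (simp add: power2_eq_square algebra_simps flip: exp_add)
    ultimately show ?thesis by (metis times_divide_eq_right)
  qed
  then have "(\<integral>\<^sup>+x. ennreal (exp (- x\<^sup>2 + 2 * c * x) / sqrt pi) \<partial>lborel)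
    = (\<integral>\<^sup>+x. ennreal (exp (c\<^sup>2)) * ennreal (normal_density c (1 / sqrt 2) x) \<partial>lborel)"
    by (simp add: ennreal_mult')
  also have "\<dots> = ennreal (exp (c\<^sup>2)) * (\<integral>\<^sup>+x. ennreal (normal_density c (1 / sqrt 2) x) \<partial>lborel)"
    by (rule nn_integral_cmult) simp
  also have "(\<integral>\<^sup>+x. ennreal (normal_density c (1 / sqrt 2) x) \<partial>lborel) = 1"
    by (subst nn_integral_eq_integral) auto
  finally show ?thesis by simp
qed

text \<open>Completing the square in one complex variable.\<close>

lemma nn_integral_gauss_complex:
  "(\<integral>\<^sup>+w. ennreal (exp (- (cmod w)\<^sup>2) / pi) * ennreal (exp (2 * Re (w * b))) \<partial>lborel) = ennreal (exp ((cmod b)\<^sup>2))"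
proof -
  define c :: "complex \<Rightarrow> real" where "c = (\<lambda>e. if e = 1 then Re b else - Im b)"
  have "ennreal (exp (- (cmod w)\<^sup>2) / pi) * ennreal (exp (2 * Re (w * b)))
    = (\<Prod>e\<in>Basis. ennreal (exp (- (w \<bullet> e)\<^sup>2 + 2 * c e * (w \<bullet> e)) / sqrt pi))" for w :: complex
  proof -
    have "ennreal (exp (- (cmod w)\<^sup>2) / pi) * ennreal (exp (2 * Re (w * b)))
      = ennreal (exp (- (cmod w)\<^sup>2) * exp (2 * Re (w * b)) / pi)"
      by (simp flip: ennreal_mult)
    also have "exp (- (cmod w)\<^sup>2) * exp (2 * Re (w * b))
      = exp (- (Re w)\<^sup>2 + 2 * Re b * Re w) * exp (- (Im w)\<^sup>2 + 2 * (- Im b) * Im w)"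
      by (simp add: cmod_power2 algebra_simps flip: exp_add)
    also have "\<dots> / pi = (exp (- (Re w)\<^sup>2 + 2 * Re b * Re w) / sqrt pi) * (exp (- (Im w)\<^sup>2 + 2 * (- Im b) * Im w) / sqrt pi)"
      by simp
    finally show ?thesis
      by (simp add: Basis_complex_def c_def inner_complex_def flip: ennreal_mult)
  qed
  then have "(\<integral>\<^sup>+w. ennreal (exp (- (cmod w)\<^sup>2) / pi) * ennreal (exp (2 * Re (w * b))) \<partial>lborel)
    = (\<integral>\<^sup>+w. (\<Prod>e\<in>Basis. ennreal (exp (- (w \<bullet> e)\<^sup>2 + 2 * c e * (w \<bullet> e)) / sqrt pi)) \<partial>(lborel :: complex measure))"
    by simp
  also have "\<dots> = (\<Prod>e\<in>Basis. \<integral>\<^sup>+x. ennreal (exp (- x\<^sup>2 + 2 * c e * x) / sqrt pi) \<partial>lborel)"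
    by (rule nn_integral_lborel_prod) auto
  also have "\<dots> = (\<Prod>e\<in>Basis. ennreal (exp ((c e)\<^sup>2)))"
    by (simp only: nn_integral_gauss_real)
  also have "\<dots> = ennreal (exp ((cmod b)\<^sup>2))"
    by (simp add: Basis_complex_def c_def cmod_power2 flip: ennreal_mult exp_add)
  finally show ?thesis .
qed

lemma nn_integral_gauss_exp_trace:
  assumes X: "X \<in> carrier_mat m k"
  shows "(\<integral>\<^sup>+z. ennreal (exp (2 * Re (mat_trace (z * X)))) \<partial>gauss_measure k m) = ennreal (exp ((hs_norm X)\<^sup>2))"
proof -
  let ?I = "{..<k} \<times> {..<m}"
  let ?g = "\<lambda>ij w. ennreal (exp (2 * Re (w * X $$ (snd ij, fst ij))))"
  have "(\<integral>\<^sup>+z. ennreal (exp (2 * Re (mat_trace (z * X)))) \<partial>gauss_measure k m)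
    = (\<integral>\<^sup>+z. (\<Prod>ij\<in>?I. ?g ij (z $$ ij)) \<partial>gauss_measure k m)"
  proof (rule nn_integral_cong)
    fix z assume "z \<in> space (gauss_measure k m)"
    then have z: "z \<in> carrier_mat k m" by simp
    have "2 * Re (mat_trace (z * X)) = (\<Sum>ij\<in>?I. 2 * Re (z $$ ij * X $$ (snd ij, fst ij)))"
      unfolding trace_mult[OF z X] by (simp add: sum.cartesian_product Re_sum case_prod_unfold sum_distrib_left)
    then show "ennreal (exp (2 * Re (mat_trace (z * X)))) = (\<Prod>ij\<in>?I. ?g ij (z $$ ij))"
      by (simp add: exp_sum prod_ennreal)
  qed
  also have "\<dots> = (\<Prod>ij\<in>?I. \<integral>\<^sup>+w. ennreal (exp (- (cmod w)\<^sup>2) / pi) * ?g ij w \<partial>lborel)"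
    by (rule nn_integral_gauss_prod) measurable
  also have "\<dots> = (\<Prod>ij\<in>?I. ennreal (exp ((cmod (X $$ (snd ij, fst ij)))\<^sup>2)))"
    by (simp only: nn_integral_gauss_complex)
  also have "\<dots> = ennreal (exp (\<Sum>ij\<in>?I. (cmod (X $$ (snd ij, fst ij)))\<^sup>2))"
    by (simp add: prod_ennreal exp_sum)
  also have "(\<Sum>ij\<in>?I. (cmod (X $$ (snd ij, fst ij)))\<^sup>2) = (hs_norm X)\<^sup>2"
    unfolding hs_norm_square[OF X] by (subst sum.swap) (simp add: sum.cartesian_product case_prod_unfold)
  finally show ?thesis .
qed

text \<open>The \<open>l\<^sup>1\<close> norm of a matrix: its exponentials dominate all functions below.\<close>

definition l1_norm :: "complex mat \<Rightarrow> real" where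
  "l1_norm z = (\<Sum>ij\<in>{..<dim_row z} \<times> {..<dim_col z}. \<bar>Re (z $$ ij)\<bar> + \<bar>Im (z $$ ij)\<bar>)"

lemma l1_norm_nonneg [simp]: "0 \<le> l1_norm z"
  unfolding l1_norm_def by (intro sum_nonneg) auto

lemma l1_norm_measurable [measurable]: "l1_norm \<in> borel_measurable (mat_borel k m)"
proof (subst measurable_cong)
  show "l1_norm z = (\<Sum>ij\<in>{..<k} \<times> {..<m}. \<bar>Re (z $$ ij)\<bar> + \<bar>Im (z $$ ij)\<bar>)" if "z \<in> space (mat_borel k m)" for z
    using that by (simp only: space_mat_borel l1_norm_def carrier_matD)
  have [measurable]: "(\<lambda>z. z $$ ij) \<in> borel_measurable (mat_borel k m)" if "ij \<in> {..<k} \<times> {..<m}" for ij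
    using that measurable_mat_entry[of "fst ij" k "snd ij" m] by auto
  show "(\<lambda>z. \<Sum>ij\<in>{..<k} \<times> {..<m}. \<bar>Re (z $$ ij)\<bar> + \<bar>Im (z $$ ij)\<bar>) \<in> borel_measurable (mat_borel k m)"
    by (intro borel_measurable_sum) simp_all
qed

lemma norm_trace_le_l1:
  assumes "z \<in> carrier_mat k m" "X \<in> carrier_mat m k"
  shows "cmod (mat_trace (z * X)) \<le> hs_norm X * l1_norm z"
proof -
  have "cmod (mat_trace (z * X)) \<le> (\<Sum>i<k. \<Sum>j<m. cmod (z $$ (i, j) * X $$ (j, i)))"
    unfolding trace_mult[OF assms] by (intro order_trans[OF norm_sum] sum_mono order_refl)
  also have "\<dots> \<le> (\<Sum>i<k. \<Sum>j<m. hs_norm X * (\<bar>Re (z $$ (i, j))\<bar> + \<bar>Im (z $$ (i, j))\<bar>))"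
  proof (intro sum_mono)
    fix i j assume "i \<in> {..<k}" "j \<in> {..<m}"
    then have "cmod (X $$ (j, i)) \<le> hs_norm X" by (intro norm_index_le_hs_norm[OF assms(2)]) auto
    moreover have "cmod (z $$ (i, j)) \<le> \<bar>Re (z $$ (i, j))\<bar> + \<bar>Im (z $$ (i, j))\<bar>" by (rule cmod_le)
    ultimately show "cmod (z $$ (i, j) * X $$ (j, i)) \<le> hs_norm X * (\<bar>Re (z $$ (i, j))\<bar> + \<bar>Im (z $$ (i, j))\<bar>)"
      by (simp add: norm_mult mult.commute mult_mono)
  qed
  also have "\<dots> = hs_norm X * l1_norm z"
    using assms(1) by (simp add: l1_norm_def sum.cartesian_product case_prod_unfold sum_distrib_left sum.distrib distrib_left)
  finally show ?thesis .
qed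

lemma integrable_exp_l1:
  "integrable (gauss_measure k m) (\<lambda>z. exp (c * l1_norm z))"
proof (rule integrableI_nonneg)
  let ?I = "{..<k} \<times> {..<m}"
  let ?g = "\<lambda>w :: complex. ennreal (exp (c * (\<bar>Re w\<bar> + \<bar>Im w\<bar>)))"
  have 1: "(\<integral>\<^sup>+w. ennreal (exp (- (cmod w)\<^sup>2) / pi) * ?g w \<partial>lborel) < \<infinity>"
  proof -
    let ?b = "\<lambda>s t. complex_of_real (s * c / 2) - \<i> * complex_of_real (t * c / 2)"
    let ?h = "\<lambda>w b. ennreal (exp (- (cmod w)\<^sup>2) / pi) * ennreal (exp (2 * Re (w * b)))"
    \<comment> \<open>One of the four choices of signs gives \<open>\<bar>Re w\<bar> + \<bar>Im w\<bar>\<close>.\<close>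
    have e: "?g w \<le> ennreal (exp (2 * Re (w * ?b 1 1))) + ennreal (exp (2 * Re (w * ?b 1 (-1))))
      + ennreal (exp (2 * Re (w * ?b (-1) 1))) + ennreal (exp (2 * Re (w * ?b (-1) (-1))))" for w
    proof -
      have "exp (c * (\<bar>Re w\<bar> + \<bar>Im w\<bar>)) \<le> exp (c * (Re w + Im w)) + exp (c * (Re w - Im w))
        + exp (c * (- Re w + Im w)) + exp (c * (- Re w - Im w))"
      proof -
        have "exp (c * (\<bar>Re w\<bar> + \<bar>Im w\<bar>)) \<in> {exp (c * (Re w + Im w)), exp (c * (Re w - Im w)),
          exp (c * (- Re w + Im w)), exp (c * (- Re w - Im w))}"
          by (auto simp: abs_if)
        then show ?thesis
          using exp_gt_zero[of "c * (Re w + Im w)"] exp_gt_zero[of "c * (Re w - Im w)"]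
            exp_gt_zero[of "c * (- Re w + Im w)"] exp_gt_zero[of "c * (- Re w - Im w)"]
          by (elim insertE emptyE) linarith+
      qed
      also have "\<dots> = exp (2 * Re (w * ?b 1 1)) + exp (2 * Re (w * ?b 1 (-1)))
        + exp (2 * Re (w * ?b (-1) 1)) + exp (2 * Re (w * ?b (-1) (-1)))"
        by (simp add: algebra_simps)
      finally have "?g w \<le> ennreal (exp (2 * Re (w * ?b 1 1)) + exp (2 * Re (w * ?b 1 (-1)))
        + exp (2 * Re (w * ?b (-1) 1)) + exp (2 * Re (w * ?b (-1) (-1))))"
        by (rule ennreal_leI)
      then show ?thesis by (simp add: ennreal_plus)
    qed
    have add4: "(\<integral>\<^sup>+w. ?h w b1 + ?h w b2 + ?h w b3 + ?h w b4 \<partial>lborel) = ennreal (exp ((cmod b1)\<^sup>2))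
      + ennreal (exp ((cmod b2)\<^sup>2)) + ennreal (exp ((cmod b3)\<^sup>2)) + ennreal (exp ((cmod b4)\<^sup>2))" for b1 b2 b3 b4
    proof -
      have m: "(\<lambda>w. ?h w b) \<in> borel_measurable lborel" for b by measurable
      show ?thesis by (simp only: nn_integral_add m borel_measurable_add nn_integral_gauss_complex)
    qed
    have "(\<integral>\<^sup>+w. ennreal (exp (- (cmod w)\<^sup>2) / pi) * ?g w \<partial>lborel)
      \<le> (\<integral>\<^sup>+w. ?h w (?b 1 1) + ?h w (?b 1 (-1)) + ?h w (?b (-1) 1) + ?h w (?b (-1) (-1)) \<partial>lborel)"
      by (intro nn_integral_mono order_trans[OF mult_left_mono[OF e]]) (simp_all add: distrib_left)
    also have "\<dots> = ennreal (exp ((cmod (?b 1 1))\<^sup>2)) + ennreal (exp ((cmod (?b 1 (-1)))\<^sup>2))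
        + ennreal (exp ((cmod (?b (-1) 1))\<^sup>2)) + ennreal (exp ((cmod (?b (-1) (-1)))\<^sup>2))"
      by (rule add4)
    also have "\<dots> < \<infinity>" by simp
    finally show ?thesis .
  qed
  have "(\<integral>\<^sup>+z. ennreal (exp (c * l1_norm z)) \<partial>gauss_measure k m)
    = (\<integral>\<^sup>+z. (\<Prod>ij\<in>?I. ?g (z $$ ij)) \<partial>gauss_measure k m)"
  proof (rule nn_integral_cong)
    fix z assume "z \<in> space (gauss_measure k m)"
    then have z: "z \<in> carrier_mat k m" by simp
    show "ennreal (exp (c * l1_norm z)) = (\<Prod>ij\<in>?I. ?g (z $$ ij))"
      by (simp only: l1_norm_def carrier_matD[OF z] sum_distrib_left)
        (subst exp_sum, auto simp: prod_ennreal)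
  qed
  also have "\<dots> = (\<Prod>ij\<in>?I. \<integral>\<^sup>+w. ennreal (exp (- (cmod w)\<^sup>2) / pi) * ?g w \<partial>lborel)"
    by (rule nn_integral_gauss_prod) measurable
  also have "\<dots> < \<infinity>" using 1 by (simp add: power_less_top_ennreal)
  finally show "(\<integral>\<^sup>+z. ennreal (exp (c * l1_norm z)) \<partial>gauss_measure k m) < \<infinity>" .
qed auto

section \<open>The space \<open>K\<close>\<close>

text \<open>Minkowski's inequality for square integrable functions, from the pointwise inequality
  \<open>|x + y|\<^sup>2 \<le> (1 + e) |x|\<^sup>2 + (1 + 1/e) |y|\<^sup>2\<close>: the best \<open>e\<close> is the quotient of the two norms, which are
  enlarged a little to make them positive.\<close>

lemma L2_norm_triangle:
  fixes f g :: "'a \<Rightarrow> complex"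
  assumes f: "f \<in> borel_measurable M" "integrable M (\<lambda>x. (cmod (f x))\<^sup>2)"
    and g: "g \<in> borel_measurable M" "integrable M (\<lambda>x. (cmod (g x))\<^sup>2)"
  shows "integrable M (\<lambda>x. (cmod (f x + g x))\<^sup>2)"
    and "sqrt (\<integral>x. (cmod (f x + g x))\<^sup>2 \<partial>M) \<le> sqrt (\<integral>x. (cmod (f x))\<^sup>2 \<partial>M) + sqrt (\<integral>x. (cmod (g x))\<^sup>2 \<partial>M)"
proof -
  note [measurable] = f(1) g(1)
  have young: "(cmod (x + y))\<^sup>2 \<le> (1 + e) * (cmod x)\<^sup>2 + (1 + 1 / e) * (cmod y)\<^sup>2" if e: "0 < e" for x y :: complex and e :: real
  proof -
    have "(cmod (x + y))\<^sup>2 \<le> (cmod x + cmod y)\<^sup>2" by (intro power_mono norm_triangle_ineq) auto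
    also have "\<dots> = (cmod x)\<^sup>2 + (cmod y)\<^sup>2 + 2 * (sqrt e * cmod x) * (cmod y / sqrt e)"
      using e by (simp add: power2_eq_square algebra_simps)
    also have "2 * (sqrt e * cmod x) * (cmod y / sqrt e) \<le> (sqrt e * cmod x)\<^sup>2 + (cmod y / sqrt e)\<^sup>2"
      by (rule sum_squares_bound)
    also have "(sqrt e * cmod x)\<^sup>2 + (cmod y / sqrt e)\<^sup>2 = e * (cmod x)\<^sup>2 + (cmod y)\<^sup>2 / e"
      using e by (simp add: power_mult_distrib power_divide)
    finally show ?thesis by (simp add: algebra_simps)
  qed
  show I: "integrable M (\<lambda>x. (cmod (f x + g x))\<^sup>2)"
    by (rule Bochner_Integration.integrable_bound[where f = "\<lambda>x. (1 + 1) * (cmod (f x))\<^sup>2 + (1 + 1 / 1) * (cmod (g x))\<^sup>2"])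
      (use f g young[of 1] in \<open>auto intro!: Bochner_Integration.integrable_add AE_I2\<close>)
  define a b where "a = sqrt (\<integral>x. (cmod (f x))\<^sup>2 \<partial>M)" and "b = sqrt (\<integral>x. (cmod (g x))\<^sup>2 \<partial>M)"
  have ab: "0 \<le> a" "0 \<le> b" "a\<^sup>2 = (\<integral>x. (cmod (f x))\<^sup>2 \<partial>M)" "b\<^sup>2 = (\<integral>x. (cmod (g x))\<^sup>2 \<partial>M)"
    unfolding a_def b_def by (auto intro!: Bochner_Integration.integral_nonneg)
  have "sqrt (\<integral>x. (cmod (f x + g x))\<^sup>2 \<partial>M) \<le> (a + b) + d" if "0 < d" for d
  proof -
    define A B where "A = a + d / 2" and "B = b + d / 2"
    have AB: "0 < A" "0 < B" "a \<le> A" "b \<le> B" using ab that unfolding A_def B_def by auto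
    have "(\<integral>x. (cmod (f x + g x))\<^sup>2 \<partial>M) \<le> (\<integral>x. (1 + B / A) * (cmod (f x))\<^sup>2 + (1 + 1 / (B / A)) * (cmod (g x))\<^sup>2 \<partial>M)"
      using AB by (intro integral_mono I young) (use f g in auto)
    also have "\<dots> = (1 + B / A) * a\<^sup>2 + (1 + A / B) * b\<^sup>2"
      using f g by (simp add: ab(3,4))
    also have "\<dots> \<le> (1 + B / A) * A\<^sup>2 + (1 + A / B) * B\<^sup>2"
      using AB ab by (intro add_mono mult_left_mono power_mono) auto
    also have "\<dots> = (A + B)\<^sup>2" using AB by (simp add: power2_eq_square field_simps)
    finally have "sqrt (\<integral>x. (cmod (f x + g x))\<^sup>2 \<partial>M) \<le> A + B"
      using AB by (intro real_le_lsqrt) auto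
    then show ?thesis unfolding A_def B_def by simp
  qed
  then show "sqrt (\<integral>x. (cmod (f x + g x))\<^sup>2 \<partial>M) \<le> sqrt (\<integral>x. (cmod (f x))\<^sup>2 \<partial>M) + sqrt (\<integral>x. (cmod (g x))\<^sup>2 \<partial>M)"
    unfolding a_def[symmetric] b_def[symmetric] by (rule field_le_epsilon)
qed

lemma holomorphic_mat_add:
  assumes "holomorphic_mat k m f" "holomorphic_mat k m g"
  shows "holomorphic_mat k m (\<lambda>z. f z + g z)"
  unfolding holomorphic_mat_def
proof
  fix z :: "complex mat" assume z: "z \<in> carrier_mat k m"
  obtain D where D: "D \<in> carrier_mat m k" "\<And>e. e > 0 \<Longrightarrow> \<exists>d>0. \<forall>h \<in> carrier_mat k m. hs_norm h < d \<longrightarrow>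
       cmod (f (z + h) - f z - mat_trace (h * D)) \<le> e * hs_norm h"
    using assms(1) z unfolding holomorphic_mat_def by blast
  obtain D' where D': "D' \<in> carrier_mat m k" "\<And>e. e > 0 \<Longrightarrow> \<exists>d>0. \<forall>h \<in> carrier_mat k m. hs_norm h < d \<longrightarrow>
       cmod (g (z + h) - g z - mat_trace (h * D')) \<le> e * hs_norm h"
    using assms(2) z unfolding holomorphic_mat_def by blast
  show "\<exists>D \<in> carrier_mat m k. \<forall>e>0. \<exists>d>0. \<forall>h \<in> carrier_mat k m. hs_norm h < d \<longrightarrow>
       cmod (f (z + h) + g (z + h) - (f z + g z) - mat_trace (h * D)) \<le> e * hs_norm h"
  proof (intro bexI[of _ "D + D'"] allI impI)
    fix e :: real assume e: "e > 0"
    obtain d where d: "d > 0" "\<And>h. h \<in> carrier_mat k m \<Longrightarrow> hs_norm h < d \<Longrightarrow> cmod (f (z + h) - f z - mat_trace (h * D)) \<le> e / 2 * hs_norm h"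
      using D(2)[of "e / 2"] e by auto
    obtain d' where d': "d' > 0" "\<And>h. h \<in> carrier_mat k m \<Longrightarrow> hs_norm h < d' \<Longrightarrow> cmod (g (z + h) - g z - mat_trace (h * D')) \<le> e / 2 * hs_norm h"
      using D'(2)[of "e / 2"] e by auto
    show "\<exists>d>0. \<forall>h \<in> carrier_mat k m. hs_norm h < d \<longrightarrow>
       cmod (f (z + h) + g (z + h) - (f z + g z) - mat_trace (h * (D + D'))) \<le> e * hs_norm h"
    proof (intro exI[of _ "min d d'"] conjI ballI impI)
      fix h assume h: "h \<in> carrier_mat k m" "hs_norm h < min d d'"
      have "mat_trace (h * (D + D')) = mat_trace (h * D) + mat_trace (h * D')"
        by (simp only: mult_add_distrib_mat[OF h(1) D(1) D'(1)]
            trace_add[OF mult_carrier_mat[OF h(1) D(1)] mult_carrier_mat[OF h(1) D'(1)]])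
      then have "f (z + h) + g (z + h) - (f z + g z) - mat_trace (h * (D + D'))
        = (f (z + h) - f z - mat_trace (h * D)) + (g (z + h) - g z - mat_trace (h * D'))" by simp
      then show "cmod (f (z + h) + g (z + h) - (f z + g z) - mat_trace (h * (D + D'))) \<le> e * hs_norm h"
        using norm_triangle_mono[OF d(2)[OF h(1)] d'(2)[OF h(1)]] h(2) by (simp add: field_simps)
    qed (use d d' in auto)
  qed (use D D' in auto)
qed

lemma holomorphic_mat_cmult:
  assumes "holomorphic_mat k m f"
  shows "holomorphic_mat k m (\<lambda>z. c * f z)"
  unfolding holomorphic_mat_def
proof
  fix z :: "complex mat" assume z: "z \<in> carrier_mat k m"
  obtain D where D: "D \<in> carrier_mat m k" "\<And>e. e > 0 \<Longrightarrow> \<exists>d>0. \<forall>h \<in> carrier_mat k m. hs_norm h < d \<longrightarrow>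
       cmod (f (z + h) - f z - mat_trace (h * D)) \<le> e * hs_norm h"
    using assms(1) z unfolding holomorphic_mat_def by blast
  show "\<exists>D \<in> carrier_mat m k. \<forall>e>0. \<exists>d>0. \<forall>h \<in> carrier_mat k m. hs_norm h < d \<longrightarrow>
       cmod (c * f (z + h) - c * f z - mat_trace (h * D)) \<le> e * hs_norm h"
  proof (intro bexI[of _ "c \<cdot>\<^sub>m D"] allI impI)
    fix e :: real assume e: "e > 0"
    then have "e / (cmod c + 1) > 0" by (simp add: add_nonneg_pos)
    then obtain d where d: "d > 0" "\<And>h. h \<in> carrier_mat k m \<Longrightarrow> hs_norm h < d \<Longrightarrow>
        cmod (f (z + h) - f z - mat_trace (h * D)) \<le> e / (cmod c + 1) * hs_norm h"
      using D(2) by blast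
    show "\<exists>d>0. \<forall>h \<in> carrier_mat k m. hs_norm h < d \<longrightarrow>
       cmod (c * f (z + h) - c * f z - mat_trace (h * (c \<cdot>\<^sub>m D))) \<le> e * hs_norm h"
    proof (intro exI[of _ d] conjI ballI impI)
      fix h assume h: "h \<in> carrier_mat k m" "hs_norm h < d"
      have "mat_trace (h * (c \<cdot>\<^sub>m D)) = c * mat_trace (h * D)"
        by (simp only: mult_smult_distrib[OF h(1) D(1)] trace_smult[OF mult_carrier_mat[OF h(1) D(1)]])
      then have "cmod (c * f (z + h) - c * f z - mat_trace (h * (c \<cdot>\<^sub>m D))) = cmod c * cmod (f (z + h) - f z - mat_trace (h * D))"
        by (simp add: algebra_simps flip: norm_mult)
      also have "\<dots> \<le> cmod c * (e / (cmod c + 1) * hs_norm h)" by (intro mult_left_mono d(2) h) auto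
      also have "\<dots> = (cmod c / (cmod c + 1)) * (e * hs_norm h)" by simp
      also have "\<dots> \<le> 1 * (e * hs_norm h)"
        using e by (intro mult_right_mono mult_nonneg_nonneg) (auto simp: divide_le_eq_1_pos add_nonneg_pos)
      finally show "cmod (c * f (z + h) - c * f z - mat_trace (h * (c \<cdot>\<^sub>m D))) \<le> e * hs_norm h" by simp
    qed (use d in auto)
  qed (use D in auto)
qed

lemma K_space_add:
  assumes "f \<in> K_space k m" "g \<in> K_space k m"
  shows "(\<lambda>z. f z + g z) \<in> K_space k m"
  using assms L2_norm_triangle(1)[of f "gauss_measure k m" g] unfolding K_space_def
  by (auto intro: holomorphic_mat_add)

lemma K_space_cmult:
  assumes "f \<in> K_space k m"
  shows "(\<lambda>z. c * f z) \<in> K_space k m"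
  using assms unfolding K_space_def by (auto intro: holomorphic_mat_cmult simp: norm_mult power_mult_distrib)

lemma K_space_diff:
  assumes "f \<in> K_space k m" "g \<in> K_space k m"
  shows "(\<lambda>z. f z - g z) \<in> K_space k m"
  using K_space_add[OF assms(1) K_space_cmult[OF assms(2), of "-1"]] by simp

lemma K_space_zero: "(\<lambda>z. 0) \<in> K_space k m"
  unfolding K_space_def holomorphic_mat_def
proof (intro CollectI conjI ballI)
  fix z :: "complex mat"
  show "\<exists>D \<in> carrier_mat m k. \<forall>e>0. \<exists>d>0. \<forall>h \<in> carrier_mat k m. hs_norm h < d \<longrightarrow>
       cmod (0 - 0 - mat_trace (h * D)) \<le> e * hs_norm h"
    by (intro bexI[of _ "0\<^sub>m m k"] allI impI exI[of _ 1])
      (auto simp: right_mult_zero_mat[of _ k m] mat_trace_def)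
qed auto

lemma K_norm_nonneg [simp]: "0 \<le> K_norm k m f"
  unfolding K_norm_def by (auto intro: Bochner_Integration.integral_nonneg)

lemma K_norm_triangle:
  assumes "f \<in> K_space k m" "g \<in> K_space k m"
  shows "K_norm k m (\<lambda>z. f z + g z) \<le> K_norm k m f + K_norm k m g"
  using assms L2_norm_triangle(2)[of f "gauss_measure k m" g] unfolding K_space_def K_norm_def by auto

lemma K_norm_cmult: "K_norm k m (\<lambda>z. c * f z) = cmod c * K_norm k m f"
  unfolding K_norm_def by (simp add: norm_mult power_mult_distrib real_sqrt_mult)

lemma K_norm_minus_commute: "K_norm k m (\<lambda>z. f z - g z) = K_norm k m (\<lambda>z. g z - f z)"
  unfolding K_norm_def by (simp add: norm_minus_commute)

lemma K_norm_diff_triangle: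
  assumes "f \<in> K_space k m" "g \<in> K_space k m"
  shows "\<bar>K_norm k m f - K_norm k m g\<bar> \<le> K_norm k m (\<lambda>z. f z - g z)"
  using K_norm_triangle[OF K_space_diff[OF assms] assms(2)]
    K_norm_triangle[OF K_space_diff[OF assms(2,1)] assms(1)] K_norm_minus_commute[of k m f g]
  by simp

section \<open>The orbit functions in \<open>K\<close>\<close>

lemma exp_diff_le:
  fixes a b :: complex
  shows "cmod (exp a - exp b) \<le> cmod (a - b) * exp (cmod b + cmod (a - b))"
proof -
  have "cmod (exp (a - b) - 1) \<le> cmod (a - b) * exp (cmod (a - b))"
  proof -
    have "cmod (exp (a - b) - 1) \<le> exp (cmod (a - b)) * cmod ((a - b) - 0)"
    proof -
      have "cmod (exp (a - b) - exp 0) \<le> exp (cmod (a - b)) * cmod ((a - b) - 0)"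
      proof (rule field_differentiable_bound[where S = "cball 0 (cmod (a - b))" and f' = exp])
        show "cmod (exp x) \<le> exp (cmod (a - b))" if "x \<in> cball 0 (cmod (a - b))" for x
        proof -
          have "Re x \<le> cmod (a - b)" using complex_Re_le_cmod[of x] that by simp
          then show ?thesis by simp
        qed
      qed (auto intro!: derivative_eq_intros)
      then show ?thesis by simp
    qed
    then show ?thesis by (simp add: mult.commute)
  qed
  moreover have "cmod (exp b) \<le> exp (cmod b)" using complex_Re_le_cmod[of b] by simp
  moreover have "exp a - exp b = exp b * (exp (a - b) - 1)" by (simp add: algebra_simps flip: exp_add)
  ultimately have "cmod (exp a - exp b) \<le> exp (cmod b) * (cmod (a - b) * exp (cmod (a - b)))"
    by (simp only: norm_mult) (intro mult_mono, auto)
  then show ?thesis by (simp add: exp_add algebra_simps)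
qed

lemma expo_measurable:
  assumes "X \<in> carrier_mat m k"
  shows "(\<lambda>z. mat_trace (z * X)) \<in> borel_measurable (mat_borel k m)"
proof (subst measurable_cong)
  show "mat_trace (z * X) = (\<Sum>i<k. \<Sum>j<m. z $$ (i, j) * X $$ (j, i))" if "z \<in> space (mat_borel k m)" for z
    using that assms by (simp only: space_mat_borel trace_mult)
  have [measurable]: "(\<lambda>A. A $$ (i, j)) \<in> borel_measurable (mat_borel k m)" if "i \<in> {..<k}" "j \<in> {..<m}" for i j
    using that by (intro measurable_mat_entry) auto
  show "(\<lambda>z. \<Sum>i<k. \<Sum>j<m. z $$ (i, j) * X $$ (j, i)) \<in> borel_measurable (mat_borel k m)" by measurable
qed

lemma holomorphic_exp_trace:
  assumes X: "X \<in> carrier_mat m k"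
  shows "holomorphic_mat k m (\<lambda>z. exp (mat_trace (z * X)))"
  unfolding holomorphic_mat_def
proof
  fix z :: "complex mat" assume z: "z \<in> carrier_mat k m"
  define a where "a = exp (mat_trace (z * X))"
  show "\<exists>D \<in> carrier_mat m k. \<forall>e>0. \<exists>d>0. \<forall>h \<in> carrier_mat k m. hs_norm h < d \<longrightarrow>
       cmod (exp (mat_trace ((z + h) * X)) - exp (mat_trace (z * X)) - mat_trace (h * D)) \<le> e * hs_norm h"
  proof (intro bexI[of _ "a \<cdot>\<^sub>m X"] allI impI)
    fix e :: real assume e: "e > 0"
    define \<epsilon> where "\<epsilon> = e / (cmod a * (hs_norm X + 1))"
    have a: "cmod a > 0" unfolding a_def by simp
    have \<epsilon>: "\<epsilon> > 0" unfolding \<epsilon>_def using e a by (simp add: add_nonneg_pos)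
    have "(exp has_derivative (*) 1) (at (0 :: complex))"
      using DERIV_exp[of "0 :: complex"] by (simp add: has_field_derivative_def)
    then obtain d where d: "d > 0" "\<And>w. cmod w < d \<Longrightarrow> cmod (exp w - 1 - w) \<le> \<epsilon> * cmod w"
      using \<epsilon> unfolding has_derivative_at_alt by fastforce
    show "\<exists>d>0. \<forall>h \<in> carrier_mat k m. hs_norm h < d \<longrightarrow>
       cmod (exp (mat_trace ((z + h) * X)) - exp (mat_trace (z * X)) - mat_trace (h * (a \<cdot>\<^sub>m X))) \<le> e * hs_norm h"
    proof (intro exI[of _ "d / (hs_norm X + 1)"] conjI ballI impI)
      show "d / (hs_norm X + 1) > 0" using d by (simp add: add_nonneg_pos)
      fix h assume h: "h \<in> carrier_mat k m" "hs_norm h < d / (hs_norm X + 1)"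
      define w where "w = mat_trace (h * X)"
      have w: "cmod w \<le> hs_norm h * (hs_norm X + 1)"
        using norm_trace_mult_le[OF h(1) X] unfolding w_def by (simp add: distrib_left add_increasing2)
      moreover have "hs_norm h * (hs_norm X + 1) < d"
        using h(2) by (simp add: pos_less_divide_eq add_nonneg_pos)
      ultimately have wd: "cmod (exp w - 1 - w) \<le> \<epsilon> * cmod w" by (intro d(2)) simp
      have "mat_trace ((z + h) * X) = mat_trace (z * X) + w" unfolding w_def
        by (simp only: add_mult_distrib_mat[OF z h(1) X] trace_add[OF mult_carrier_mat[OF z X] mult_carrier_mat[OF h(1) X]])
      moreover have "mat_trace (h * (a \<cdot>\<^sub>m X)) = a * w" unfolding w_def
        by (simp only: mult_smult_distrib[OF h(1) X] trace_smult[OF mult_carrier_mat[OF h(1) X]])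
      ultimately have "exp (mat_trace ((z + h) * X)) - exp (mat_trace (z * X)) - mat_trace (h * (a \<cdot>\<^sub>m X)) = a * (exp w - 1 - w)"
        by (simp add: exp_add a_def[symmetric] algebra_simps)
      then have "cmod (exp (mat_trace ((z + h) * X)) - exp (mat_trace (z * X)) - mat_trace (h * (a \<cdot>\<^sub>m X)))
        \<le> cmod a * (\<epsilon> * cmod w)" using wd by (simp add: norm_mult mult_left_mono)
      also have "\<dots> \<le> cmod a * (\<epsilon> * (hs_norm h * (hs_norm X + 1)))"
        using w \<epsilon> by (intro mult_left_mono) auto
      also have "\<dots> = e * hs_norm h"
      proof -
        have gen: "x * (e / (x * y) * (u * y)) = e * u" if "x \<noteq> 0" "y \<noteq> 0" for x y u :: real
          using that by (simp add: field_simps)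
        have "hs_norm X + 1 \<noteq> 0" using hs_norm_nonneg[of X] by linarith
        then show ?thesis unfolding \<epsilon>_def by (intro gen) (use a in auto)
      qed
      finally show "cmod (exp (mat_trace ((z + h) * X)) - exp (mat_trace (z * X)) - mat_trace (h * (a \<cdot>\<^sub>m X))) \<le> e * hs_norm h" .
    qed
  qed (use X in auto)
qed

lemma point_blocks:
  assumes "v \<in> carrier_mat (p + m + p) p" "s \<in> carrier_mat p p"
  shows "E2 p m * v \<in> carrier_mat m p" "E3 p m * v \<in> carrier_mat p p" "E2 p m * v * mat_adjoint s \<in> carrier_mat m p"
  using assms by auto

lemma phi_eq:
  "phi p m v s z = exp (mat_trace (s * (E3 p m * v) * mat_adjoint s)) * exp (mat_trace (z * (E2 p m * v * mat_adjoint s)))"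
  unfolding phi_def expo_def by (simp add: exp_add)

text \<open>The exact norm: the exponent is the form of the domain evaluated at \<open>s\<^sup>*\<close>.\<close>

lemma phi_norm_nn:
  assumes v: "v \<in> carrier_mat (p + m + p) p" "E1 p m * v = 1\<^sub>m p" and s: "s \<in> carrier_mat p p"
  shows "(\<integral>\<^sup>+z. ennreal ((cmod (phi p m v s z))\<^sup>2) \<partial>gauss_measure p m) = ennreal (exp (sig_form p m (v * mat_adjoint s)))"
proof -
  let ?a = "mat_trace (s * (E3 p m * v) * mat_adjoint s)" and ?X = "E2 p m * v * mat_adjoint s"
  have X: "?X \<in> carrier_mat m p" by (rule point_blocks(3)[OF v(1) s])
  have "(cmod (phi p m v s z))\<^sup>2 = exp (2 * Re ?a) * exp (2 * Re (mat_trace (z * ?X)))" for z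
    unfolding phi_eq by (simp add: norm_mult power_mult_distrib flip: exp_double)
  then have "(\<integral>\<^sup>+z. ennreal ((cmod (phi p m v s z))\<^sup>2) \<partial>gauss_measure p m)
    = (\<integral>\<^sup>+z. ennreal (exp (2 * Re ?a)) * ennreal (exp (2 * Re (mat_trace (z * ?X)))) \<partial>gauss_measure p m)"
    by (simp add: ennreal_mult')
  also have "\<dots> = ennreal (exp (2 * Re ?a)) * (\<integral>\<^sup>+z. ennreal (exp (2 * Re (mat_trace (z * ?X)))) \<partial>gauss_measure p m)"
    using expo_measurable[OF X] by (intro nn_integral_cmult) simp
  also have "\<dots> = ennreal (exp (2 * Re ?a + (hs_norm ?X)\<^sup>2))"
    unfolding nn_integral_gauss_exp_trace[OF X] by (simp add: exp_add ennreal_mult')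
  also have "2 * Re ?a + (hs_norm ?X)\<^sup>2 = sig_form p m (v * mat_adjoint s)"
    using sig_form_point[OF v adj_carrier[OF s]] by simp
  finally show ?thesis .
qed

lemma phi_measurable:
  assumes "v \<in> carrier_mat (p + m + p) p" "s \<in> carrier_mat p p"
  shows "phi p m v s \<in> borel_measurable (gauss_measure p m)"
  using expo_measurable[OF point_blocks(3)[OF assms]]
  unfolding phi_eq[abs_def] by measurable

lemma phi_K:
  assumes v: "v \<in> carrier_mat (p + m + p) p" "E1 p m * v = 1\<^sub>m p" and s: "s \<in> carrier_mat p p"
  shows "phi p m v s \<in> K_space p m"
    and "(K_norm p m (phi p m v s))\<^sup>2 = exp (sig_form p m (v * mat_adjoint s))"
proof -
  have "holomorphic_mat p m (phi p m v s)"
    unfolding phi_eq[abs_def] by (intro holomorphic_mat_cmult holomorphic_exp_trace point_blocks(3) v s)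
  moreover note m[measurable] = phi_measurable[OF v(1) s]
  moreover have I: "has_bochner_integral (gauss_measure p m) (\<lambda>z. (cmod (phi p m v s z))\<^sup>2) (exp (sig_form p m (v * mat_adjoint s)))"
    by (rule has_bochner_integral_nn_integral) (use phi_norm_nn[OF v s] in auto)
  ultimately show "phi p m v s \<in> K_space p m"
    unfolding K_space_def by (auto simp: has_bochner_integral_iff)
  show "(K_norm p m (phi p m v s))\<^sup>2 = exp (sig_form p m (v * mat_adjoint s))"
    using I unfolding K_norm_def by (simp add: has_bochner_integral_iff)
qed

text \<open>On the domain the norm decays like a Gaussian in \<open>s\<close>: moving the point to the base point by some
  \<open>s\<^sub>0 h\<close> in \<open>P\<close> turns the exponent into \<open>- 2 |s s\<^sub>0|\<^sup>2\<close>.\<close>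

lemma phi_norm_decay:
  assumes v: "v \<in> siegel p m"
  shows "\<exists>c>0. \<forall>s \<in> carrier_mat p p. (K_norm p m (phi p m v s))\<^sup>2 \<le> exp (- c * (hs_norm s)\<^sup>2)"
proof -
  obtain s0 h where s0: "s0 \<in> S_group p" and h: "h \<in> N_group p m"
    and v_eq: "act p m (S_embed p m s0 * N_embed p m h) (base p m) = v"
    by (rule P_transitive[OF v])
  note sc = S_group_carrier[OF s0]
  note I = minv_props[OF sc S_group_det[OF s0]]
  define \<kappa> where "\<kappa> = hs_norm (minv s0) + 1"
  have \<kappa>: "\<kappa> > 0" unfolding \<kappa>_def using hs_norm_nonneg[of "minv s0"] by linarith
  show ?thesis
  proof (intro exI[of _ "2 / \<kappa>\<^sup>2"] conjI ballI)
    fix s :: "complex mat" assume s: "s \<in> carrier_mat p p"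
    have ss: "s * s0 \<in> carrier_mat p p" using s sc by auto
    have "s = (s * s0) * minv s0" using s by (simp only: assoc_mult_mat[OF s sc I(1)] I(2) right_mult_one_mat)
    then have "hs_norm s \<le> hs_norm (s * s0) * hs_norm (minv s0)" using hs_norm_mult_le[OF ss I(1)] by simp
    also have "\<dots> \<le> hs_norm (s * s0) * \<kappa>" unfolding \<kappa>_def by (intro mult_left_mono) auto
    finally have "(hs_norm s)\<^sup>2 \<le> (hs_norm (s * s0) * \<kappa>)\<^sup>2" by (intro power_mono) auto
    then have le: "(hs_norm s)\<^sup>2 / \<kappa>\<^sup>2 \<le> (hs_norm (s * s0))\<^sup>2" using \<kappa> by (simp add: power_mult_distrib pos_divide_le_eq)
    have "sig_form p m (v * mat_adjoint s) = sig_form p m (base p m * (mat_adjoint s0 * mat_adjoint s))"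
      using act_P_form(3)[OF s0 h base_carrier base_blocks(1) adj_carrier[OF s]] unfolding v_eq .
    also have "\<dots> = - 2 * (hs_norm (s * s0))\<^sup>2"
      unfolding adj_mult[OF s sc, symmetric] sig_form_base[OF adj_carrier[OF ss]] hs_norm_adj ..
    also have "\<dots> \<le> - (2 / \<kappa>\<^sup>2) * (hs_norm s)\<^sup>2" using le by simp
    finally show "(K_norm p m (phi p m v s))\<^sup>2 \<le> exp (- (2 / \<kappa>\<^sup>2) * (hs_norm s)\<^sup>2)"
      unfolding phi_K(2)[OF siegel_carrier[OF v] siegel_E1[OF v] s] by simp
  qed (use \<kappa> in simp)
qed

lemma expo_bound:
  assumes v: "v \<in> carrier_mat (p + m + p) p" and s: "s \<in> carrier_mat p p" and z: "z \<in> carrier_mat p m"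
  shows "cmod (expo p m v s z) \<le> hs_norm s * (hs_norm s * hs_norm (E3 p m * v)) + hs_norm s * (hs_norm (E2 p m * v) * l1_norm z)"
proof -
  note c = point_blocks[OF v s]
  have "cmod (mat_trace (s * (E3 p m * v) * mat_adjoint s)) \<le> hs_norm (s * (E3 p m * v)) * hs_norm s"
    using norm_trace_mult_le[OF mult_carrier_mat[OF s c(2)] adj_carrier[OF s]] by (simp add: hs_norm_adj)
  also have "\<dots> \<le> (hs_norm s * hs_norm (E3 p m * v)) * hs_norm s"
    by (intro mult_right_mono hs_norm_mult_le[OF s c(2)]) simp
  finally have 1: "cmod (mat_trace (s * (E3 p m * v) * mat_adjoint s)) \<le> hs_norm s * (hs_norm s * hs_norm (E3 p m * v))"
    by (simp add: mult_ac)
  have "cmod (mat_trace (z * (E2 p m * v * mat_adjoint s))) \<le> hs_norm (E2 p m * v * mat_adjoint s) * l1_norm z"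
    by (rule norm_trace_le_l1[OF z c(3)])
  also have "\<dots> \<le> (hs_norm (E2 p m * v) * hs_norm s) * l1_norm z"
    using hs_norm_mult_le[OF c(1) adj_carrier[OF s]] by (intro mult_right_mono) (auto simp: hs_norm_adj)
  finally have 2: "cmod (mat_trace (z * (E2 p m * v * mat_adjoint s))) \<le> hs_norm s * (hs_norm (E2 p m * v) * l1_norm z)"
    by (simp add: mult_ac)
  show ?thesis unfolding expo_def by (rule norm_triangle_mono[OF 1 2])
qed

text \<open>Near \<open>s = 0\<close> differences of orbit functions are of first order in \<open>s\<close>, because the exponents are, and
  at infinity they decay. The minimum of \<open>|s|\<close> and \<open>1 / |s|\<close> is a convenient bound for both ends.\<close>

lemma phi_diff_bound:
  assumes v: "v \<in> siegel p m" and w: "w \<in> siegel p m"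
  shows "\<exists>M\<ge>0. \<forall>s \<in> carrier_mat p p. hs_norm s > 0 \<longrightarrow>
    (K_norm p m (\<lambda>z. phi p m v s z - phi p m w s z))\<^sup>2 \<le> M * min (hs_norm s) (1 / hs_norm s)"
proof -
  note vc = siegel_carrier[OF v] siegel_E1[OF v] and wc = siegel_carrier[OF w] siegel_E1[OF w]
  obtain c1 where c1: "c1 > 0" "\<And>s. s \<in> carrier_mat p p \<Longrightarrow> (K_norm p m (phi p m v s))\<^sup>2 \<le> exp (- c1 * (hs_norm s)\<^sup>2)"
    using phi_norm_decay[OF v] by blast
  obtain c2 where c2: "c2 > 0" "\<And>s. s \<in> carrier_mat p p \<Longrightarrow> (K_norm p m (phi p m w s))\<^sup>2 \<le> exp (- c2 * (hs_norm s)\<^sup>2)"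
    using phi_norm_decay[OF w] by blast
  define c where "c = hs_norm (E3 p m * v) + hs_norm (E2 p m * v) + hs_norm (E3 p m * w) + hs_norm (E2 p m * w)"
  have c: "c \<ge> 0" unfolding c_def by simp
  define M1 where "M1 = exp (6 * c) * (\<integral>z. exp (6 * c * l1_norm z) \<partial>gauss_measure p m)"
  define M where "M = M1 + 2 / c1 + 2 / c2"
  have M1: "M1 \<ge> 0" unfolding M1_def by (intro mult_nonneg_nonneg Bochner_Integration.integral_nonneg) auto
  have M: "M \<ge> 0" "M1 \<le> M" "2 / c1 + 2 / c2 \<le> M" unfolding M_def using M1 c1(1) c2(1) by auto
  have main: "(K_norm p m (\<lambda>z. phi p m v s z - phi p m w s z))\<^sup>2 \<le> M * min (hs_norm s) (1 / hs_norm s)"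
    if s: "s \<in> carrier_mat p p" and pos: "hs_norm s > 0" for s
  proof (cases "hs_norm s \<le> 1")
    case True
    let ?h = "hs_norm s"
    have bound: "cmod (phi p m v s z - phi p m w s z) \<le> ?h * exp (3 * c * (1 + l1_norm z))" if z: "z \<in> carrier_mat p m" for z
    proof -
      define x where "x = c * (1 + l1_norm z)"
      have x0: "x \<ge> 0" unfolding x_def using c by simp
      have xe: "x \<le> exp x" using exp_ge_add_one_self[of x] by linarith
      have est: "cmod (expo p m v s z) + cmod (expo p m w s z) \<le> ?h * x"
      proof -
        have 0: "?h * (?h * a) + ?h * (b * l1_norm z) \<le> ?h * ((a + b) * (1 + l1_norm z))" if "0 \<le> a" "0 \<le> b" for a b
        proof -
          have "?h * a \<le> a" using True that(1) by (simp add: mult_left_le_one_le)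
          then have "?h * a + b * l1_norm z \<le> (a + b) * (1 + l1_norm z)"
            using that by (simp add: algebra_simps add_increasing2)
          then have "?h * (?h * a + b * l1_norm z) \<le> ?h * ((a + b) * (1 + l1_norm z))"
            by (intro mult_left_mono) auto
          then show ?thesis by (simp add: distrib_left)
        qed
        have "cmod (expo p m v s z) + cmod (expo p m w s z)
          \<le> ?h * ((hs_norm (E3 p m * v) + hs_norm (E2 p m * v)) * (1 + l1_norm z))
            + ?h * ((hs_norm (E3 p m * w) + hs_norm (E2 p m * w)) * (1 + l1_norm z))"
          by (intro add_mono order_trans[OF expo_bound[OF vc(1) s z] 0] order_trans[OF expo_bound[OF wc(1) s z] 0]) auto
        also have "\<dots> = ?h * x" unfolding x_def c_def by (simp add: algebra_simps)
        finally show ?thesis .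
      qed
      have hx: "?h * x \<le> x" using True x0 by (simp add: mult_left_le_one_le)
      have d: "cmod (expo p m v s z - expo p m w s z) \<le> ?h * x" using norm_triangle_ineq4[of "expo p m v s z" "expo p m w s z"] est by linarith
      have e: "cmod (expo p m w s z) \<le> x" using est hx norm_ge_zero[of "expo p m v s z"] by linarith
      have "cmod (phi p m v s z - phi p m w s z) \<le> cmod (expo p m v s z - expo p m w s z) * exp (cmod (expo p m w s z) + cmod (expo p m v s z - expo p m w s z))"
        unfolding phi_def by (rule exp_diff_le)
      also have "\<dots> \<le> (?h * x) * exp (x + x)" using d e hx x0 by (intro mult_mono) auto
      also have "\<dots> \<le> (?h * exp x) * exp (x + x)"
        by (intro mult_right_mono mult_left_mono xe) auto
      also have "\<dots> = ?h * exp (3 * c * (1 + l1_norm z))" by (simp add: x_def algebra_simps flip: exp_add)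
      finally show ?thesis .
    qed
    have "(K_norm p m (\<lambda>z. phi p m v s z - phi p m w s z))\<^sup>2 = (\<integral>z. (cmod (phi p m v s z - phi p m w s z))\<^sup>2 \<partial>gauss_measure p m)"
      unfolding K_norm_def by (simp add: Bochner_Integration.integral_nonneg)
    also have "\<dots> \<le> (\<integral>z. ?h\<^sup>2 * (exp (6 * c) * exp (6 * c * l1_norm z)) \<partial>gauss_measure p m)"
    proof (rule integral_mono)
      show "integrable (gauss_measure p m) (\<lambda>z. (cmod (phi p m v s z - phi p m w s z))\<^sup>2)"
        using K_space_diff[OF phi_K(1)[OF vc s] phi_K(1)[OF wc s]] unfolding K_space_def by simp
      show "integrable (gauss_measure p m) (\<lambda>z. ?h\<^sup>2 * (exp (6 * c) * exp (6 * c * l1_norm z)))"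
        by (intro integrable_mult_right integrable_exp_l1)
      fix z assume "z \<in> space (gauss_measure p m)"
      then have "(cmod (phi p m v s z - phi p m w s z))\<^sup>2 \<le> (?h * exp (3 * c * (1 + l1_norm z)))\<^sup>2"
        by (intro power_mono bound) auto
      also have "\<dots> = ?h\<^sup>2 * (exp (6 * c) * exp (6 * c * l1_norm z))"
        by (simp add: power_mult_distrib algebra_simps flip: exp_add exp_double)
      finally show "(cmod (phi p m v s z - phi p m w s z))\<^sup>2 \<le> ?h\<^sup>2 * (exp (6 * c) * exp (6 * c * l1_norm z))" .
    qed
    also have "\<dots> = M1 * ?h\<^sup>2" unfolding M1_def by simp
    also have "\<dots> \<le> M * ?h"
      using True pos M M1 by (intro mult_mono) (auto simp: power2_eq_square mult_left_le_one_le)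
    also have "?h = min ?h (1 / ?h)"
    proof -
      have "1 \<le> 1 / ?h" using True pos by simp
      then have "?h \<le> 1 / ?h" using True by linarith
      then show ?thesis by (simp add: min_absorb1)
    qed
    finally show ?thesis .
  next
    case False
    let ?h = "hs_norm s"
    have 1: "exp (- d * ?h\<^sup>2) \<le> (1 / d) * (1 / ?h)" if d: "d > 0" for d
    proof -
      have "?h \<le> ?h\<^sup>2" using False by (simp add: power2_eq_square)
      then have "d * ?h \<le> d * ?h\<^sup>2" using d by (intro mult_left_mono) auto
      also have "\<dots> \<le> exp (d * ?h\<^sup>2)" using exp_ge_add_one_self[of "d * ?h\<^sup>2"] by linarith
      finally have "inverse (exp (d * ?h\<^sup>2)) \<le> inverse (d * ?h)" using d pos by (intro le_imp_inverse_le) auto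
      then show ?thesis by (simp add: exp_minus field_simps)
    qed
    let ?a = "K_norm p m (phi p m v s)" and ?b = "K_norm p m (phi p m w s)"
    have "K_norm p m (\<lambda>z. phi p m v s z - phi p m w s z) \<le> ?a + ?b"
      using K_norm_triangle[OF phi_K(1)[OF vc s] K_space_cmult[OF phi_K(1)[OF wc s], of "-1"]]
        K_norm_cmult[of p m "-1" "phi p m w s"] by simp
    then have "(K_norm p m (\<lambda>z. phi p m v s z - phi p m w s z))\<^sup>2 \<le> (?a + ?b)\<^sup>2" by (intro power_mono) auto
    also have "\<dots> \<le> 2 * ?a\<^sup>2 + 2 * ?b\<^sup>2"
      using sum_squares_bound[of ?a ?b] by (simp add: power2_eq_square algebra_simps)
    also have "\<dots> \<le> 2 * ((1 / c1) * (1 / ?h)) + 2 * ((1 / c2) * (1 / ?h))"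
      by (intro add_mono mult_left_mono order_trans[OF c1(2)[OF s] 1[OF c1(1)]] order_trans[OF c2(2)[OF s] 1[OF c2(1)]]) auto
    also have "\<dots> = (2 / c1 + 2 / c2) * (1 / ?h)" by (simp add: algebra_simps)
    also have "\<dots> \<le> M * (1 / ?h)" using M pos by (intro mult_right_mono) auto
    also have "1 / ?h = min ?h (1 / ?h)"
    proof -
      have "1 / ?h \<le> 1" using False by (simp add: divide_le_eq)
      then have "1 / ?h \<le> ?h" using False by linarith
      then show ?thesis by (simp add: min_absorb2)
    qed
    finally show ?thesis .
  qed
  show ?thesis using M(1) main by blast
qed

text \<open>Continuity of the orbit functions as maps to \<open>K\<close>, by dominated convergence.\<close>

lemma
  assumes v: "v \<in> siegel p m" and S: "\<And>n. S n \<in> carrier_mat p p" and s: "s \<in> carrier_mat p p"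
    and lim: "\<And>i j. i < p \<Longrightarrow> j < p \<Longrightarrow> (\<lambda>n. S n $$ (i, j)) \<longlonglongrightarrow> s $$ (i, j)"
  shows phi_tendsto: "\<And>z. z \<in> carrier_mat p m \<Longrightarrow> (\<lambda>n. phi p m v (S n) z) \<longlonglongrightarrow> phi p m v s z"
    and phi_K_tendsto: "(\<lambda>n. K_norm p m (\<lambda>z. phi p m v (S n) z - phi p m v s z)) \<longlonglongrightarrow> 0"
proof -
  note vc = siegel_carrier[OF v] siegel_E1[OF v]
  show ptw: "(\<lambda>n. phi p m v (S n) z) \<longlonglongrightarrow> phi p m v s z" if z: "z \<in> carrier_mat p m" for z
    unfolding phi_def expo_entries[OF vc(1) S z] expo_entries[OF vc(1) s z]
    by (intro tendsto_intros lim) auto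
  have "(\<lambda>n. (hs_norm (S n))\<^sup>2) \<longlonglongrightarrow> (hs_norm s)\<^sup>2"
    unfolding hs_norm_square[OF S] hs_norm_square[OF s] by (intro tendsto_intros lim) auto
  then have "(\<lambda>n. sqrt ((hs_norm (S n))\<^sup>2)) \<longlonglongrightarrow> sqrt ((hs_norm s)\<^sup>2)" by (rule tendsto_real_sqrt)
  then have hs: "(\<lambda>n. hs_norm (S n)) \<longlonglongrightarrow> hs_norm s" by simp
  then obtain H where H: "\<And>n. \<bar>hs_norm (S n)\<bar> \<le> H"
    using convergent_imp_Bseq[of "\<lambda>n. hs_norm (S n)"] unfolding convergent_def Bseq_def real_norm_def by blast
  then have H': "hs_norm (S n) \<le> H" for n using abs_le_D1 by blast
  have Hs: "hs_norm s \<le> H" by (rule LIMSEQ_le_const2[OF hs]) (use H' in auto)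
  have H0: "0 \<le> H" using order_trans[OF hs_norm_nonneg Hs] .
  define A B where "A = H * (H * hs_norm (E3 p m * v))" and "B = H * hs_norm (E2 p m * v)"
  have bound: "cmod (phi p m v t z) \<le> exp (A + B * l1_norm z)"
    if t: "t \<in> carrier_mat p p" "hs_norm t \<le> H" and z: "z \<in> carrier_mat p m" for t z
  proof -
    have "cmod (expo p m v t z) \<le> A + B * l1_norm z"
      unfolding A_def B_def mult.assoc
      by (rule order_trans[OF expo_bound[OF vc(1) t(1) z]])
        (intro add_mono mult_mono order_refl t(2) mult_nonneg_nonneg hs_norm_nonneg l1_norm_nonneg H0)
    then have "Re (expo p m v t z) \<le> A + B * l1_norm z" using complex_Re_le_cmod order_trans by blast
    then show ?thesis unfolding phi_def by simp
  qed
  have "(\<lambda>n. \<integral>z. (cmod (phi p m v (S n) z - phi p m v s z))\<^sup>2 \<partial>gauss_measure p m) \<longlonglongrightarrow> (\<integral>z. 0 \<partial>gauss_measure p m)"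
  proof (rule integral_dominated_convergence[where w = "\<lambda>z. 4 * exp (2 * A) * exp (2 * B * l1_norm z)"])
    show "(\<lambda>z. (cmod (phi p m v (S n) z - phi p m v s z))\<^sup>2) \<in> borel_measurable (gauss_measure p m)" for n
      using phi_measurable[OF vc(1) S] phi_measurable[OF vc(1) s] by measurable
    show "integrable (gauss_measure p m) (\<lambda>z. 4 * exp (2 * A) * exp (2 * B * l1_norm z))"
      by (intro integrable_mult_right integrable_exp_l1)
    show "AE z in gauss_measure p m. (\<lambda>n. (cmod (phi p m v (S n) z - phi p m v s z))\<^sup>2) \<longlonglongrightarrow> 0"
    proof (intro AE_I2)
      fix z assume "z \<in> space (gauss_measure p m)"
      then have "(\<lambda>n. phi p m v (S n) z - phi p m v s z) \<longlonglongrightarrow> phi p m v s z - phi p m v s z"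
        by (intro tendsto_diff ptw tendsto_const) simp
      from tendsto_power[OF tendsto_norm[OF this], of 2]
      show "(\<lambda>n. (cmod (phi p m v (S n) z - phi p m v s z))\<^sup>2) \<longlonglongrightarrow> 0" by simp
    qed
    show "AE z in gauss_measure p m. norm ((cmod (phi p m v (S n) z - phi p m v s z))\<^sup>2) \<le> 4 * exp (2 * A) * exp (2 * B * l1_norm z)" for n
    proof (intro AE_I2)
      fix z assume "z \<in> space (gauss_measure p m)"
      then have z: "z \<in> carrier_mat p m" by simp
      have "cmod (phi p m v (S n) z - phi p m v s z) \<le> 2 * exp (A + B * l1_norm z)"
        using norm_triangle_ineq4[of "phi p m v (S n) z" "phi p m v s z"] bound[OF S H' z] bound[OF s Hs z]
        by (smt (verit))
      then have "(cmod (phi p m v (S n) z - phi p m v s z))\<^sup>2 \<le> (2 * exp (A + B * l1_norm z))\<^sup>2" by (intro power_mono) auto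
      also have "\<dots> = 4 * exp (2 * A) * exp (2 * B * l1_norm z)"
        by (simp add: power_mult_distrib algebra_simps flip: exp_add exp_double)
      finally show "norm ((cmod (phi p m v (S n) z - phi p m v s z))\<^sup>2) \<le> 4 * exp (2 * A) * exp (2 * B * l1_norm z)" by simp
    qed
  qed simp
  then have "(\<lambda>n. sqrt (\<integral>z. (cmod (phi p m v (S n) z - phi p m v s z))\<^sup>2 \<partial>gauss_measure p m)) \<longlonglongrightarrow> sqrt 0"
    by (intro tendsto_real_sqrt) simp
  then show "(\<lambda>n. K_norm p m (\<lambda>z. phi p m v (S n) z - phi p m v s z)) \<longlonglongrightarrow> 0"
    unfolding K_norm_def by simp
qed

section \<open>Maps that preserve null sets\<close>

text \<open>Measurable maps under which preimages of null sets are null sets.\<close>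

definition nonsingular :: "'a measure \<Rightarrow> ('a \<Rightarrow> 'a) \<Rightarrow> bool" where
  "nonsingular M T \<longleftrightarrow> T \<in> measurable M M \<and> (\<forall>N \<in> null_sets M. T -` N \<inter> space M \<in> null_sets M)"

lemma nonsingular_id: "nonsingular M (\<lambda>x. x)"
  unfolding nonsingular_def by (auto simp: null_sets_def sets.Int_space_eq2)

lemma nonsingular_comp:
  assumes "nonsingular M T" "nonsingular M T'"
  shows "nonsingular M (\<lambda>x. T (T' x))"
  unfolding nonsingular_def
proof (intro conjI ballI)
  show "(\<lambda>x. T (T' x)) \<in> measurable M M"
    using assms unfolding nonsingular_def by (auto intro: measurable_compose)
  fix N assume "N \<in> null_sets M"
  then have "T' -` (T -` N \<inter> space M) \<inter> space M \<in> null_sets M"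
    using assms unfolding nonsingular_def by blast
  moreover have "(\<lambda>x. T (T' x)) -` N \<inter> space M = T' -` (T -` N \<inter> space M) \<inter> space M"
    using assms(2) unfolding nonsingular_def by (auto dest: measurable_space)
  ultimately show "(\<lambda>x. T (T' x)) -` N \<inter> space M \<in> null_sets M" by simp
qed

lemma nonsingular_AE:
  assumes "nonsingular M T" "AE x in M. P x"
  shows "AE x in M. P (T x)"
proof -
  obtain N where N: "N \<in> null_sets M" "{x \<in> space M. \<not> P x} \<subseteq> N" using assms(2) by (auto elim: AE_E3 simp: eventually_ae_filter)
  then have "T -` N \<inter> space M \<in> null_sets M" using assms(1) unfolding nonsingular_def by blast
  moreover have "{x \<in> space M. \<not> P (T x)} \<subseteq> T -` N \<inter> space M"
    using assms(1) N(2) unfolding nonsingular_def by (auto dest: measurable_space)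
  ultimately show ?thesis by (rule AE_I')
qed

lemma null_sets_in_differentiable_image:
  fixes N A :: "'a :: euclidean_space set" and g :: "'a \<Rightarrow> 'a"
  assumes N: "N \<in> null_sets lborel" and g: "g differentiable_on UNIV" and A: "A \<subseteq> g ` N" "A \<in> sets borel"
  shows "A \<in> null_sets lborel"
proof -
  have "negligible N" using N by (auto simp: negligible_iff_null_sets intro: null_sets_completionI)
  moreover have "g differentiable_on N" using g differentiable_on_subset by blast
  ultimately have "negligible (g ` N)" by (intro negligible_differentiable_image_negligible) auto
  then have "negligible A" using A(1) negligible_subset by blast
  then show ?thesis using A(2) by (simp add: negligible_iff_null_sets null_sets_completion_iff)
qed

lemma nonsingular_affine:
  fixes c d :: complex
  assumes "d \<noteq> 0"
  shows "nonsingular lborel (\<lambda>w. w * d + c)"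
  unfolding nonsingular_def
proof (intro conjI ballI)
  fix N :: "complex set" assume N: "N \<in> null_sets lborel"
  show "(\<lambda>w. w * d + c) -` N \<inter> space lborel \<in> null_sets lborel"
  proof (rule null_sets_in_differentiable_image[OF N, of "\<lambda>w. (w - c) / d"])
    show "(\<lambda>w. (w - c) / d) differentiable_on UNIV"
      unfolding divide_inverse differentiable_on_def
      by (auto intro!: differentiable_mult differentiable_diff differentiable_ident differentiable_const)
    show "(\<lambda>w. w * d + c) -` N \<inter> space lborel \<subseteq> (\<lambda>w. (w - c) / d) ` N"
    proof
      fix w assume "w \<in> (\<lambda>w. w * d + c) -` N \<inter> space lborel"
      moreover have "w = (w * d + c - c) / d" using assms by simp
      ultimately show "w \<in> (\<lambda>w. (w - c) / d) ` N" by blast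
    qed
    have "(\<lambda>w. w * d + c) -` N \<inter> space borel \<in> sets borel"
      by (rule measurable_sets[of _ borel borel]) (use N in auto)
    then show "(\<lambda>w. w * d + c) -` N \<inter> space lborel \<in> sets borel" by simp
  qed
qed auto

section \<open>The factors of the measure on \<open>S\<close>\<close>

lemma space_pos_lebesgue [simp]: "space pos_lebesgue = complex_of_real ` {0<..}"
  unfolding pos_lebesgue_def by (simp add: space_restrict_space)

lemma sets_pos_lebesgue: "sets pos_lebesgue = sets (restrict_space borel (complex_of_real ` {0<..}))"
  unfolding pos_lebesgue_def by simp

lemma measurable_of_real_pos:
  "complex_of_real \<in> measurable (restrict_space lborel {0<..}) (restrict_space borel (complex_of_real ` {0<..}))"
  by (rule measurable_restrict_space3) auto

lemma emeasure_pos_lebesgue: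
  assumes "A \<in> sets pos_lebesgue"
  shows "emeasure pos_lebesgue A = emeasure lborel {x. 0 < x \<and> complex_of_real x \<in> A}"
proof -
  have A: "A \<in> sets (restrict_space borel (complex_of_real ` {0<..}))" using assms by (simp add: sets_pos_lebesgue)
  have "emeasure pos_lebesgue A = emeasure (restrict_space lborel {0<..}) (complex_of_real -` A \<inter> space (restrict_space lborel {0<..}))"
    unfolding pos_lebesgue_def by (rule emeasure_distr[OF measurable_of_real_pos A])
  also have "complex_of_real -` A \<inter> space (restrict_space lborel {0<..}) = {x. 0 < x \<and> complex_of_real x \<in> A}"
    by (auto simp: space_restrict_space)
  also have "emeasure (restrict_space lborel {0<..}) {x. 0 < x \<and> complex_of_real x \<in> A} = emeasure lborel {x. 0 < x \<and> complex_of_real x \<in> A}"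
    by (rule emeasure_restrict_space) auto
  finally show ?thesis .
qed

lemma sets_pos_preimage:
  assumes "A \<in> sets pos_lebesgue"
  shows "{x. 0 < x \<and> complex_of_real x \<in> A} \<in> sets borel"
proof -
  have "complex_of_real -` A \<inter> space (restrict_space lborel {0<..}) \<in> sets (restrict_space lborel {0<..})"
    using assms measurable_sets[OF measurable_of_real_pos] by (simp add: sets_pos_lebesgue)
  then have "{x. 0 < x \<and> complex_of_real x \<in> A} \<in> sets (restrict_space lborel {0<..})"
    by (simp add: space_restrict_space vimage_def Collect_conj_eq Int_commute greaterThan_def)
  then show ?thesis by (subst (asm) sets_restrict_space_iff) auto
qed

lemma sets_of_real_pos: "complex_of_real ` {0<..} \<in> sets borel"
proof -
  have "complex_of_real ` {0<..} = {w. Im w = 0 \<and> 0 < Re w}"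
    by (auto simp: image_iff complex_eq_iff intro!: exI[of _ "Re _"])
  also have "\<dots> \<in> sets borel" by measurable
  finally show ?thesis .
qed

lemma sets_pos_iff: "A \<in> sets pos_lebesgue \<longleftrightarrow> A \<in> sets borel \<and> A \<subseteq> complex_of_real ` {0<..}"
  unfolding sets_pos_lebesgue using sets_of_real_pos by (subst sets_restrict_space_iff) auto

lemma emeasure_pos_lebesgue_ball_le:
  "emeasure pos_lebesgue {w \<in> complex_of_real ` {0<..}. cmod w \<le> r} \<le> ennreal r" if "0 \<le> r"
proof -
  have "{w \<in> complex_of_real ` {0<..}. cmod w \<le> r} = complex_of_real ` {0<..} \<inter> {w. cmod w \<le> r}" by auto
  then have s: "{w \<in> complex_of_real ` {0<..}. cmod w \<le> r} \<in> sets pos_lebesgue"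
    unfolding sets_pos_iff using sets_of_real_pos by auto
  have "emeasure pos_lebesgue {w \<in> complex_of_real ` {0<..}. cmod w \<le> r}
    = emeasure lborel {x :: real. 0 < x \<and> complex_of_real x \<in> {w \<in> complex_of_real ` {0<..}. cmod w \<le> r}}"
    by (rule emeasure_pos_lebesgue[OF s])
  also have "\<dots> \<le> emeasure lborel {0..r}" by (intro emeasure_mono) auto
  also have "\<dots> = ennreal r" using that by simp
  finally show ?thesis .
qed

lemma sigma_finite_pos_lebesgue: "sigma_finite_measure pos_lebesgue"
proof
  let ?A = "\<lambda>n::nat. {w \<in> complex_of_real ` {0<..}. cmod w \<le> real n}"
  show "\<exists>A. countable A \<and> A \<subseteq> sets pos_lebesgue \<and> \<Union> A = space pos_lebesgue \<and> (\<forall>a\<in>A. emeasure pos_lebesgue a \<noteq> \<infinity>)"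
  proof (intro exI[of _ "range ?A"] conjI ballI)
    have "?A n = complex_of_real ` {0<..} \<inter> {w. cmod w \<le> real n}" for n by auto
    then show "range ?A \<subseteq> sets pos_lebesgue" unfolding sets_pos_iff using sets_of_real_pos by (auto simp: sets_pos_iff)
    show "\<Union> (range ?A) = space pos_lebesgue" by (auto intro: real_arch_simple)
    fix a assume "a \<in> range ?A"
    then obtain n where "a = ?A n" by blast
    then have "emeasure pos_lebesgue a \<le> ennreal (real n)" using emeasure_pos_lebesgue_ball_le[of "real n"] by simp
    also have "\<dots> < \<infinity>" by simp
    finally show "emeasure pos_lebesgue a \<noteq> \<infinity>" by simp
  qed simp
qed

lemma nonsingular_pos_scale:
  assumes d: "0 < d"
  shows "nonsingular pos_lebesgue (\<lambda>w. w * complex_of_real d)"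
  unfolding nonsingular_def
proof (intro conjI ballI)
  show m: "(\<lambda>w. w * complex_of_real d) \<in> measurable pos_lebesgue pos_lebesgue"
  proof (subst measurable_cong_sets[OF sets_pos_lebesgue sets_pos_lebesgue], rule measurable_restrict_space3)
    show "(\<lambda>w. w * complex_of_real d) \<in> complex_of_real ` {0<..} \<rightarrow> complex_of_real ` {0<..}"
      using d by (auto simp flip: of_real_mult)
  qed auto
  fix N assume N: "N \<in> null_sets pos_lebesgue"
  let ?N = "(\<lambda>w. w * complex_of_real d) -` N \<inter> space pos_lebesgue"
  have s: "?N \<in> sets pos_lebesgue" using measurable_sets[OF m] N by auto
  have "{x. 0 < x \<and> complex_of_real x \<in> N} \<in> null_sets lborel"
    using N emeasure_pos_lebesgue[of N] sets_pos_preimage[of N] by (auto simp: null_sets_def)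
  then have "{x. 0 < x \<and> complex_of_real x \<in> ?N} \<in> null_sets lborel"
  proof (rule null_sets_in_differentiable_image[of _ "\<lambda>x. x / d"])
    show "(\<lambda>x. x / d) differentiable_on UNIV"
      unfolding divide_inverse differentiable_on_def
      by (auto intro!: differentiable_mult differentiable_ident differentiable_const)
    show "{x. 0 < x \<and> complex_of_real x \<in> ?N} \<subseteq> (\<lambda>x. x / d) ` {x. 0 < x \<and> complex_of_real x \<in> N}"
    proof
      fix x assume "x \<in> {x. 0 < x \<and> complex_of_real x \<in> ?N}"
      then have "x * d \<in> {x. 0 < x \<and> complex_of_real x \<in> N}" "x = x * d / d" using d by auto
      then show "x \<in> (\<lambda>x. x / d) ` {x. 0 < x \<and> complex_of_real x \<in> N}" by blast
    qed
  qed (rule sets_pos_preimage[OF s])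
  then show "?N \<in> null_sets pos_lebesgue"
    using s emeasure_pos_lebesgue[OF s] by (auto simp: null_sets_def)
qed

section \<open>Triangular changes of coordinates\<close>

text \<open>By Fubini's theorem, a map that changes one coordinate is nonsingular if it is so for fixed values of
  the other coordinates.\<close>

lemma (in product_sigma_finite) nonsingular_update:
  assumes I: "finite I" "a \<in> I"
    and T: "T \<in> measurable (Pi\<^sub>M I M) (Pi\<^sub>M I M)"
    and upd: "\<And>x w. x \<in> space (Pi\<^sub>M (I - {a}) M) \<Longrightarrow> w \<in> space (M a) \<Longrightarrow> T (x(a := w)) = x(a := h x w)"
    and ns: "\<And>x. x \<in> space (Pi\<^sub>M (I - {a}) M) \<Longrightarrow> nonsingular (M a) (h x)"
  shows "nonsingular (Pi\<^sub>M I M) T"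
  unfolding nonsingular_def
proof (intro conjI ballI T)
  let ?J = "I - {a}"
  have IJ: "insert a ?J = I" "finite ?J" "a \<notin> ?J" using I by auto
  fix N assume N: "N \<in> null_sets (Pi\<^sub>M I M)"
  let ?N = "T -` N \<inter> space (Pi\<^sub>M I M)"
  have s: "?N \<in> sets (Pi\<^sub>M I M)" using measurable_sets[OF T] N by auto
  note ins = product_nn_integral_insert[OF IJ(2,3), unfolded IJ(1)]
  have slice: "(\<lambda>w. indicator A (x(a := w)) :: ennreal) \<in> borel_measurable (M a)"
    if "A \<in> sets (Pi\<^sub>M I M)" "x \<in> space (Pi\<^sub>M ?J M)" for A x
    using measurable_compose[OF measurable_component_update[OF that(2) IJ(3), unfolded IJ(1)] borel_measurable_indicator[OF that(1)]] .
  have "0 = (\<integral>\<^sup>+x. indicator N x \<partial>Pi\<^sub>M I M)" using N by (simp add: null_sets_def)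
  also have "\<dots> = (\<integral>\<^sup>+x. \<integral>\<^sup>+w. indicator N (x(a := w)) \<partial>M a \<partial>Pi\<^sub>M ?J M)"
    by (rule ins) (use N in auto)
  finally have 0: "(\<integral>\<^sup>+x. \<integral>\<^sup>+w. indicator N (x(a := w)) \<partial>M a \<partial>Pi\<^sub>M ?J M) = 0" by simp
  have meas: "(\<lambda>x. \<integral>\<^sup>+w. indicator A (x(a := w)) \<partial>M a) \<in> borel_measurable (Pi\<^sub>M ?J M)" if "A \<in> sets (Pi\<^sub>M I M)" for A
  proof -
    have "(\<lambda>(x, w). x(a := w)) \<in> measurable (Pi\<^sub>M ?J M \<Otimes>\<^sub>M M a) (Pi\<^sub>M I M)"
      using measurable_add_dim[of a ?J M] unfolding IJ(1) .
    then have "(\<lambda>(x, w). indicator A (x(a := w)) :: ennreal) \<in> borel_measurable (Pi\<^sub>M ?J M \<Otimes>\<^sub>M M a)"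
      using measurable_compose[of "\<lambda>(x, w). x(a := w)" _ "Pi\<^sub>M I M" "indicator A" borel] that
      by (simp add: case_prod_unfold)
    then show ?thesis using M.borel_measurable_nn_integral[of "\<lambda>x w. indicator A (x(a := w))"] by simp
  qed
  have "AE x in Pi\<^sub>M ?J M. (\<integral>\<^sup>+w. indicator N (x(a := w)) \<partial>M a) = 0"
    using 0 meas[of N] N by (subst (asm) nn_integral_0_iff_AE) auto
  then have "AE x in Pi\<^sub>M ?J M. (\<integral>\<^sup>+w. indicator ?N (x(a := w)) \<partial>M a) = 0"
  proof (rule AE_mp, intro AE_I2 impI)
    fix x assume x: "x \<in> space (Pi\<^sub>M ?J M)" and "(\<integral>\<^sup>+w. indicator N (x(a := w)) \<partial>M a) = 0"
    then have "AE w in M a. indicator N (x(a := w)) = (0 :: ennreal)"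
      using slice[OF _ x, of N] N by (subst (asm) nn_integral_0_iff_AE) auto
    then have "AE w in M a. indicator N (x(a := h x w)) = (0 :: ennreal)"
      by (rule nonsingular_AE[OF ns[OF x]])
    then have "AE w in M a. indicator ?N (x(a := w)) = (0 :: ennreal)"
      by (rule AE_mp) (auto intro!: AE_I2 simp: upd[OF x] indicator_def split: if_splits)
    then show "(\<integral>\<^sup>+w. indicator ?N (x(a := w)) \<partial>M a) = 0"
      using slice[OF s x] by (subst nn_integral_0_iff_AE) auto
  qed
  then have "(\<integral>\<^sup>+x. \<integral>\<^sup>+w. indicator ?N (x(a := w)) \<partial>M a \<partial>Pi\<^sub>M ?J M) = 0"
    using meas[OF s] by (subst nn_integral_0_iff_AE) auto
  moreover have "emeasure (Pi\<^sub>M I M) ?N = (\<integral>\<^sup>+x. \<integral>\<^sup>+w. indicator ?N (x(a := w)) \<partial>M a \<partial>Pi\<^sub>M ?J M)"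
    using ins[of "indicator ?N"] s by simp
  ultimately show "?N \<in> null_sets (Pi\<^sub>M I M)" using s by (auto simp: null_sets_def)
qed

text \<open>Coordinates may be changed one after the other, in an order in which each new coordinate
  depends on its old value and on coordinates of larger rank only.\<close>

lemma (in product_sigma_finite) nonsingular_triangular:
  fixes rank :: "'i \<Rightarrow> nat"
  assumes I: "finite I"
    and g_meas: "\<And>a. a \<in> I \<Longrightarrow> (\<lambda>x. g a x) \<in> measurable (Pi\<^sub>M I M) (M a)"
    and g_dep: "\<And>a x y. a \<in> I \<Longrightarrow> x a = y a \<Longrightarrow> (\<And>b. b \<in> I \<Longrightarrow> rank a < rank b \<Longrightarrow> x b = y b) \<Longrightarrow> g a x = g a y"
    and ns: "\<And>a x. a \<in> I \<Longrightarrow> x \<in> space (Pi\<^sub>M (I - {a}) M) \<Longrightarrow> nonsingular (M a) (\<lambda>w. g a (x(a := w)))"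
    and A: "finite A" "A \<subseteq> I"
  shows "nonsingular (Pi\<^sub>M I M) (\<lambda>x b. if b \<in> A then g b x else x b)"
  using A
proof (induction A rule: finite_ranking_induct[where f = rank])
  case empty
  then show ?case using nonsingular_id by simp
next
  case (insert a A)
  let ?T = "\<lambda>A x b. if b \<in> A then g b x else x b"
  show ?case
  proof (cases "a \<in> A")
    case True
    then show ?thesis using insert by (simp add: insert_absorb)
  next
    case False
    have a: "a \<in> I" and AI: "A \<subseteq> I" using insert.prems by auto
    have "nonsingular (Pi\<^sub>M I M) (\<lambda>x. x(a := g a x))"
    proof (rule nonsingular_update[OF I a, where h = "\<lambda>x w. g a (x(a := w))"])
      show "(\<lambda>x. x(a := g a x)) \<in> measurable (Pi\<^sub>M I M) (Pi\<^sub>M I M)"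
        by (rule measurable_fun_upd[of I I a]) (use a g_meas in auto)
    qed (auto intro: ns[OF a])
    from nonsingular_comp[OF this insert.IH[OF AI]]
    have "nonsingular (Pi\<^sub>M I M) (\<lambda>x. (?T A x)(a := g a (?T A x)))" .
    moreover have "?T (insert a A) x = (?T A x)(a := g a (?T A x))" for x
    proof -
      have "g a (?T A x) = g a x"
      proof (rule g_dep[OF a])
        show "?T A x b = x b" if "b \<in> I" "rank a < rank b" for b
          using insert.hyps(2)[of b] that by auto
      qed (use False in auto)
      then show ?thesis by (auto simp: fun_eq_iff)
    qed
    ultimately show ?thesis by simp
  qed
qed

section \<open>The measure on \<open>S\<close>\<close>

text \<open>The coordinates on \<open>S\<close>: the factor measures and the matrix with given coordinates.\<close>

abbreviation tri_factor :: "nat \<times> nat \<Rightarrow> complex measure" where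
  "tri_factor \<equiv> (\<lambda>(i, j). if i = j then pos_lebesgue else lborel)"

definition tri_mat :: "nat \<Rightarrow> (nat \<times> nat \<Rightarrow> complex) \<Rightarrow> complex mat" where
  "tri_mat p x = mat p p (\<lambda>ij. if ij \<in> tri_index p then x ij else 0)"

abbreviation tri_measure :: "nat \<Rightarrow> (nat \<times> nat \<Rightarrow> complex) measure" where
  "tri_measure p \<equiv> Pi\<^sub>M (tri_index p) tri_factor"

lemma finite_tri_index [simp]: "finite (tri_index p)"
  by (rule finite_subset[of _ "{..<p} \<times> {..<p}"]) (auto simp: tri_index_def)

lemma product_sigma_finite_tri: "product_sigma_finite tri_factor"
proof
  fix ij :: "nat \<times> nat"
  interpret sigma_finite_measure pos_lebesgue by (rule sigma_finite_pos_lebesgue)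
  show "\<exists>A. countable A \<and> A \<subseteq> sets (tri_factor ij) \<and> \<Union> A = space (tri_factor ij) \<and> (\<forall>a\<in>A. emeasure (tri_factor ij) a \<noteq> \<infinity>)"
    using sigma_finite_countable lborel.sigma_finite_countable by (auto simp: case_prod_unfold)
qed

interpretation tri: product_sigma_finite tri_factor
  by (rule product_sigma_finite_tri)

lemma component_measurable_tri [measurable]:
  assumes "b \<in> tri_index p"
  shows "(\<lambda>x. x b) \<in> borel_measurable (tri_measure p)"
proof -
  have "(\<lambda>w. w) \<in> borel_measurable (tri_factor b)"
  proof (cases "fst b = snd b")
    case True
    then show ?thesis
      by (simp add: case_prod_unfold measurable_cong_sets[OF sets_pos_lebesgue refl] measurable_restrict_space1)
  qed (simp add: case_prod_unfold)
  from measurable_compose[OF measurable_component_singleton[of b "tri_index p" tri_factor, OF assms] this] show ?thesis .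
qed

lemma tri_mat_S:
  assumes "x \<in> space (tri_measure p)"
  shows "tri_mat p x \<in> S_group p"
proof -
  have "x (i, i) \<in> \<real> \<and> 0 < Re (x (i, i))" if "i < p" for i
  proof -
    have "(i, i) \<in> tri_index p" using that by (simp add: tri_index_def)
    from measurable_space[OF measurable_component_singleton[of _ _ tri_factor, OF this] assms]
    show ?thesis by auto
  qed
  then show ?thesis unfolding S_group_def tri_mat_def by (auto simp: tri_index_def)
qed

lemma tri_mat_measurable:
  "tri_mat p \<in> measurable (tri_measure p) (restrict_space (mat_borel p p) (S_group p))"
proof (rule measurable_restrict_space2)
  show "tri_mat p \<in> space (tri_measure p) \<rightarrow> S_group p" using tri_mat_S by auto
  show "tri_mat p \<in> measurable (tri_measure p) (mat_borel p p)"
  proof (rule measurable_into_mat_borel)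
    fix i j assume ij: "i < p" "j < p"
    show "(\<lambda>x. tri_mat p x $$ (i, j)) \<in> borel_measurable (tri_measure p)"
      using ij by (cases "(i, j) \<in> tri_index p") (auto simp: tri_mat_def)
  qed (auto simp: tri_mat_def)
qed

lemma S_lebesgue_eq:
  "S_lebesgue p = distr (tri_measure p) (restrict_space (mat_borel p p) (S_group p)) (tri_mat p)"
  unfolding S_lebesgue_def tri_mat_def[abs_def] ..

lemma space_S_lebesgue [simp]: "space (S_lebesgue p) = S_group p"
  unfolding S_lebesgue_eq by (auto simp: space_restrict_space S_group_carrier)

lemma sets_S_lebesgue: "sets (S_lebesgue p) = sets (restrict_space (mat_borel p p) (S_group p))"
  unfolding S_lebesgue_eq by simp

lemma space_nu [simp]: "space (nu_measure p) = S_group p"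
  unfolding nu_measure_def by simp

lemma sets_nu: "sets (nu_measure p) = sets (S_lebesgue p)"
  unfolding nu_measure_def by simp

lemma entry_measurable_S:
  assumes "i < p" "j < p"
  shows "(\<lambda>s. s $$ (i, j)) \<in> borel_measurable (S_lebesgue p)"
  by (subst measurable_cong_sets[OF sets_S_lebesgue refl]) (intro measurable_restrict_space1 measurable_mat_entry assms)

lemma hs_norm_measurable_S: "hs_norm \<in> borel_measurable (S_lebesgue p)"
proof (subst measurable_cong)
  show "hs_norm s = sqrt (\<Sum>i<p. \<Sum>j<p. (cmod (s $$ (i, j)))\<^sup>2)" if "s \<in> space (S_lebesgue p)" for s
    using that hs_norm_square[OF S_group_carrier, of s p] by (simp flip: hs_norm_square[OF S_group_carrier])
  have [measurable]: "(\<lambda>A. A $$ (i, j)) \<in> borel_measurable (S_lebesgue p)" if "i \<in> {..<p}" "j \<in> {..<p}" for i j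
    using that by (intro entry_measurable_S) auto
  show "(\<lambda>s. sqrt (\<Sum>i<p. \<Sum>j<p. (cmod (s $$ (i, j)))\<^sup>2)) \<in> borel_measurable (S_lebesgue p)" by measurable
qed

lemma hs_norm_S_pos:
  assumes "s \<in> S_group p" "1 \<le> p"
  shows "0 < hs_norm s"
proof -
  have "hs_norm s \<noteq> 0"
  proof
    assume "hs_norm s = 0"
    then have "s = 0\<^sub>m p p" using hs_norm_eq_0_iff[OF S_group_carrier[OF assms(1)]] by simp
    then show False using assms unfolding S_group_def by auto
  qed
  then show ?thesis using hs_norm_nonneg[of s] by linarith
qed

lemma AE_nu_iff:
  assumes "1 \<le> p"
  shows "(AE s in nu_measure p. P s) \<longleftrightarrow> (AE s in S_lebesgue p. P s)"
proof -
  have m: "(\<lambda>s. ennreal (1 / hs_norm s ^ p\<^sup>2)) \<in> borel_measurable (S_lebesgue p)"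
    using hs_norm_measurable_S[of p] by measurable
  have "(AE s in nu_measure p. P s) \<longleftrightarrow> (AE s in S_lebesgue p. 0 < ennreal (1 / hs_norm s ^ p\<^sup>2) \<longrightarrow> P s)"
    unfolding nu_measure_def by (rule AE_density[OF m])
  also have "\<dots> \<longleftrightarrow> (AE s in S_lebesgue p. P s)"
    by (rule AE_cong) (use hs_norm_S_pos[OF _ assms] in \<open>auto simp: zero_less_power\<close>)
  finally show ?thesis .
qed

text \<open>Right multiplication by \<open>s\<^sub>0\<close> in coordinates. The entry \<open>(i, j)\<close> of the product depends on the entries
  \<open>(i, k)\<close> with \<open>k \<ge> j\<close> only, and it is affine in the entry \<open>(i, j)\<close>, with the nonzero slope
  \<open>s\<^sub>0(j, j)\<close>: the change of coordinates is triangular with respect to the column index.\<close>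

lemma nonsingular_right_mult:
  assumes s0: "s0 \<in> S_group p"
  shows "nonsingular (tri_measure p) (\<lambda>x b. if b \<in> tri_index p then
    x b * s0 $$ (snd b, snd b) + (\<Sum>k\<in>{snd b<..fst b}. x (fst b, k) * s0 $$ (k, snd b)) else x b)"
proof (rule tri.nonsingular_triangular[where rank = snd and A = "tri_index p" and
      g = "\<lambda>b x. x b * s0 $$ (snd b, snd b) + (\<Sum>k\<in>{snd b<..fst b}. x (fst b, k) * s0 $$ (k, snd b))"])
  let ?g = "\<lambda>b x. x b * s0 $$ (snd b, snd b) + (\<Sum>k\<in>{snd b<..fst b}. x (fst b, k) * s0 $$ (k, snd b))"
  have diag: "0 < Re (s0 $$ (i, i))" "s0 $$ (i, i) = of_real (Re (s0 $$ (i, i)))" if "i < p" for i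
    using s0 that unfolding S_group_def by auto
  fix a assume a: "a \<in> tri_index p"
  obtain i j where ij: "a = (i, j)" by fastforce
  have ip: "i < p" "j \<le> i" "j < p" using a unfolding tri_index_def ij by auto
  show "(\<lambda>x. ?g a x) \<in> measurable (tri_measure p) (tri_factor a)"
  proof (cases "i = j")
    case True
    have "(\<lambda>w. w * complex_of_real (Re (s0 $$ (i, i)))) \<in> measurable (tri_factor a) (tri_factor a)"
      using nonsingular_pos_scale[OF diag(1)[OF ip(1)]] True unfolding nonsingular_def ij by simp
    from measurable_compose[OF measurable_component_singleton[of a "tri_index p" tri_factor, OF a] this]
    show ?thesis using True diag(2)[OF ip(1)] unfolding ij by simp
  next
    case False
    have [measurable]: "(\<lambda>x. x (i, k)) \<in> borel_measurable (tri_measure p)" if "k \<in> {j<..i}" for k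
      using that ip by (intro component_measurable_tri) (auto simp: tri_index_def)
    have [measurable]: "(\<lambda>x. x (i, j)) \<in> borel_measurable (tri_measure p)"
      using a unfolding ij by (rule component_measurable_tri)
    have "(\<lambda>x. ?g a x) \<in> borel_measurable (tri_measure p)"
      unfolding ij fst_conv snd_conv by measurable
    then show ?thesis using False unfolding ij by simp
  qed
  show "?g a x = ?g a y" if "x a = y a" "\<And>b. b \<in> tri_index p \<Longrightarrow> snd a < snd b \<Longrightarrow> x b = y b" for x y :: "nat \<times> nat \<Rightarrow> complex"
    using that ip unfolding ij by (auto intro!: sum.cong simp: tri_index_def)
  fix x assume x: "x \<in> space (Pi\<^sub>M (tri_index p - {a}) tri_factor)"
  have g: "?g a (x(a := w)) = w * s0 $$ (j, j) + (\<Sum>k\<in>{j<..i}. x (i, k) * s0 $$ (k, j))" for w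
    unfolding ij by (auto intro!: sum.cong)
  show "nonsingular (tri_factor a) (\<lambda>w. ?g a (x(a := w)))"
  proof (cases "i = j")
    case True
    have "(\<lambda>w. ?g a (x(a := w))) = (\<lambda>w. w * complex_of_real (Re (s0 $$ (i, i))))"
      unfolding g using True diag(2)[OF ip(1)] by (intro ext) simp
    moreover have "tri_factor a = pos_lebesgue" using True unfolding ij by simp
    ultimately show ?thesis using nonsingular_pos_scale[OF diag(1)[OF ip(1)]] by (simp only:)
  next
    case False
    have "s0 $$ (j, j) \<noteq> 0" using diag(1)[OF ip(3)] by auto
    from nonsingular_affine[OF this] show ?thesis unfolding g using False unfolding ij by simp
  qed
qed auto

text \<open>The measure class of \<open>\<nu>\<close> is invariant under right translations.\<close>

lemma nu_right_mult:
  assumes p: "1 \<le> p" and s0: "s0 \<in> S_group p" and P: "AE s in nu_measure p. P s"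
  shows "AE s in nu_measure p. P (s * s0)"
proof -
  define T where "T = (\<lambda>x b. if b \<in> tri_index p then
    x b * s0 $$ (snd b, snd b) + (\<Sum>k\<in>{snd b<..fst b}. x (fst b, k) * s0 $$ (k, snd b)) else x b)"
  have T: "nonsingular (tri_measure p) T" unfolding T_def by (rule nonsingular_right_mult[OF s0])
  note sc = S_group_carrier[OF s0]
  have mult: "tri_mat p (T x) = tri_mat p x * s0" for x
  proof (rule eq_matI)
    fix i j assume "i < dim_row (tri_mat p x * s0)" "j < dim_col (tri_mat p x * s0)"
    then have ij: "i < p" "j < p" using sc by (auto simp: tri_mat_def)
    have "(tri_mat p x * s0) $$ (i, j) = (\<Sum>k<p. tri_mat p x $$ (i, k) * s0 $$ (k, j))"
      using ij sc by (auto simp: tri_mat_def scalar_prod_def atLeast0LessThan)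
    also have "\<dots> = (\<Sum>k\<in>{j..i}. x (i, k) * s0 $$ (k, j))"
    proof (rule sum.mono_neutral_cong_right)
      show "\<forall>k\<in>{..<p} - {j..i}. tri_mat p x $$ (i, k) * s0 $$ (k, j) = 0"
        using ij s0 unfolding S_group_def by (auto simp: tri_mat_def tri_index_def)
    qed (use ij in \<open>auto simp: tri_mat_def tri_index_def\<close>)
    also have "\<dots> = tri_mat p (T x) $$ (i, j)"
    proof (cases "j \<le> i")
      case True
      then have "{j..i} = insert j {j<..i}" by auto
      then show ?thesis using ij True by (simp add: tri_mat_def tri_index_def T_def)
    qed (use ij in \<open>auto simp: tri_mat_def tri_index_def\<close>)
    finally show "tri_mat p (T x) $$ (i, j) = (tri_mat p x * s0) $$ (i, j)" by simp
  qed (use sc in \<open>auto simp: tri_mat_def\<close>)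
  let ?R = "restrict_space (mat_borel p p) (S_group p)"
  have "AE s in S_lebesgue p. P s" using P AE_nu_iff[OF p] by simp
  then obtain N where N: "{s \<in> space (S_lebesgue p). \<not> P s} \<subseteq> N" "N \<in> null_sets (S_lebesgue p)"
    by (auto simp: eventually_ae_filter)
  have N': "tri_mat p -` N \<inter> space (tri_measure p) \<in> null_sets (tri_measure p)"
    using N(2) null_sets_distr_iff[OF tri_mat_measurable] unfolding S_lebesgue_eq by auto
  have meas: "(\<lambda>s. s * s0) \<in> measurable (S_lebesgue p) ?R"
  proof (rule measurable_restrict_space2)
    have S_mult: "s * s0 \<in> S_group p" if s: "s \<in> S_group p" for s
    proof -
      define x where "x = (\<lambda>ij\<in>tri_index p. s $$ ij)"
      have x: "x \<in> space (tri_measure p)"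
        using s unfolding x_def S_group_def by (auto simp: space_PiM tri_index_def image_iff complex_eq_iff Reals_def intro!: bexI[of _ "Re _"])
      have "tri_mat p x = s"
        using s unfolding x_def tri_mat_def S_group_def by (intro eq_matI) (auto simp: tri_index_def)
      moreover have "T x \<in> space (tri_measure p)"
        using T x unfolding nonsingular_def by (auto dest: measurable_space)
      ultimately show ?thesis using tri_mat_S[of "T x" p] mult[of x] by simp
    qed
    then show "(\<lambda>s. s * s0) \<in> space (S_lebesgue p) \<rightarrow> S_group p" by auto
    show "(\<lambda>s. s * s0) \<in> measurable (S_lebesgue p) (mat_borel p p)"
    proof (rule measurable_into_mat_borel)
      fix i j assume ij: "i < p" "j < p"
      have [measurable]: "(\<lambda>s. s $$ (i, k)) \<in> borel_measurable (S_lebesgue p)" if "k \<in> {..<p}" for k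
        using that ij by (intro entry_measurable_S) auto
      have "(\<lambda>s. \<Sum>k<p. s $$ (i, k) * s0 $$ (k, j)) \<in> borel_measurable (S_lebesgue p)" by measurable
      moreover have "(s * s0) $$ (i, j) = (\<Sum>k<p. s $$ (i, k) * s0 $$ (k, j))" if "s \<in> space (S_lebesgue p)" for s
        using that ij sc S_group_carrier[of s p] by (auto simp: scalar_prod_def atLeast0LessThan)
      ultimately show "(\<lambda>s. (s * s0) $$ (i, j)) \<in> borel_measurable (S_lebesgue p)"
        by (subst measurable_cong) auto
    next
      fix s assume "s \<in> space (S_lebesgue p)"
      then show "s * s0 \<in> carrier_mat p p" using S_group_carrier[of s p] sc by auto
    qed
  qed
  let ?N = "(\<lambda>s. s * s0) -` N \<inter> space (S_lebesgue p)"
  have NR: "N \<in> sets ?R" using N(2) sets_S_lebesgue by auto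
  have s: "?N \<in> sets (S_lebesgue p)" by (rule measurable_sets[OF meas NR])
  have "T -` (tri_mat p -` N \<inter> space (tri_measure p)) \<inter> space (tri_measure p) \<in> null_sets (tri_measure p)"
    using T N' unfolding nonsingular_def by blast
  moreover have "T -` (tri_mat p -` N \<inter> space (tri_measure p)) \<inter> space (tri_measure p)
    = tri_mat p -` ?N \<inter> space (tri_measure p)"
    using T tri_mat_S unfolding nonsingular_def by (auto simp: mult dest: measurable_space)
  ultimately have "?N \<in> null_sets (S_lebesgue p)"
    using s null_sets_distr_iff[OF tri_mat_measurable] unfolding S_lebesgue_eq by auto
  moreover have "{s \<in> space (S_lebesgue p). \<not> P (s * s0)} \<subseteq> ?N"
  proof
    fix s assume s: "s \<in> {s \<in> space (S_lebesgue p). \<not> P (s * s0)}"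
    then have "s * s0 \<in> space (S_lebesgue p)" using measurable_space[OF meas, of s] by (auto simp: space_restrict_space)
    then show "s \<in> ?N" using N(1) s by auto
  qed
  ultimately have "AE s in S_lebesgue p. P (s * s0)" by (intro AE_I')
  then show ?thesis using AE_nu_iff[OF p] by simp
qed

text \<open>The complement of a null set is dense, since a product of balls around the coordinates of a point of
  \<open>S\<close> has positive measure.\<close>

lemma conull_dense:
  assumes p: "1 \<le> p" and P: "AE s in nu_measure p. P s" and s: "s \<in> S_group p"
  obtains S where "\<And>n :: nat. S n \<in> S_group p" "\<And>n. P (S n)"
    "\<And>i j. i < p \<Longrightarrow> j < p \<Longrightarrow> (\<lambda>n. S n $$ (i, j)) \<longlonglongrightarrow> s $$ (i, j)"
proof -
  have ex: "\<exists>t \<in> S_group p. P t \<and> (\<forall>i<p. \<forall>j<p. dist (t $$ (i, j)) (s $$ (i, j)) < e)" if e: "0 < e" for e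
  proof (rule ccontr)
    assume neg: "\<not> ?thesis"
    define B where "B b = space (tri_factor b) \<inter> ball (s $$ b) e" for b
    have Bs: "B b \<in> sets (tri_factor b)" for b
      unfolding B_def using sets_of_real_pos by (cases "fst b = snd b") (auto simp: case_prod_unfold sets_pos_iff)
    have Bpos: "emeasure (tri_factor b) (B b) \<noteq> 0" if b: "b \<in> tri_index p" for b
    proof (cases "fst b = snd b")
      case False
      then have "emeasure (tri_factor b) (B b) = emeasure lborel (ball (s $$ b) e)" by (simp add: B_def case_prod_unfold)
      moreover have "\<not> negligible (ball (s $$ b) e)" using e by (intro open_not_negligible) auto
      ultimately show ?thesis
        by (auto simp: negligible_iff_null_sets null_sets_completion_iff null_sets_def)
    next
      case True
      define i where "i = fst b"
      have i: "i < p" "b = (i, i)" using b True unfolding i_def by (auto simp: tri_index_def prod_eq_iff)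
      define r where "r = Re (s $$ (i, i))"
      have "s $$ (i, i) \<in> \<real>" "0 < r" using s i(1) unfolding S_group_def r_def by auto
      then have r: "s $$ b = of_real r" "0 < r" unfolding i(2) r_def by simp_all
      have "emeasure (tri_factor b) (B b) = emeasure lborel {x. 0 < x \<and> complex_of_real x \<in> B b}"
        using emeasure_pos_lebesgue[of "B b"] Bs[of b] True by (simp add: case_prod_unfold)
      also have "{x. 0 < x \<and> complex_of_real x \<in> B b} = {0<..} \<inter> ball r e"
        using True by (auto simp: B_def case_prod_unfold r(1) dist_of_real)
      also have "emeasure lborel \<dots> \<noteq> 0"
      proof -
        have "\<not> negligible ({0<..} \<inter> ball r e)"
          by (rule open_not_negligible) (use r e in \<open>auto intro!: exI[of _ r]\<close>)
        then show ?thesis by (auto simp: negligible_iff_null_sets null_sets_completion_iff null_sets_def)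
      qed
      finally show ?thesis .
    qed
    have "AE x in tri_measure p. P (tri_mat p x)"
      using P AE_distrD[OF tri_mat_measurable] unfolding AE_nu_iff[OF p] S_lebesgue_eq by blast
    then have "AE x in tri_measure p. x \<notin> Pi\<^sub>E (tri_index p) B"
    proof (rule AE_mp, intro AE_I2 impI notI)
      fix x assume PP: "P (tri_mat p x)" and x: "x \<in> Pi\<^sub>E (tri_index p) B"
      have xs: "x \<in> space (tri_measure p)" using x unfolding B_def by (auto simp: space_PiM PiE_iff)
      have "dist (tri_mat p x $$ (i, j)) (s $$ (i, j)) < e" if ij: "i < p" "j < p" for i j
      proof (cases "(i, j) \<in> tri_index p")
        case True
        then have "x (i, j) \<in> B (i, j)" using x by auto
        then show ?thesis using True ij by (auto simp: tri_mat_def B_def dist_commute)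
      next
        case False
        then show ?thesis using ij s e unfolding S_group_def by (auto simp: tri_mat_def tri_index_def)
      qed
      then show False using neg tri_mat_S[OF xs] PP by blast
    qed
    moreover have "Pi\<^sub>E (tri_index p) B \<in> sets (tri_measure p)" using Bs by (intro sets_PiM_I_finite) auto
    ultimately have "emeasure (tri_measure p) (Pi\<^sub>E (tri_index p) B) = 0"
      using AE_iff_measurable[of "Pi\<^sub>E (tri_index p) B" "tri_measure p" "\<lambda>x. x \<notin> Pi\<^sub>E (tri_index p) B"] sets.sets_into_space
      by blast
    moreover have "emeasure (tri_measure p) (Pi\<^sub>E (tri_index p) B) = (\<Prod>b\<in>tri_index p. emeasure (tri_factor b) (B b))"
      using Bs by (intro tri.emeasure_PiM) auto
    ultimately show False using Bpos by (auto simp: prod_zero_iff)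
  qed
  have "\<forall>n. \<exists>t. t \<in> S_group p \<and> P t \<and> (\<forall>i<p. \<forall>j<p. dist (t $$ (i, j)) (s $$ (i, j)) < 1 / real (Suc n))"
    using ex by (metis of_nat_0_less_iff zero_less_Suc zero_less_divide_1_iff)
  then obtain S where S: "\<And>n. S n \<in> S_group p" "\<And>n. P (S n)"
    "\<And>n i j. i < p \<Longrightarrow> j < p \<Longrightarrow> dist (S n $$ (i, j)) (s $$ (i, j)) < 1 / real (Suc n)" by metis
  have "(\<lambda>n. S n $$ (i, j)) \<longlonglongrightarrow> s $$ (i, j)" if "i < p" "j < p" for i j
  proof (rule tendsto_dist_iff[THEN iffD2], rule tendsto_sandwich[of "\<lambda>_. 0" _ _ "\<lambda>n. 1 / real (Suc n)"])
    show "\<forall>\<^sub>F n in sequentially. dist (S n $$ (i, j)) (s $$ (i, j)) \<le> 1 / real (Suc n)"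
      using S(3)[OF that] by (auto intro: always_eventually less_imp_le)
    show "(\<lambda>n. 1 / real (Suc n)) \<longlonglongrightarrow> 0" using LIMSEQ_inverse_real_of_nat by (simp add: inverse_eq_divide)
  qed auto
  then show ?thesis using that S(1,2) by blast
qed

section \<open>Integrability at the origin and at infinity\<close>

text \<open>The real dimension of \<open>S\<close>: a diagonal entry is real, an entry below the diagonal is complex.\<close>

lemma sum_tri_index: "(\<Sum>(i, j)\<in>tri_index p. if i = j then 1 else 2 :: nat) = p\<^sup>2"
proof (induction p)
  case 0
  then show ?case by (simp add: tri_index_def)
next
  case (Suc p)
  have e: "tri_index (Suc p) = tri_index p \<union> Pair p ` {..p}"
    by (auto simp: tri_index_def less_Suc_eq)
  have "(\<Sum>(i, j)\<in>tri_index (Suc p). if i = j then 1 else 2 :: nat)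
    = (\<Sum>(i, j)\<in>tri_index p. if i = j then 1 else 2) + (\<Sum>(i, j)\<in>Pair p ` {..p}. if i = j then 1 else 2)"
    unfolding e by (rule sum.union_disjoint) (simp, simp, auto simp: tri_index_def)
  also have "(\<Sum>(i, j)\<in>Pair p ` {..p}. if i = j then 1 else 2 :: nat) = (\<Sum>j\<le>p. if p = j then 1 else 2)"
    by (subst sum.reindex) (auto simp: inj_on_def)
  also have "\<dots> = (\<Sum>j<p. 2) + 1"
    by (simp flip: lessThan_Suc_atMost)
  finally show ?case using Suc by (simp add: power2_eq_square)
qed

lemma prod_mono_ennreal:
  fixes f g :: "'i \<Rightarrow> ennreal"
  assumes "\<And>b. b \<in> I \<Longrightarrow> f b \<le> g b"
  shows "prod f I \<le> prod g I"
  using assms by (induction I rule: infinite_finite_induct) (auto intro!: mult_mono)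

text \<open>The volume of a ball in \<open>S\<close> grows at most like the power of the radius given by the dimension.\<close>

lemma ball_volume_le:
  assumes r: "0 < r"
  shows "emeasure (S_lebesgue p) {s \<in> S_group p. hs_norm s \<le> r} \<le> ennreal ((2 * r) ^ p\<^sup>2)"
proof -
  define B where "B b = {w \<in> space (tri_factor b). cmod w \<le> r}" for b :: "nat \<times> nat"
  have B_eq: "B b = space (tri_factor b) \<inter> cball 0 r" for b unfolding B_def by (auto simp: dist_norm)
  have Bs: "B b \<in> sets (tri_factor b)" for b
    unfolding B_eq using sets_of_real_pos by (cases "fst b = snd b") (auto simp: case_prod_unfold sets_pos_iff)
  have vol: "emeasure (tri_factor b) (B b) \<le> ennreal ((2 * r) ^ (case b of (i, j) \<Rightarrow> if i = j then 1 else 2))" for b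
  proof (cases "fst b = snd b")
    case True
    then have "emeasure (tri_factor b) (B b) = emeasure pos_lebesgue {w \<in> complex_of_real ` {0<..}. cmod w \<le> r}"
      by (simp add: B_def case_prod_unfold)
    also have "\<dots> \<le> ennreal r" using emeasure_pos_lebesgue_ball_le[of r] r by simp
    also have "\<dots> \<le> ennreal ((2 * r) ^ 1)" using r by (intro ennreal_leI) simp
    finally show ?thesis using True by (simp add: case_prod_unfold)
  next
    case False
    let ?l = "Complex (- r) (- r)" and ?u = "Complex r r"
    have "emeasure (tri_factor b) (B b) = emeasure lborel (cball (0 :: complex) r)"
      unfolding B_eq using False by (simp add: case_prod_unfold)
    also have "\<dots> \<le> emeasure lborel (cbox ?l ?u)"
    proof (rule emeasure_mono)
      show "cball 0 r \<subseteq> cbox ?l ?u"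
      proof
        fix w assume "w \<in> cball (0 :: complex) r"
        then have "cmod w \<le> r" by simp
        then have "\<bar>Re w\<bar> \<le> r" "\<bar>Im w\<bar> \<le> r" using abs_Re_le_cmod[of w] abs_Im_le_cmod[of w] by linarith+
        then show "w \<in> cbox ?l ?u" by (auto simp: in_cbox_complex_iff)
      qed
    qed simp
    also have "\<dots> = ennreal ((2 * r) ^ 2)"
      using r by (subst emeasure_lborel_cbox) (auto simp: Basis_complex_def inner_complex_def power2_eq_square)
    finally show ?thesis using False by (simp add: case_prod_unfold)
  qed
  have A: "{s \<in> S_group p. hs_norm s \<le> r} \<in> sets (S_lebesgue p)"
    using measurable_sets[OF hs_norm_measurable_S, of "{..r}"] by (simp add: vimage_def Collect_conj_eq Int_commute)
  have "emeasure (S_lebesgue p) {s \<in> S_group p. hs_norm s \<le> r}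
    = emeasure (tri_measure p) (tri_mat p -` {s \<in> S_group p. hs_norm s \<le> r} \<inter> space (tri_measure p))"
    unfolding S_lebesgue_eq by (rule emeasure_distr[OF tri_mat_measurable]) (use A sets_S_lebesgue in simp)
  also have "\<dots> \<le> emeasure (tri_measure p) (Pi\<^sub>E (tri_index p) B)"
  proof (rule emeasure_mono)
    show "Pi\<^sub>E (tri_index p) B \<in> sets (tri_measure p)" using Bs by (intro sets_PiM_I_finite) auto
    show "tri_mat p -` {s \<in> S_group p. hs_norm s \<le> r} \<inter> space (tri_measure p) \<subseteq> Pi\<^sub>E (tri_index p) B"
    proof
      fix x assume x: "x \<in> tri_mat p -` {s \<in> S_group p. hs_norm s \<le> r} \<inter> space (tri_measure p)"
      have "x b \<in> B b" if b: "b \<in> tri_index p" for b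
      proof -
        have "cmod (tri_mat p x $$ (fst b, snd b)) \<le> hs_norm (tri_mat p x)"
          by (rule norm_index_le_hs_norm[of _ p p]) (use b in \<open>auto simp: tri_mat_def tri_index_def\<close>)
        moreover have "tri_mat p x $$ (fst b, snd b) = x b"
          using b by (auto simp: tri_mat_def tri_index_def)
        moreover have "x b \<in> space (tri_factor b)" using x b by (auto simp: space_PiM PiE_iff)
        ultimately show ?thesis using x unfolding B_def by auto
      qed
      then show "x \<in> Pi\<^sub>E (tri_index p) B" using x by (auto simp: space_PiM PiE_iff)
    qed
  qed
  also have "\<dots> = (\<Prod>b\<in>tri_index p. emeasure (tri_factor b) (B b))"
    using Bs by (intro tri.emeasure_PiM) auto
  also have "\<dots> \<le> (\<Prod>b\<in>tri_index p. ennreal ((2 * r) ^ (case b of (i, j) \<Rightarrow> if i = j then 1 else 2)))"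
    by (rule prod_mono_ennreal) (rule vol)
  also have "\<dots> = ennreal ((2 * r) ^ p\<^sup>2)"
    using r by (simp add: prod_ennreal flip: power_sum sum_tri_index)
  finally show ?thesis .
qed

lemma dyadic_shell:
  fixes h :: real
  assumes "1 \<le> h"
  obtains k :: nat where "2 ^ k \<le> h" "h < 2 ^ Suc k"
proof -
  have ex: "\<exists>k. h < 2 ^ k" by (rule real_arch_pow) simp
  define K where "K = (LEAST k. h < 2 ^ k)"
  have K: "h < 2 ^ K" unfolding K_def by (rule LeastI_ex[OF ex])
  have "K \<noteq> 0" using K assms by (intro notI) simp
  then obtain k where k: "K = Suc k" using not0_implies_Suc by blast
  have "\<not> h < 2 ^ k" using not_less_Least[of k "\<lambda>k. h < 2 ^ k"] k unfolding K_def by simp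
  then show ?thesis using that[of k] K k by simp
qed

text \<open>Summation over dyadic shells. Since the exponent in \<open>\<nu>\<close> is the dimension of \<open>S\<close>, all shells have
  comparable measure, and the integrand makes the sum converge geometrically at both ends.\<close>

lemma nn_integral_nu_min:
  assumes p: "1 \<le> p"
  shows "(\<integral>\<^sup>+s. ennreal (min (hs_norm s) (1 / hs_norm s)) \<partial>nu_measure p) < \<infinity>"
proof -
  let ?d = "p\<^sup>2"
  \<comment> \<open>Bounds for density times integrand on the shells \<open>2\<^sup>k \<le> |s| < 2\<^sup>k\<^sup>+\<^sup>1\<close> and
    \<open>2\<^sup>-\<^sup>k\<^sup>-\<^sup>1 < |s| \<le> 2\<^sup>-\<^sup>k\<close>; each shell lies in the ball around 0 of its outer radius.\<close>
  define a b :: "nat \<Rightarrow> real" where "a k = ((1 / 2) ^ k) ^ ?d * (1 / 2) ^ k" and "b k = (2 ^ Suc k) ^ ?d * (1 / 2) ^ k" for k :: nat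
  have ab: "0 \<le> a k" "0 \<le> b k" for k :: nat unfolding a_def b_def by auto
  let ?A = "\<lambda>r. {s \<in> S_group p. hs_norm s \<le> r}"
  have A: "?A r \<in> sets (S_lebesgue p)" for r
    using measurable_sets[OF hs_norm_measurable_S, of "{..r}"] by (simp add: vimage_def Collect_conj_eq Int_commute)
  note [measurable] = hs_norm_measurable_S[of p]
  define g where "g k s = ennreal (a k) * indicator (?A (2 ^ Suc k)) s + ennreal (b k) * indicator (?A ((1 / 2) ^ k)) s" for k s
  have g_meas: "g k \<in> borel_measurable (S_lebesgue p)" for k
    unfolding g_def using A by measurable
  have bound: "ennreal (1 / hs_norm s ^ ?d) * ennreal (min (hs_norm s) (1 / hs_norm s)) \<le> (\<Sum>k. g k s)"
    if s: "s \<in> S_group p" for s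
  proof -
    let ?h = "hs_norm s"
    have h: "0 < ?h" by (rule hs_norm_S_pos[OF s p])
    have "\<exists>k. ennreal (1 / ?h ^ ?d) * ennreal (min ?h (1 / ?h)) \<le> g k s"
    proof (cases "1 \<le> ?h")
      case True
      obtain k where k: "2 ^ k \<le> ?h" "?h < 2 ^ Suc k" using dyadic_shell[OF True] by blast
      have i: "1 / ?h \<le> (1 / 2) ^ k"
      proof -
        have "1 / ?h \<le> 1 / 2 ^ k" using k(1) h by (intro divide_left_mono) auto
        then show ?thesis by (simp add: power_one_over)
      qed
      have "1 / ?h ^ ?d * min ?h (1 / ?h) \<le> (1 / ?h) ^ ?d * (1 / ?h)"
        using h by (intro mult_mono) (auto simp: power_one_over)
      also have "\<dots> \<le> a k" unfolding a_def using i h by (intro mult_mono power_mono) auto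
      finally have "ennreal (1 / ?h ^ ?d) * ennreal (min ?h (1 / ?h)) \<le> ennreal (a k)"
        using h by (simp add: ennreal_leI flip: ennreal_mult)
      also have "\<dots> \<le> g k s" unfolding g_def using k(2) s by (simp add: indicator_def)
      finally show ?thesis by blast
    next
      case False
      then have "1 \<le> 1 / ?h" using h by simp
      then obtain k where k: "2 ^ k \<le> 1 / ?h" "1 / ?h < 2 ^ Suc k" using dyadic_shell by blast
      have i: "?h \<le> (1 / 2) ^ k"
      proof -
        have "2 ^ k * ?h \<le> 1" using k(1) by (simp add: pos_le_divide_eq[OF h])
        then have "?h \<le> 1 / 2 ^ k" by (simp add: pos_le_divide_eq mult.commute)
        then show ?thesis by (simp add: power_one_over)
      qed
      have "1 / ?h ^ ?d * min ?h (1 / ?h) \<le> (1 / ?h) ^ ?d * ?h"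
        using h by (intro mult_mono) (auto simp: power_one_over)
      also have "\<dots> \<le> b k" unfolding b_def using i k(2) h by (intro mult_mono power_mono) auto
      finally have "ennreal (1 / ?h ^ ?d) * ennreal (min ?h (1 / ?h)) \<le> ennreal (b k)"
        using h by (simp add: ennreal_leI flip: ennreal_mult)
      also have "\<dots> \<le> g k s" unfolding g_def using i s by (simp add: indicator_def)
      finally show ?thesis by blast
    qed
    then obtain k where "ennreal (1 / ?h ^ ?d) * ennreal (min ?h (1 / ?h)) \<le> g k s" by blast
    also have "g k s \<le> (\<Sum>k. g k s)" using sum_le_suminf[OF summableI, of "{k}" "\<lambda>k. g k s"] by simp
    finally show ?thesis .
  qed
  have g_int: "(\<integral>\<^sup>+s. g k s \<partial>S_lebesgue p) \<le> ennreal (2 * 4 ^ ?d * (1 / 2) ^ k)" for k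
  proof -
    have "(\<integral>\<^sup>+s. g k s \<partial>S_lebesgue p) = ennreal (a k) * emeasure (S_lebesgue p) (?A (2 ^ Suc k)) + ennreal (b k) * emeasure (S_lebesgue p) (?A ((1 / 2) ^ k))"
      unfolding g_def using A by (subst nn_integral_add) (auto simp: nn_integral_cmult_indicator)
    also have "\<dots> \<le> ennreal (a k) * ennreal ((2 * 2 ^ Suc k) ^ ?d) + ennreal (b k) * ennreal ((2 * (1 / 2) ^ k) ^ ?d)"
      by (intro add_mono mult_left_mono ball_volume_le) auto
    also have "\<dots> = ennreal (a k * (2 * 2 ^ Suc k) ^ ?d + b k * (2 * (1 / 2) ^ k) ^ ?d)"
      using ab by (simp add: ennreal_mult ennreal_plus)
    also have "a k * (2 * 2 ^ Suc k) ^ ?d + b k * (2 * (1 / 2) ^ k) ^ ?d = 2 * 4 ^ ?d * (1 / 2) ^ k"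
    proof -
      have "(1 / 2) ^ k * (2 * 2 ^ Suc k) = (4 :: real)" "2 ^ Suc k * (2 * (1 / 2) ^ k) = (4 :: real)"
        by (simp_all add: power_one_over)
      then have "((1 / 2) ^ k) ^ ?d * (2 * 2 ^ Suc k) ^ ?d = (4 :: real) ^ ?d" "(2 ^ Suc k) ^ ?d * (2 * (1 / 2) ^ k) ^ ?d = (4 :: real) ^ ?d"
        by (simp_all only: power_mult_distrib[symmetric])
      moreover have "x * u * y + x' * u * y' = (x * y + x' * y') * u" for x y x' y' u :: real by (simp add: algebra_simps)
      ultimately show ?thesis unfolding a_def b_def by simp
    qed
    finally show ?thesis .
  qed
  have "(\<integral>\<^sup>+s. ennreal (min (hs_norm s) (1 / hs_norm s)) \<partial>nu_measure p)
    = (\<integral>\<^sup>+s. ennreal (1 / hs_norm s ^ ?d) * ennreal (min (hs_norm s) (1 / hs_norm s)) \<partial>S_lebesgue p)"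
    unfolding nu_measure_def by (rule nn_integral_density) measurable
  also have "\<dots> \<le> (\<integral>\<^sup>+s. (\<Sum>k. g k s) \<partial>S_lebesgue p)"
    by (rule nn_integral_mono) (use bound in auto)
  also have "\<dots> = (\<Sum>k. \<integral>\<^sup>+s. g k s \<partial>S_lebesgue p)" by (rule nn_integral_suminf[OF g_meas])
  also have "\<dots> \<le> (\<Sum>k. ennreal (2 * 4 ^ ?d * (1 / 2) ^ k))" by (intro suminf_le g_int) auto
  also have "\<dots> = ennreal (\<Sum>k. 2 * 4 ^ ?d * (1 / 2) ^ k)"
    by (rule suminf_ennreal2) (auto intro!: summable_mult summable_geometric)
  also have "\<dots> < \<infinity>" by simp
  finally show ?thesis .
qed

section \<open>Strong measurability\<close>

lemma entry_measurable_nu: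
  assumes "i < p" "j < p"
  shows "(\<lambda>s. s $$ (i, j)) \<in> borel_measurable (nu_measure p)"
  by (subst measurable_cong_sets[OF sets_nu refl]) (rule entry_measurable_S[OF assms])

lemma hs_norm_measurable_nu: "hs_norm \<in> borel_measurable (nu_measure p)"
  by (subst measurable_cong_sets[OF sets_nu refl]) (rule hs_norm_measurable_S)

lemma simple_function_restrict:
  assumes "finite I" "\<And>a. a \<in> I \<Longrightarrow> simple_function M (F a)"
  shows "simple_function M (\<lambda>x. \<lambda>a\<in>I. F a x)"
  using assms
proof (induction I rule: finite_induct)
  case empty
  then show ?case by simp
next
  case (insert b I)
  have "(\<lambda>x. \<lambda>a\<in>insert b I. F a x) = (\<lambda>x. (\<lambda>a\<in>I. F a x)(b := F b x))"
    by (intro ext) auto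
  moreover have "simple_function M (\<lambda>x. (\<lambda>a\<in>I. F a x)(b := F b x))"
  proof (rule simple_function_compose2[where h = "\<lambda>f w. f(b := w)"])
    show "simple_function M (\<lambda>x. \<lambda>a\<in>I. F a x)" by (rule insert.IH) (use insert.prems in simp)
    show "simple_function M (F b)" using insert.prems by simp
  qed
  ultimately show ?case by (simp only:)
qed

text \<open>The identity of \<open>S\<close> is a pointwise limit of simple maps to \<open>S\<close>; the diagonal is approximated
  through its logarithm to keep it positive.\<close>

lemma simple_approximation_S:
  obtains \<sigma> :: "nat \<Rightarrow> complex mat \<Rightarrow> complex mat"
  where "\<And>n. simple_function (nu_measure p) (\<sigma> n)" "\<And>n s. \<sigma> n s \<in> S_group p"
    "\<And>s i j. s \<in> S_group p \<Longrightarrow> i < p \<Longrightarrow> j < p \<Longrightarrow> (\<lambda>n. \<sigma> n s $$ (i, j)) \<longlonglongrightarrow> s $$ (i, j)"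
proof -
  define f where "f b s = (if fst b = snd b then complex_of_real (ln (Re (s $$ b))) else s $$ b)" for b :: "nat \<times> nat" and s :: "complex mat"
  have "\<exists>F. \<forall>b\<in>tri_index p. (\<forall>n. simple_function (nu_measure p) (F b n)) \<and> (\<forall>s\<in>S_group p. (\<lambda>n. F b n s) \<longlonglongrightarrow> f b s)"
  proof (rule bchoice, rule ballI)
    fix b assume "b \<in> tri_index p"
    then have "fst b < p" "snd b < p" by (auto simp: tri_index_def)
    then have [measurable]: "(\<lambda>s. s $$ b) \<in> borel_measurable (nu_measure p)" using entry_measurable_nu[of "fst b" p "snd b"] by simp
    have "f b \<in> borel_measurable (nu_measure p)" unfolding f_def by measurable
    from borel_measurable_implies_sequence_metric[OF this, of 0]
    show "\<exists>F. (\<forall>n. simple_function (nu_measure p) (F n)) \<and> (\<forall>s\<in>S_group p. (\<lambda>n. F n s) \<longlonglongrightarrow> f b s)" by auto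
  qed
  then obtain F where F: "\<And>b n. b \<in> tri_index p \<Longrightarrow> simple_function (nu_measure p) (F b n)"
    "\<And>b s. b \<in> tri_index p \<Longrightarrow> s \<in> S_group p \<Longrightarrow> (\<lambda>n. F b n s) \<longlonglongrightarrow> f b s" by blast
  define H where "H x = mat p p (\<lambda>b. if fst b = snd b then complex_of_real (exp (Re (x b))) else if b \<in> tri_index p then x b else 0)"
    for x :: "nat \<times> nat \<Rightarrow> complex"
  define \<sigma> where "\<sigma> n s = H (\<lambda>b\<in>tri_index p. F b n s)" for n s
  show ?thesis
  proof
    show "simple_function (nu_measure p) (\<sigma> n)" for n
      unfolding \<sigma>_def using F(1) by (intro simple_function_compose1[where g = H] simple_function_restrict) auto
    show "\<sigma> n s \<in> S_group p" for n s
      unfolding \<sigma>_def H_def S_group_def by (auto simp: tri_index_def)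
    show "(\<lambda>n. \<sigma> n s $$ (i, j)) \<longlonglongrightarrow> s $$ (i, j)" if s: "s \<in> S_group p" and ij: "i < p" "j < p" for s i j
    proof (cases "i = j")
      case True
      have b: "(i, i) \<in> tri_index p" using ij by (simp add: tri_index_def)
      have si: "s $$ (i, i) = of_real (Re (s $$ (i, i)))" "0 < Re (s $$ (i, i))" using s ij unfolding S_group_def by auto
      have "(\<lambda>n. complex_of_real (exp (Re (F (i, i) n s)))) \<longlonglongrightarrow> of_real (exp (Re (f (i, i) s)))"
        by (intro tendsto_intros F(2) b s)
      moreover have "exp (Re (f (i, i) s)) = Re (s $$ (i, i))" using si unfolding f_def by simp
      ultimately show ?thesis using True ij b si(1) unfolding \<sigma>_def H_def by simp
    next
      case False
      show ?thesis
      proof (cases "(i, j) \<in> tri_index p")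
        case True
        have "(\<lambda>n. F (i, j) n s) \<longlonglongrightarrow> f (i, j) s" by (intro F(2) True s)
        then show ?thesis using False ij True unfolding \<sigma>_def H_def f_def by simp
      next
        case nt: False
        then have "s $$ (i, j) = 0" using s ij unfolding S_group_def tri_index_def by auto
        then show ?thesis using False ij nt unfolding \<sigma>_def H_def by simp
      qed
    qed
  qed
qed

lemma null_sequence_squeeze:
  fixes f g :: "nat \<Rightarrow> real"
  assumes "\<And>n. 0 \<le> f n" "\<And>n. f n \<le> g n" "g \<longlonglongrightarrow> 0"
  shows "f \<longlonglongrightarrow> 0"
  by (rule tendsto_sandwich[of "\<lambda>_. 0" f sequentially g 0]) (use assms in auto)

text \<open>Pointwise limits in \<open>K\<close> of simple functions: the measurability part of square integrability.\<close>

definition strongly_measurable :: "nat \<Rightarrow> nat \<Rightarrow> vfun \<Rightarrow> bool" where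
  "strongly_measurable p q F \<longleftrightarrow> (\<exists>G. (\<forall>i::nat. simple_function (nu_measure p) (G i) \<and>
              (\<forall>s \<in> S_group p. G i s \<in> K_space p (q - p))) \<and>
          (\<forall>s \<in> S_group p. (\<lambda>i. K_norm p (q - p) (\<lambda>z. G i s z - F s z)) \<longlonglongrightarrow> 0))"

lemma square_int_fun_iff:
  "F \<in> square_int_fun p q \<longleftrightarrow> (\<forall>s \<in> S_group p. F s \<in> K_space p (q - p)) \<and> strongly_measurable p q F \<and>
     integrable (nu_measure p) (\<lambda>s. (K_norm p (q - p) (F s))\<^sup>2)"
  unfolding square_int_fun_def strongly_measurable_def by simp

lemma K_norm_measurable:
  assumes F: "\<And>s. s \<in> S_group p \<Longrightarrow> F s \<in> K_space p (q - p)" "strongly_measurable p q F"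
  shows "(\<lambda>s. K_norm p (q - p) (F s)) \<in> borel_measurable (nu_measure p)"
proof -
  obtain G where G: "\<And>i. simple_function (nu_measure p) (G i)" "\<And>i s. s \<in> S_group p \<Longrightarrow> G i s \<in> K_space p (q - p)"
    "\<And>s. s \<in> S_group p \<Longrightarrow> (\<lambda>i. K_norm p (q - p) (\<lambda>z. G i s z - F s z)) \<longlonglongrightarrow> 0"
    using F(2) unfolding strongly_measurable_def by blast
  show ?thesis
  proof (rule borel_measurable_LIMSEQ_real)
    show "(\<lambda>s. K_norm p (q - p) (G i s)) \<in> borel_measurable (nu_measure p)" for i
      by (rule borel_measurable_simple_function[OF simple_function_compose1[OF G(1)]])
    fix s assume "s \<in> space (nu_measure p)"
    then have s: "s \<in> S_group p" by simp
    show "(\<lambda>i. K_norm p (q - p) (G i s)) \<longlonglongrightarrow> K_norm p (q - p) (F s)"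
    proof (rule tendsto_dist_iff[THEN iffD2], rule tendsto_sandwich[OF _ _ tendsto_const G(3)[OF s]])
      show "\<forall>\<^sub>F i in sequentially. dist (K_norm p (q - p) (G i s)) (K_norm p (q - p) (F s)) \<le> K_norm p (q - p) (\<lambda>z. G i s z - F s z)"
        using K_norm_diff_triangle[OF G(2)[OF s] F(1)[OF s]] by (auto simp: dist_real_def)
    qed auto
  qed
qed

lemma phi_diff_square_int:
  assumes p: "1 \<le> p" and v: "v \<in> siegel p m" and w: "w \<in> siegel p m"
  shows "(\<lambda>s z. phi p m v s z - phi p m w s z) \<in> square_int_fun p (p + m)"
proof -
  note vc = siegel_carrier[OF v] siegel_E1[OF v] and wc = siegel_carrier[OF w] siegel_E1[OF w]
  let ?F = "\<lambda>s z. phi p m v s z - phi p m w s z"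
  have K: "?F s \<in> K_space p m" if "s \<in> S_group p" for s
    using S_group_carrier[OF that] by (intro K_space_diff phi_K(1) vc wc)
  obtain \<sigma> where \<sigma>: "\<And>n. simple_function (nu_measure p) (\<sigma> n)" "\<And>n s. \<sigma> n s \<in> S_group p"
    "\<And>s i j. s \<in> S_group p \<Longrightarrow> i < p \<Longrightarrow> j < p \<Longrightarrow> (\<lambda>n. \<sigma> n s $$ (i, j)) \<longlonglongrightarrow> s $$ (i, j)"
    using simple_approximation_S[of p] by blast
  have sm: "strongly_measurable p (p + m) ?F"
    unfolding strongly_measurable_def
  proof (intro exI[of _ "\<lambda>n s. ?F (\<sigma> n s)"] conjI allI ballI)
    show "simple_function (nu_measure p) (\<lambda>s. ?F (\<sigma> n s))" for n
      by (rule simple_function_compose1[OF \<sigma>(1)])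
    show "?F (\<sigma> n s) \<in> K_space p (p + m - p)" for n s using K[OF \<sigma>(2)] by simp
    fix s assume s: "s \<in> S_group p"
    note c = S_group_carrier[OF \<sigma>(2)] S_group_carrier[OF s] \<sigma>(3)[OF s]
    have "(\<lambda>n. K_norm p m (\<lambda>z. phi p m v (\<sigma> n s) z - phi p m v s z) + K_norm p m (\<lambda>z. phi p m w s z - phi p m w (\<sigma> n s) z)) \<longlonglongrightarrow> 0 + 0"
      using phi_K_tendsto[OF v c] phi_K_tendsto[OF w c] by (intro tendsto_add) (simp_all add: K_norm_minus_commute)
    moreover have "K_norm p m (\<lambda>z. ?F (\<sigma> n s) z - ?F s z)
      \<le> K_norm p m (\<lambda>z. phi p m v (\<sigma> n s) z - phi p m v s z) + K_norm p m (\<lambda>z. phi p m w s z - phi p m w (\<sigma> n s) z)" for n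
      using K_norm_triangle[of "\<lambda>z. phi p m v (\<sigma> n s) z - phi p m v s z" p m "\<lambda>z. phi p m w s z - phi p m w (\<sigma> n s) z",
          OF K_space_diff[OF phi_K(1)[OF vc c(1)] phi_K(1)[OF vc c(2)]] K_space_diff[OF phi_K(1)[OF wc c(2)] phi_K(1)[OF wc c(1)]]]
      by (simp add: algebra_simps)
    ultimately have "(\<lambda>n. K_norm p m (\<lambda>z. ?F (\<sigma> n s) z - ?F s z)) \<longlonglongrightarrow> 0"
      by (intro null_sequence_squeeze[OF K_norm_nonneg]) simp_all
    then show "(\<lambda>n. K_norm p (p + m - p) (\<lambda>z. ?F (\<sigma> n s) z - ?F s z)) \<longlonglongrightarrow> 0" by simp
  qed
  obtain M where M: "M \<ge> 0" "\<And>s. s \<in> carrier_mat p p \<Longrightarrow> hs_norm s > 0 \<Longrightarrow>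
    (K_norm p m (?F s))\<^sup>2 \<le> M * min (hs_norm s) (1 / hs_norm s)"
    using phi_diff_bound[OF v w] by blast
  have meas: "(\<lambda>s. K_norm p m (?F s)) \<in> borel_measurable (nu_measure p)"
    using K_norm_measurable[of p ?F "p + m"] K sm by simp
  have "integrable (nu_measure p) (\<lambda>s. (K_norm p m (?F s))\<^sup>2)"
  proof (rule integrableI_nonneg)
    show "(\<lambda>s. (K_norm p m (?F s))\<^sup>2) \<in> borel_measurable (nu_measure p)" using meas by measurable
    have "(\<integral>\<^sup>+s. ennreal ((K_norm p m (?F s))\<^sup>2) \<partial>nu_measure p)
      \<le> (\<integral>\<^sup>+s. ennreal M * ennreal (min (hs_norm s) (1 / hs_norm s)) \<partial>nu_measure p)"
    proof (rule nn_integral_mono)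
      fix s assume "s \<in> space (nu_measure p)"
      then have s: "s \<in> S_group p" by simp
      have "ennreal ((K_norm p m (?F s))\<^sup>2) \<le> ennreal (M * min (hs_norm s) (1 / hs_norm s))"
        by (intro ennreal_leI M(2) S_group_carrier[OF s] hs_norm_S_pos[OF s p])
      then show "ennreal ((K_norm p m (?F s))\<^sup>2) \<le> ennreal M * ennreal (min (hs_norm s) (1 / hs_norm s))"
        using M(1) by (simp add: ennreal_mult)
    qed
    also have "\<dots> = ennreal M * (\<integral>\<^sup>+s. ennreal (min (hs_norm s) (1 / hs_norm s)) \<partial>nu_measure p)"
      using hs_norm_measurable_nu[of p] by (intro nn_integral_cmult) measurable
    also have "\<dots> < \<infinity>" using nn_integral_nu_min[OF p] by (simp add: ennreal_mult_less_top)
    finally show "(\<integral>\<^sup>+s. ennreal ((K_norm p m (?F s))\<^sup>2) \<partial>nu_measure p) < \<infinity>" .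
  qed simp
  then show ?thesis unfolding square_int_fun_iff using K sm by simp
qed

lemma square_int_fun_add:
  assumes F: "F \<in> square_int_fun p q" and G: "G \<in> square_int_fun p q"
  shows "(\<lambda>s z. F s z + G s z) \<in> square_int_fun p q"
proof -
  let ?m = "q - p"
  have K: "F s \<in> K_space p ?m" "G s \<in> K_space p ?m" if "s \<in> S_group p" for s
    using F G that unfolding square_int_fun_iff by auto
  obtain A where A: "\<And>i. simple_function (nu_measure p) (A i)" "\<And>i s. s \<in> S_group p \<Longrightarrow> A i s \<in> K_space p ?m"
    "\<And>s. s \<in> S_group p \<Longrightarrow> (\<lambda>i. K_norm p ?m (\<lambda>z. A i s z - F s z)) \<longlonglongrightarrow> 0"
    using F unfolding square_int_fun_iff strongly_measurable_def by blast
  obtain B where B: "\<And>i. simple_function (nu_measure p) (B i)" "\<And>i s. s \<in> S_group p \<Longrightarrow> B i s \<in> K_space p ?m"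
    "\<And>s. s \<in> S_group p \<Longrightarrow> (\<lambda>i. K_norm p ?m (\<lambda>z. B i s z - G s z)) \<longlonglongrightarrow> 0"
    using G unfolding square_int_fun_iff strongly_measurable_def by blast
  have sm: "strongly_measurable p q (\<lambda>s z. F s z + G s z)"
    unfolding strongly_measurable_def
  proof (intro exI[of _ "\<lambda>i s z. A i s z + B i s z"] conjI allI ballI)
    show "simple_function (nu_measure p) (\<lambda>s z. A i s z + B i s z)" for i
      by (rule simple_function_compose2[OF A(1) B(1)])
    show "(\<lambda>z. A i s z + B i s z) \<in> K_space p ?m" if "s \<in> S_group p" for i s
      using A(2) B(2) that by (intro K_space_add)
    fix s assume s: "s \<in> S_group p"
    have "(\<lambda>i. K_norm p ?m (\<lambda>z. A i s z - F s z) + K_norm p ?m (\<lambda>z. B i s z - G s z)) \<longlonglongrightarrow> 0 + 0"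
      by (intro tendsto_add A(3) B(3) s)
    moreover have "K_norm p ?m (\<lambda>z. (A i s z + B i s z) - (F s z + G s z))
      \<le> K_norm p ?m (\<lambda>z. A i s z - F s z) + K_norm p ?m (\<lambda>z. B i s z - G s z)" for i
      using K_norm_triangle[of "\<lambda>z. A i s z - F s z" p ?m "\<lambda>z. B i s z - G s z",
          OF K_space_diff[OF A(2)[OF s] K(1)[OF s]] K_space_diff[OF B(2)[OF s] K(2)[OF s]]]
      by (simp add: algebra_simps)
    ultimately show "(\<lambda>i. K_norm p ?m (\<lambda>z. (A i s z + B i s z) - (F s z + G s z))) \<longlonglongrightarrow> 0"
      by (intro null_sequence_squeeze[OF K_norm_nonneg]) simp_all
  qed
  have KK: "(\<lambda>z. F s z + G s z) \<in> K_space p ?m" if "s \<in> S_group p" for s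
    using K[OF that] by (rule K_space_add)
  have meas: "(\<lambda>s. K_norm p ?m (\<lambda>z. F s z + G s z)) \<in> borel_measurable (nu_measure p)"
    by (rule K_norm_measurable[of p "\<lambda>s z. F s z + G s z" q, OF KK sm])
  have "integrable (nu_measure p) (\<lambda>s. (K_norm p ?m (\<lambda>z. F s z + G s z))\<^sup>2)"
  proof (rule Bochner_Integration.integrable_bound[where f = "\<lambda>s. 2 * (K_norm p ?m (F s))\<^sup>2 + 2 * (K_norm p ?m (G s))\<^sup>2"])
    show "integrable (nu_measure p) (\<lambda>s. 2 * (K_norm p ?m (F s))\<^sup>2 + 2 * (K_norm p ?m (G s))\<^sup>2)"
      using F G unfolding square_int_fun_iff by auto
    show "(\<lambda>s. (K_norm p ?m (\<lambda>z. F s z + G s z))\<^sup>2) \<in> borel_measurable (nu_measure p)" using meas by measurable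
    show "AE s in nu_measure p. norm ((K_norm p ?m (\<lambda>z. F s z + G s z))\<^sup>2) \<le> norm (2 * (K_norm p ?m (F s))\<^sup>2 + 2 * (K_norm p ?m (G s))\<^sup>2)"
    proof (rule AE_I2)
      fix s assume "s \<in> space (nu_measure p)"
      then have "K_norm p ?m (\<lambda>z. F s z + G s z) \<le> K_norm p ?m (F s) + K_norm p ?m (G s)"
        by (intro K_norm_triangle K) auto
      then have "(K_norm p ?m (\<lambda>z. F s z + G s z))\<^sup>2 \<le> (K_norm p ?m (F s) + K_norm p ?m (G s))\<^sup>2" by (intro power_mono) auto
      also have "\<dots> \<le> 2 * (K_norm p ?m (F s))\<^sup>2 + 2 * (K_norm p ?m (G s))\<^sup>2"
        using sum_squares_bound[of "K_norm p ?m (F s)" "K_norm p ?m (G s)"] by (simp add: power2_eq_square algebra_simps)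
      finally show "norm ((K_norm p ?m (\<lambda>z. F s z + G s z))\<^sup>2) \<le> norm (2 * (K_norm p ?m (F s))\<^sup>2 + 2 * (K_norm p ?m (G s))\<^sup>2)" by simp
    qed
  qed
  then show ?thesis unfolding square_int_fun_iff using KK sm by simp
qed

lemma square_int_fun_cmult:
  assumes F: "F \<in> square_int_fun p q"
  shows "(\<lambda>s z. c * F s z) \<in> square_int_fun p q"
proof -
  let ?m = "q - p"
  obtain A where A: "\<And>i. simple_function (nu_measure p) (A i)" "\<And>i s. s \<in> S_group p \<Longrightarrow> A i s \<in> K_space p ?m"
    "\<And>s. s \<in> S_group p \<Longrightarrow> (\<lambda>i. K_norm p ?m (\<lambda>z. A i s z - F s z)) \<longlonglongrightarrow> 0"
    using F unfolding square_int_fun_iff strongly_measurable_def by blast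
  have "strongly_measurable p q (\<lambda>s z. c * F s z)"
    unfolding strongly_measurable_def
  proof (intro exI[of _ "\<lambda>i s z. c * A i s z"] conjI allI ballI)
    show "simple_function (nu_measure p) (\<lambda>s z. c * A i s z)" for i
      by (rule simple_function_compose1[OF A(1)])
    show "(\<lambda>z. c * A i s z) \<in> K_space p ?m" if "s \<in> S_group p" for i s
      using A(2) that by (intro K_space_cmult)
    fix s assume s: "s \<in> S_group p"
    have "(\<lambda>i. cmod c * K_norm p ?m (\<lambda>z. A i s z - F s z)) \<longlonglongrightarrow> cmod c * 0"
      by (intro tendsto_mult tendsto_const A(3) s)
    then show "(\<lambda>i. K_norm p ?m (\<lambda>z. c * A i s z - c * F s z)) \<longlonglongrightarrow> 0"
      by (simp add: right_diff_distrib[symmetric] K_norm_cmult)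
  qed
  then show ?thesis
    using F unfolding square_int_fun_iff by (auto intro: K_space_cmult simp: K_norm_cmult power_mult_distrib)
qed

lemma square_int_fun_zero: "(\<lambda>s z. 0) \<in> square_int_fun p q"
proof -
  have "K_norm p (q - p) (\<lambda>z. 0) = 0" unfolding K_norm_def by simp
  then show ?thesis
    unfolding square_int_fun_iff strongly_measurable_def
    by (auto intro!: K_space_zero exI[of _ "\<lambda>i s z. 0"])
qed

section \<open>The vector space of classes\<close>

text \<open>Equality almost everywhere, with the convention of the classes.\<close>

definition ae_eq :: "nat \<Rightarrow> nat \<Rightarrow> vfun \<Rightarrow> vfun \<Rightarrow> bool" where
  "ae_eq p q F G \<longleftrightarrow> (AE s in nu_measure p. \<forall>z \<in> carrier_mat p (q - p). G s z = F s z)"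

lemma ae_eq_refl [simp]: "ae_eq p q F F"
  unfolding ae_eq_def by simp

lemma ae_eq_sym: "ae_eq p q F G \<Longrightarrow> ae_eq p q G F"
  unfolding ae_eq_def by (erule AE_mp) auto

lemma ae_eq_trans:
  assumes "ae_eq p q F G" "ae_eq p q G H"
  shows "ae_eq p q F H"
  using assms unfolding ae_eq_def by eventually_elim auto

lemma ae_eq_add:
  assumes "ae_eq p q F F'" "ae_eq p q G G'"
  shows "ae_eq p q (\<lambda>s z. F s z + G s z) (\<lambda>s z. F' s z + G' s z)"
  using assms unfolding ae_eq_def by eventually_elim auto

lemma ae_eq_cmult:
  assumes "ae_eq p q F F'"
  shows "ae_eq p q (\<lambda>s z. c * F s z) (\<lambda>s z. c * F' s z)"
  using assms unfolding ae_eq_def by eventually_elim auto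

lemma ae_class_iff: "G \<in> ae_class p q F \<longleftrightarrow> G \<in> square_int_fun p q \<and> ae_eq p q F G"
  unfolding ae_class_def ae_eq_def by simp

lemma ae_class_cong:
  assumes "ae_eq p q F G"
  shows "ae_class p q F = ae_class p q G"
  using ae_eq_trans[OF assms] ae_eq_trans[OF ae_eq_sym[OF assms]] by (auto simp: ae_class_iff)

lemma ae_class_self: "F \<in> square_int_fun p q \<Longrightarrow> F \<in> ae_class p q F"
  by (simp add: ae_class_iff)

lemma ae_class_eq_iff:
  assumes "F \<in> square_int_fun p q"
  shows "ae_class p q F = ae_class p q G \<longleftrightarrow> ae_eq p q F G"
  using ae_class_cong ae_class_self[OF assms] by (metis ae_class_iff ae_eq_sym)

lemma L2_carrier: "carrier (L2_space p q) = ae_class p q ` square_int_fun p q"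
  unfolding L2_space_def by simp

lemma L2_zero: "\<zero>\<^bsub>L2_space p q\<^esub> = ae_class p q (\<lambda>s z. 0)"
  unfolding L2_space_def by simp

lemma L2_add:
  assumes F: "F \<in> square_int_fun p q" and G: "G \<in> square_int_fun p q"
  shows "ae_class p q F \<oplus>\<^bsub>L2_space p q\<^esub> ae_class p q G = ae_class p q (\<lambda>s z. F s z + G s z)"
proof -
  have "ae_class p q (\<lambda>s z. F' s z + G' s z) = ae_class p q (\<lambda>s z. F s z + G s z)"
    if "F' \<in> ae_class p q F" "G' \<in> ae_class p q G" for F' G'
    using that by (intro ae_class_cong ae_eq_add) (auto simp: ae_class_iff intro: ae_eq_sym)
  then have "(\<Union>F'\<in>ae_class p q F. \<Union>G'\<in>ae_class p q G. ae_class p q (\<lambda>s z. F' s z + G' s z)) = ae_class p q (\<lambda>s z. F s z + G s z)"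
    by (intro UN_constant_eq[OF ae_class_self[OF F]] UN_constant_eq[OF ae_class_self[OF G]] ballI) simp
  then show ?thesis unfolding L2_space_def by simp
qed

lemma L2_smult:
  assumes F: "F \<in> square_int_fun p q"
  shows "c \<odot>\<^bsub>L2_space p q\<^esub> ae_class p q F = ae_class p q (\<lambda>s z. c * F s z)"
proof -
  have "ae_class p q (\<lambda>s z. c * F' s z) = ae_class p q (\<lambda>s z. c * F s z)" if "F' \<in> ae_class p q F" for F'
    using that by (intro ae_class_cong ae_eq_cmult) (auto simp: ae_class_iff intro: ae_eq_sym)
  then have "(\<Union>F'\<in>ae_class p q F. ae_class p q (\<lambda>s z. c * F' s z)) = ae_class p q (\<lambda>s z. c * F s z)"
    by (intro UN_constant_eq[OF ae_class_self[OF F]] ballI) simp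
  then show ?thesis unfolding L2_space_def by simp
qed

lemma L2_module: "module (class_ring :: complex ring) (L2_space p q)"
proof (rule moduleI)
  show "cring (class_ring :: complex ring)" by (rule class_cring.cring_axioms)
  show "abelian_group (L2_space p q)"
  proof (rule abelian_groupI)
    show "x \<oplus>\<^bsub>L2_space p q\<^esub> y \<in> carrier (L2_space p q)"
      if "x \<in> carrier (L2_space p q)" "y \<in> carrier (L2_space p q)" for x y
      using that unfolding L2_carrier by (auto simp: L2_add square_int_fun_add)
    show "\<zero>\<^bsub>L2_space p q\<^esub> \<in> carrier (L2_space p q)"
      unfolding L2_carrier L2_zero using square_int_fun_zero by blast
    show "(x \<oplus>\<^bsub>L2_space p q\<^esub> y) \<oplus>\<^bsub>L2_space p q\<^esub> z = x \<oplus>\<^bsub>L2_space p q\<^esub> (y \<oplus>\<^bsub>L2_space p q\<^esub> z)"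
      if "x \<in> carrier (L2_space p q)" "y \<in> carrier (L2_space p q)" "z \<in> carrier (L2_space p q)" for x y z
      using that unfolding L2_carrier by (auto simp: L2_add square_int_fun_add add.assoc)
    show "x \<oplus>\<^bsub>L2_space p q\<^esub> y = y \<oplus>\<^bsub>L2_space p q\<^esub> x"
      if "x \<in> carrier (L2_space p q)" "y \<in> carrier (L2_space p q)" for x y
      using that unfolding L2_carrier by (auto simp: L2_add add.commute)
    show "\<zero>\<^bsub>L2_space p q\<^esub> \<oplus>\<^bsub>L2_space p q\<^esub> x = x" if "x \<in> carrier (L2_space p q)" for x
      using that unfolding L2_carrier L2_zero by (auto simp: L2_add square_int_fun_zero)
    show "\<exists>y \<in> carrier (L2_space p q). y \<oplus>\<^bsub>L2_space p q\<^esub> x = \<zero>\<^bsub>L2_space p q\<^esub>"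
      if "x \<in> carrier (L2_space p q)" for x
    proof -
      from that obtain F where F: "F \<in> square_int_fun p q" "x = ae_class p q F" unfolding L2_carrier by blast
      have N: "(\<lambda>s z. - 1 * F s z) \<in> square_int_fun p q" by (rule square_int_fun_cmult[OF F(1)])
      have "ae_class p q (\<lambda>s z. - 1 * F s z) \<oplus>\<^bsub>L2_space p q\<^esub> x = \<zero>\<^bsub>L2_space p q\<^esub>"
        unfolding F(2) L2_add[OF N F(1)] L2_zero by simp
      moreover have "ae_class p q (\<lambda>s z. - 1 * F s z) \<in> carrier (L2_space p q)" unfolding L2_carrier using N by blast
      ultimately show ?thesis by blast
    qed
  qed
qed (auto simp: L2_carrier L2_smult L2_add square_int_fun_cmult square_int_fun_add distrib_left distrib_right mult.assoc)

section \<open>Finitely supported coefficients on the domain\<close>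

text \<open>The support of a coefficient function.\<close>

definition supp :: "(complex mat \<Rightarrow> complex) \<Rightarrow> complex mat set" where
  "supp c = {v. c v \<noteq> 0}"

text \<open>Coefficients of finite combinations of points of the domain, with sum zero.\<close>

definition coeff_space :: "nat \<Rightarrow> nat \<Rightarrow> (complex mat \<Rightarrow> complex) set" where
  "coeff_space p m = {c. finite (supp c) \<and> supp c \<subseteq> siegel p m \<and> (\<Sum>v\<in>supp c. c v) = 0}"

lemma sum_supp:
  assumes "finite A" "supp c \<subseteq> A"
  shows "(\<Sum>v\<in>supp c. c v * h v) = (\<Sum>v\<in>A. c v * h v)"
  by (rule sum.mono_neutral_left) (use assms in \<open>auto simp: supp_def\<close>)

lemma sum_supp_1:
  assumes "finite A" "supp c \<subseteq> A"
  shows "(\<Sum>v\<in>supp c. c v) = (\<Sum>v\<in>A. c v)"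
  using sum_supp[OF assms, of "\<lambda>_. 1"] by simp

lemma coeff_space_add:
  assumes "c \<in> coeff_space p m" "d \<in> coeff_space p m"
  shows "(\<lambda>v. c v + d v) \<in> coeff_space p m"
proof -
  let ?A = "supp c \<union> supp d"
  have A: "finite ?A" "?A \<subseteq> siegel p m" using assms unfolding coeff_space_def by auto
  have s: "supp (\<lambda>v. c v + d v) \<subseteq> ?A" unfolding supp_def by auto
  have "(\<Sum>v\<in>supp (\<lambda>v. c v + d v). c v + d v) = (\<Sum>v\<in>?A. c v) + (\<Sum>v\<in>?A. d v)"
    using sum_supp_1[OF A(1) s] by (simp add: sum.distrib)
  also have "\<dots> = 0" using assms sum_supp_1[OF A(1), of c] sum_supp_1[OF A(1), of d] unfolding coeff_space_def by auto
  finally show ?thesis using A s unfolding coeff_space_def by (auto intro: finite_subset)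
qed

lemma coeff_space_cmult:
  assumes "c \<in> coeff_space p m"
  shows "(\<lambda>v. a * c v) \<in> coeff_space p m"
proof -
  have A: "finite (supp c)" "supp c \<subseteq> siegel p m" using assms unfolding coeff_space_def by auto
  have s: "supp (\<lambda>v. a * c v) \<subseteq> supp c" unfolding supp_def by auto
  have "(\<Sum>v\<in>supp (\<lambda>v. a * c v). a * c v) = a * (\<Sum>v\<in>supp c. c v)"
    using sum_supp_1[OF A(1) s] by (simp add: sum_distrib_left)
  then show ?thesis using A s assms unfolding coeff_space_def by (auto intro: finite_subset)
qed

lemma coeff_space_zero: "(\<lambda>v. 0) \<in> coeff_space p m"
  unfolding coeff_space_def supp_def by simp

text \<open>The coefficient function of a single point.\<close>

definition delta :: "complex mat \<Rightarrow> complex mat \<Rightarrow> complex" where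
  "delta v = (\<lambda>w. if w = v then 1 else 0)"

lemma delta_diff_coeff_space:
  assumes "v \<in> siegel p m" "w \<in> siegel p m"
  shows "(\<lambda>x. delta v x - delta w x) \<in> coeff_space p m"
proof -
  let ?c = "\<lambda>x. delta v x - delta w x"
  have s: "supp ?c \<subseteq> {v, w}" unfolding supp_def delta_def by auto
  have "(\<Sum>x\<in>supp ?c. ?c x) = (\<Sum>x\<in>{v, w}. ?c x)" by (rule sum_supp_1[OF _ s]) simp
  also have "\<dots> = 0" by (cases "v = w") (auto simp: delta_def)
  finally show ?thesis using s assms unfolding coeff_space_def by (auto intro: finite_subset)
qed

text \<open>Transport of coefficients along a map of points.\<close>

definition push :: "(complex mat \<Rightarrow> complex mat) \<Rightarrow> (complex mat \<Rightarrow> complex) \<Rightarrow> complex mat \<Rightarrow> complex" where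
  "push f c = (\<lambda>y. \<Sum>x\<in>supp c. if f x = y then c x else 0)"

lemma supp_push: "supp (push f c) \<subseteq> f ` supp c"
proof
  fix y assume y: "y \<in> supp (push f c)"
  show "y \<in> f ` supp c"
  proof (rule ccontr)
    assume "y \<notin> f ` supp c"
    then have "push f c y = 0" unfolding push_def by (intro sum.neutral) auto
    with y show False unfolding supp_def by simp
  qed
qed

lemma sum_push:
  assumes "finite (supp c)"
  shows "(\<Sum>y\<in>supp (push f c). push f c y * h y) = (\<Sum>x\<in>supp c. c x * h (f x))"
proof -
  have "(\<Sum>y\<in>supp (push f c). push f c y * h y) = (\<Sum>y\<in>f ` supp c. push f c y * h y)"
    by (rule sum_supp[OF _ supp_push]) (use assms in simp)
  also have "\<dots> = (\<Sum>y\<in>f ` supp c. \<Sum>x\<in>supp c. if f x = y then c x * h (f x) else 0)"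
    unfolding push_def sum_distrib_right by (intro sum.cong refl) auto
  also have "\<dots> = (\<Sum>x\<in>supp c. \<Sum>y\<in>f ` supp c. if f x = y then c x * h (f x) else 0)"
    by (rule sum.swap)
  also have "\<dots> = (\<Sum>x\<in>supp c. c x * h (f x))"
    using assms by (intro sum.cong refl) (simp add: sum.delta')
  finally show ?thesis .
qed

lemma push_coeff_space:
  assumes c: "c \<in> coeff_space p m" and f: "\<And>v. v \<in> siegel p m \<Longrightarrow> f v \<in> siegel p m"
  shows "push f c \<in> coeff_space p m"
  using c f supp_push[of f c] sum_push[of c f "\<lambda>_. 1"] unfolding coeff_space_def
  by (auto intro: finite_subset)

lemma push_sum:
  assumes "finite A" "supp c \<subseteq> A"
  shows "push f c y = (\<Sum>x\<in>A. c x * (if f x = y then 1 else 0))"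
  unfolding push_def sum_supp[OF assms, symmetric] by (intro sum.cong) auto

lemma push_add:
  assumes "finite (supp c)" "finite (supp d)"
  shows "push f (\<lambda>v. c v + d v) = (\<lambda>y. push f c y + push f d y)"
proof
  fix y
  let ?A = "supp c \<union> supp d"
  have A: "finite ?A" "supp c \<subseteq> ?A" "supp d \<subseteq> ?A" "supp (\<lambda>v. c v + d v) \<subseteq> ?A" using assms by (auto simp: supp_def)
  show "push f (\<lambda>v. c v + d v) y = push f c y + push f d y"
    unfolding push_sum[OF A(1,2)] push_sum[OF A(1,3)] push_sum[OF A(1,4)] by (simp add: distrib_right sum.distrib)
qed

lemma push_cmult:
  assumes "finite (supp c)"
  shows "push f (\<lambda>v. a * c v) = (\<lambda>y. a * push f c y)"
proof
  fix y
  have s: "supp (\<lambda>v. a * c v) \<subseteq> supp c" by (auto simp: supp_def)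
  show "push f (\<lambda>v. a * c v) y = a * push f c y"
    unfolding push_sum[OF assms order_refl] push_sum[OF assms s] by (simp add: sum_distrib_left mult.assoc)
qed

lemma push_comp:
  assumes c: "c \<in> coeff_space p m" and fgh: "\<And>v. v \<in> siegel p m \<Longrightarrow> h v = f (g v)"
  shows "push h c = push f (push g c)"
proof
  fix y
  have fin: "finite (supp c)" "supp c \<subseteq> siegel p m" using c unfolding coeff_space_def by auto
  have fin': "finite (supp (push g c))" using finite_subset[OF supp_push] fin by blast
  have "push f (push g c) y = (\<Sum>x\<in>supp (push g c). push g c x * (if f x = y then 1 else 0))"
    by (rule push_sum[OF fin' order_refl])
  also have "\<dots> = (\<Sum>x\<in>supp c. c x * (if f (g x) = y then 1 else 0))" by (rule sum_push[OF fin(1)])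
  also have "\<dots> = push h c y"
    unfolding push_sum[OF fin(1) order_refl] using fin(2) fgh by (intro sum.cong refl) (auto simp: subset_iff)
  finally show "push h c y = push f (push g c) y" by simp
qed

lemma push_id:
  assumes c: "c \<in> coeff_space p m" and f: "\<And>v. v \<in> siegel p m \<Longrightarrow> f v = v"
  shows "push f c = c"
proof
  fix y
  have fin: "finite (supp c)" "supp c \<subseteq> siegel p m" using c unfolding coeff_space_def by auto
  have "push f c y = (\<Sum>x\<in>supp c. if x = y then c x else 0)"
    unfolding push_def using fin(2) f by (intro sum.cong refl) (auto simp: subset_iff)
  also have "\<dots> = c y" using fin(1) by (auto simp: supp_def)
  finally show "push f c y = c y" .
qed

lemma push_delta_diff:
  "push f (\<lambda>x. delta v x - delta w x) = (\<lambda>x. delta (f v) x - delta (f w) x)"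
proof
  fix y
  have s: "supp (\<lambda>x. delta v x - delta w x) \<subseteq> {v, w}" unfolding supp_def delta_def by auto
  show "push f (\<lambda>x. delta v x - delta w x) y = delta (f v) y - delta (f w) y"
    unfolding push_sum[OF _ s, simplified] by (cases "v = w") (auto simp: delta_def)
qed

section \<open>Combinations of orbit functions\<close>

text \<open>The combination of orbit functions with given coefficients, and its class. Both are meaningful for finitely
  supported coefficients; the combination is the zero function if the support is infinite.\<close>

definition comb :: "nat \<Rightarrow> nat \<Rightarrow> (complex mat \<Rightarrow> complex) \<Rightarrow> vfun" where
  "comb p m c s z = (\<Sum>v\<in>supp c. c v * phi p m v s z)"

definition comb_class :: "nat \<Rightarrow> nat \<Rightarrow> (complex mat \<Rightarrow> complex) \<Rightarrow> vfun set" where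
  "comb_class p m c = ae_class p (p + m) (comb p m c)"

lemma comb_add:
  assumes "finite (supp c)" "finite (supp d)"
  shows "comb p m (\<lambda>v. c v + d v) = (\<lambda>s z. comb p m c s z + comb p m d s z)"
proof (intro ext)
  fix s z
  let ?A = "supp c \<union> supp d"
  have A: "finite ?A" "supp c \<subseteq> ?A" "supp d \<subseteq> ?A" "supp (\<lambda>v. c v + d v) \<subseteq> ?A" using assms by (auto simp: supp_def)
  show "comb p m (\<lambda>v. c v + d v) s z = comb p m c s z + comb p m d s z"
    unfolding comb_def sum_supp[OF A(1,2)] sum_supp[OF A(1,3)] sum_supp[OF A(1,4)] by (simp add: distrib_right sum.distrib)
qed

lemma comb_cmult:
  assumes "finite (supp c)"
  shows "comb p m (\<lambda>v. a * c v) = (\<lambda>s z. a * comb p m c s z)"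
proof (intro ext)
  fix s z
  have s: "supp (\<lambda>v. a * c v) \<subseteq> supp c" by (auto simp: supp_def)
  show "comb p m (\<lambda>v. a * c v) s z = a * comb p m c s z"
    unfolding comb_def sum_supp[OF assms s] by (simp add: sum_distrib_left mult.assoc)
qed

lemma comb_delta_diff: "comb p m (\<lambda>x. delta v x - delta w x) s z = phi p m v s z - phi p m w s z"
proof -
  have s: "supp (\<lambda>x. delta v x - delta w x) \<subseteq> {v, w}" unfolding supp_def delta_def by auto
  show ?thesis unfolding comb_def sum_supp[OF _ s, simplified] by (cases "v = w") (auto simp: delta_def)
qed

lemma square_int_fun_sum:
  assumes "finite A" "\<And>v. v \<in> A \<Longrightarrow> F v \<in> square_int_fun p q"
  shows "(\<lambda>s z. \<Sum>v\<in>A. c v * F v s z) \<in> square_int_fun p q"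
  using assms
proof (induction A rule: finite_induct)
  case empty
  then show ?case using square_int_fun_zero by simp
next
  case (insert v A)
  have "(\<lambda>s z. c v * F v s z + (\<Sum>v\<in>A. c v * F v s z)) \<in> square_int_fun p q"
    by (intro square_int_fun_add square_int_fun_cmult insert.IH) (use insert.prems in auto)
  then show ?case using insert.hyps by simp
qed

text \<open>Since the coefficients sum to zero, a combination is one of the square integrable differences
  to the base point.\<close>

lemma comb_square_int:
  assumes p: "1 \<le> p" and c: "c \<in> coeff_space p m"
  shows "comb p m c \<in> square_int_fun p (p + m)"
proof -
  have fin: "finite (supp c)" "supp c \<subseteq> siegel p m" "(\<Sum>v\<in>supp c. c v) = 0" using c unfolding coeff_space_def by auto
  have "(\<lambda>s z. \<Sum>v\<in>supp c. c v * (phi p m v s z - phi p m (base p m) s z)) \<in> square_int_fun p (p + m)"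
    by (rule square_int_fun_sum[OF fin(1)]) (use fin(2) in \<open>auto intro!: phi_diff_square_int p base_siegel\<close>)
  moreover have "(\<Sum>v\<in>supp c. c v * (phi p m v s z - phi p m (base p m) s z)) = comb p m c s z" for s z
    unfolding comb_def by (simp add: right_diff_distrib sum_subtractf fin(3) flip: sum_distrib_right)
  ultimately show ?thesis by simp
qed

lemma comb_class_add:
  assumes p: "1 \<le> p" and "c \<in> coeff_space p m" "d \<in> coeff_space p m"
  shows "comb_class p m c \<oplus>\<^bsub>L2_space p (p + m)\<^esub> comb_class p m d = comb_class p m (\<lambda>v. c v + d v)"
proof -
  have "finite (supp c)" "finite (supp d)" using assms unfolding coeff_space_def by auto
  then show ?thesis
    unfolding comb_class_def comb_add[OF \<open>finite (supp c)\<close> \<open>finite (supp d)\<close>]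
    by (intro L2_add comb_square_int assms)
qed

lemma comb_class_smult:
  assumes p: "1 \<le> p" and c: "c \<in> coeff_space p m"
  shows "a \<odot>\<^bsub>L2_space p (p + m)\<^esub> comb_class p m c = comb_class p m (\<lambda>v. a * c v)"
proof -
  have "finite (supp c)" using c unfolding coeff_space_def by auto
  then show ?thesis
    unfolding comb_class_def comb_cmult[OF \<open>finite (supp c)\<close>] by (intro L2_smult comb_square_int assms)
qed

text \<open>Linear independence modulo null sets: the relation extends from a dense set to all of \<open>S\<close> by continuity.\<close>

lemma comb_zero_imp:
  assumes p: "1 \<le> p" and c: "finite (supp c)" "supp c \<subseteq> siegel p m"
    and zero: "AE s in nu_measure p. \<forall>z \<in> carrier_mat p m. comb p m c s z = 0"
  shows "c = (\<lambda>v. 0)"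
proof -
  have all: "comb p m c s z = 0" if s: "s \<in> S_group p" and z: "z \<in> carrier_mat p m" for s z
  proof -
    obtain S where S: "\<And>n :: nat. S n \<in> S_group p" "\<And>n. \<forall>z \<in> carrier_mat p m. comb p m c (S n) z = 0"
      "\<And>i j. i < p \<Longrightarrow> j < p \<Longrightarrow> (\<lambda>n. S n $$ (i, j)) \<longlonglongrightarrow> s $$ (i, j)"
      using conull_dense[OF p zero s] by blast
    have "(\<lambda>n. comb p m c (S n) z) \<longlonglongrightarrow> comb p m c s z"
      unfolding comb_def
      by (intro tendsto_sum tendsto_mult tendsto_const phi_tendsto S_group_carrier[OF S(1)] S_group_carrier[OF s] S(3) z)
        (use c in auto)
    moreover have "(\<lambda>n. comb p m c (S n) z) = (\<lambda>n. 0)" using S(2) z by auto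
    ultimately show ?thesis by (metis LIMSEQ_const_iff)
  qed
  have "c v = 0" if "v \<in> supp c" for v
    by (rule phi_independent[OF c _ that]) (use all in \<open>simp add: comb_def\<close>)
  then show ?thesis unfolding supp_def by auto
qed

lemma comb_class_inj:
  assumes p: "1 \<le> p"
  shows "inj_on (comb_class p m) (coeff_space p m)"
proof (rule inj_onI)
  fix c d assume c: "c \<in> coeff_space p m" and d: "d \<in> coeff_space p m" and eq: "comb_class p m c = comb_class p m d"
  define e where "e = (\<lambda>v. c v + (- 1) * d v)"
  have e: "e \<in> coeff_space p m" unfolding e_def by (intro coeff_space_add coeff_space_cmult c d)
  have fin: "finite (supp c)" "finite (supp (\<lambda>v. (- 1) * d v))" "finite (supp d)"
    using c d coeff_space_cmult[OF d, of "-1"] unfolding coeff_space_def by auto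
  have "ae_eq p (p + m) (comb p m c) (comb p m d)"
    using eq ae_class_eq_iff[OF comb_square_int[OF p c]] unfolding comb_class_def by simp
  then have "AE s in nu_measure p. \<forall>z \<in> carrier_mat p m. comb p m e s z = 0"
    unfolding ae_eq_def e_def comb_add[OF fin(1,2)] comb_cmult[OF fin(3)]
    by (elim AE_mp) (intro AE_I2, simp)
  then have "e = (\<lambda>v. 0)" using comb_zero_imp[OF p, of e m] e unfolding coeff_space_def by auto
  then have "e v = 0" for v by simp
  then show "c = d" unfolding e_def by (simp add: fun_eq_iff)
qed

section \<open>The span of the cocycle\<close>

lemma P_group_obtain:
  assumes "g \<in> P_group p (p + m)"
  obtains s h where "s \<in> S_group p" "h \<in> N_group p m" "g = S_embed p m s * N_embed p m h"
  using assms unfolding P_group_def by (simp only: diff_add_inverse) blast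

lemma act_P_group:
  assumes "g \<in> P_group p (p + m)" "v \<in> siegel p m"
  shows "act p m g v \<in> siegel p m"
proof -
  obtain s h where "s \<in> S_group p" "h \<in> N_group p m" "g = S_embed p m s * N_embed p m h"
    by (rule P_group_obtain[OF assms(1)])
  then show ?thesis using act_P_siegel[OF _ _ assms(2)] by simp
qed

text \<open>The given cocycle is the difference of the orbit functions of the moved and the original base point.\<close>

lemma b_cocycle_eq:
  assumes p: "1 \<le> p" and g: "g \<in> P_group p (p + m)"
  shows "b_cocycle p (p + m) g = comb_class p m (\<lambda>x. delta (act p m g (base p m)) x - delta (base p m) x)"
proof -
  obtain s0 n z0 where s0: "s0 \<in> S_group p" and h: "(n, z0) \<in> N_group p m" and g_eq: "g = S_embed p m s0 * N_embed p m (n, z0)"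
    by (rule P_group_obtain[OF g]) (metis prod.exhaust)
  have z0: "z0 \<in> carrier_mat p m" using h unfolding N_group_def by auto
  note base = base_carrier[of p m] base_blocks(1)[of p m]
  have "T_fun p (p + m) g f_vac s z - f_vac s z = comb p m (\<lambda>x. delta (act p m g (base p m)) x - delta (base p m) x) s z"
    if s: "s \<in> carrier_mat p p" and z: "z \<in> carrier_mat p m" for s z
  proof -
    have ss: "s * s0 \<in> carrier_mat p p" using s S_group_carrier[OF s0] by auto
    have zz: "z + s * s0 * z0 \<in> carrier_mat p m" using z z0 ss by auto
    have "T_fun p (p + m) g f_vac s z = T_fun p (p + m) g (phi p m (base p m)) s z"
      unfolding g_eq T_fun_SN[OF s0 h] using phi_base[OF ss zz] by simp
    also have "\<dots> = phi p m (act p m g (base p m)) s z"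
      unfolding g_eq by (rule T_fun_phi[OF s0 h base s z])
    finally show ?thesis unfolding comb_delta_diff phi_base[OF s z] by simp
  qed
  then have "ae_eq p (p + m) (\<lambda>s z. T_fun p (p + m) g f_vac s z - f_vac s z)
      (comb p m (\<lambda>x. delta (act p m g (base p m)) x - delta (base p m) x))"
    unfolding ae_eq_def by (intro AE_I2) (auto simp: S_group_carrier)
  then show ?thesis unfolding b_cocycle_def comb_class_def by (rule ae_class_cong)
qed

lemma comb_class_L2:
  assumes "1 \<le> p" "c \<in> coeff_space p m"
  shows "comb_class p m c \<in> carrier (L2_space p (p + m))"
  unfolding L2_carrier comb_class_def using comb_square_int[OF assms] by blast

lemma comb_submodule:
  assumes p: "1 \<le> p"
  shows "submodule (class_ring :: complex ring) (comb_class p m ` coeff_space p m) (L2_space p (p + m))"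
proof (rule submodule.intro)
  show "module (class_ring :: complex ring) (L2_space p (p + m))" by (rule L2_module)
  show "comb_class p m ` coeff_space p m \<subseteq> carrier (L2_space p (p + m))" using comb_class_L2[OF p] by auto
  show "v \<oplus>\<^bsub>L2_space p (p + m)\<^esub> w \<in> comb_class p m ` coeff_space p m"
    if "v \<in> comb_class p m ` coeff_space p m" "w \<in> comb_class p m ` coeff_space p m" for v w
    using that by (auto simp: comb_class_add[OF p] coeff_space_add)
  show "\<zero>\<^bsub>L2_space p (p + m)\<^esub> \<in> comb_class p m ` coeff_space p m"
  proof (rule image_eqI[OF _ coeff_space_zero])
    show "\<zero>\<^bsub>L2_space p (p + m)\<^esub> = comb_class p m (\<lambda>v. 0)"
      unfolding L2_zero comb_class_def comb_def supp_def by simp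
  qed
  show "c \<odot>\<^bsub>L2_space p (p + m)\<^esub> v \<in> comb_class p m ` coeff_space p m"
    if "v \<in> comb_class p m ` coeff_space p m" for c v
    using that by (auto simp: comb_class_smult[OF p] coeff_space_cmult)
qed

text \<open>Every combination with sum zero lies in each submodule that contains the cocycle: peel off
  the points one by one.\<close>

lemma comb_in_submodule:
  assumes p: "1 \<le> p" and N: "submodule (class_ring :: complex ring) N (L2_space p (p + m))"
    and b: "\<And>v. v \<in> siegel p m \<Longrightarrow> comb_class p m (\<lambda>x. delta v x - delta (base p m) x) \<in> N"
    and A: "finite A"
  shows "c \<in> coeff_space p m \<Longrightarrow> supp c \<subseteq> insert (base p m) A \<Longrightarrow> comb_class p m c \<in> N"
  using A
proof (induction A arbitrary: c rule: finite_induct)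
  case empty
  have "c v = 0" for v
  proof (cases "v = base p m")
    case True
    have "0 = (\<Sum>v\<in>supp c. c v)" using empty.prems(1) unfolding coeff_space_def by simp
    also have "\<dots> = (\<Sum>v\<in>{base p m}. c v)" by (rule sum_supp_1) (use empty.prems in auto)
    finally show ?thesis using True by simp
  next
    case False
    then show ?thesis using empty.prems(2) unfolding supp_def by auto
  qed
  then have "c = (\<lambda>v. 0)" by auto
  then have "comb_class p m c = \<zero>\<^bsub>L2_space p (p + m)\<^esub>" unfolding L2_zero comb_class_def comb_def supp_def by simp
  then show ?case using N unfolding submodule_def by simp
next
  case (insert w A)
  show ?case
  proof (cases "w \<in> supp c")
    case False
    then have "supp c \<subseteq> insert (base p m) A" using insert.prems(2) by auto
    then show ?thesis by (rule insert.IH[OF insert.prems(1)])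
  next
    case True
    have w: "w \<in> siegel p m" using True insert.prems(1) unfolding coeff_space_def by auto
    define d where "d = (\<lambda>x. c w * (delta w x - delta (base p m) x))"
    define e where "e = (\<lambda>x. c x + (- 1) * d x)"
    have dd: "(\<lambda>x. delta w x - delta (base p m) x) \<in> coeff_space p m" by (rule delta_diff_coeff_space[OF w base_siegel])
    have d: "d \<in> coeff_space p m" unfolding d_def by (rule coeff_space_cmult[OF dd])
    have e: "e \<in> coeff_space p m" unfolding e_def by (intro coeff_space_add coeff_space_cmult insert.prems d)
    have "supp e \<subseteq> insert (base p m) A"
    proof
      fix x assume x: "x \<in> supp e"
      show "x \<in> insert (base p m) A"
      proof (rule ccontr)
        assume nx: "x \<notin> insert (base p m) A"
        have "e x = 0"
        proof (cases "x = w")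
          case True
          then show ?thesis using nx unfolding e_def d_def delta_def by auto
        next
          case False
          then have "c x = 0" using nx insert.prems(2) unfolding supp_def by auto
          then show ?thesis using False nx unfolding e_def d_def delta_def by auto
        qed
        with x show False unfolding supp_def by simp
      qed
    qed
    then have eN: "comb_class p m e \<in> N" by (rule insert.IH[OF e])
    have dN: "comb_class p m d \<in> N"
    proof -
      have "c w \<odot>\<^bsub>L2_space p (p + m)\<^esub> comb_class p m (\<lambda>x. delta w x - delta (base p m) x) \<in> N"
        by (rule submodule.smult_closed[OF N]) (use b[OF w] in auto)
      then show ?thesis unfolding comb_class_smult[OF p dd] d_def .
    qed
    have "comb_class p m e \<oplus>\<^bsub>L2_space p (p + m)\<^esub> comb_class p m d \<in> N"
      by (rule submodule.m_closed[OF N eN dN])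
    also have "comb_class p m e \<oplus>\<^bsub>L2_space p (p + m)\<^esub> comb_class p m d = comb_class p m (\<lambda>v. e v + d v)"
      by (rule comb_class_add[OF p e d])
    also have "(\<lambda>v. e v + d v) = c" unfolding e_def by auto
    finally show ?thesis .
  qed
qed

text \<open>The values of the cocycle are classes of combinations with sum zero, and by transitivity every difference between an orbit
  function and the vacuum is a value of the cocycle.\<close>

lemma L_carrier:
  assumes p: "1 \<le> p"
  shows "carrier (L_space p (p + m)) = comb_class p m ` coeff_space p m"
proof -
  interpret M: module "class_ring :: complex ring" "L2_space p (p + m)" by (rule L2_module)
  let ?B = "b_cocycle p (p + m) ` P_group p (p + m)"
  have B: "?B \<subseteq> comb_class p m ` coeff_space p m"
  proof (rule image_subsetI)
    fix g assume g: "g \<in> P_group p (p + m)"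
    show "b_cocycle p (p + m) g \<in> comb_class p m ` coeff_space p m"
      unfolding b_cocycle_eq[OF p g] by (intro imageI delta_diff_coeff_space act_P_group[OF g] base_siegel)
  qed
  have BL: "?B \<subseteq> carrier (L2_space p (p + m))" 
    using B image_subsetI[of "coeff_space p m", OF comb_class_L2[OF p]] by (rule subset_trans)
  have "M.span ?B \<subseteq> comb_class p m ` coeff_space p m"
    by (rule M.span_is_subset[OF B comb_submodule[OF p]])
  moreover have "comb_class p m ` coeff_space p m \<subseteq> M.span ?B"
  proof
    fix x assume "x \<in> comb_class p m ` coeff_space p m"
    then obtain c where c: "c \<in> coeff_space p m" "x = comb_class p m c" by blast
    have "comb_class p m c \<in> M.span ?B"
    proof (rule comb_in_submodule[OF p M.span_is_submodule[OF BL] _ _ c(1)])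
      show "finite (supp c)" using c unfolding coeff_space_def by auto
      show "supp c \<subseteq> insert (base p m) (supp c)" by auto
      fix v assume v: "v \<in> siegel p m"
      obtain s h where sh: "s \<in> S_group p" "h \<in> N_group p m"
        "act p m (S_embed p m s * N_embed p m h) (base p m) = v" by (rule P_transitive[OF v])
      have g: "S_embed p m s * N_embed p m h \<in> P_group p (p + m)" using sh(1,2) unfolding P_group_def by (simp only: diff_add_inverse) blast
      have "comb_class p m (\<lambda>x. delta v x - delta (base p m) x) = b_cocycle p (p + m) (S_embed p m s * N_embed p m h)"
        using b_cocycle_eq[OF p g] sh(3) by simp
      then show "comb_class p m (\<lambda>x. delta v x - delta (base p m) x) \<in> M.span ?B"
        using M.in_own_span[OF BL] g by auto
    qed
    then show "x \<in> M.span ?B" using c by simp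
  qed
  ultimately show ?thesis unfolding L_space_def by simp
qed

lemma L_add: "x \<oplus>\<^bsub>L_space p q\<^esub> y = x \<oplus>\<^bsub>L2_space p q\<^esub> y"
  unfolding L_space_def by simp

lemma L_smult: "c \<odot>\<^bsub>L_space p q\<^esub> y = c \<odot>\<^bsub>L2_space p q\<^esub> y"
  unfolding L_space_def by simp

lemma L_vectorspace:
  assumes p: "1 \<le> p"
  shows "vectorspace (class_ring :: complex ring) (L_space p (p + m))"
proof -
  interpret M: module "class_ring :: complex ring" "L2_space p (p + m)" by (rule L2_module)
  have "module (class_ring :: complex ring) (M.md (comb_class p m ` coeff_space p m))"
    by (rule M.submodule_is_module[OF comb_submodule[OF p]])
  moreover have "M.md (comb_class p m ` coeff_space p m) = L_space p (p + m)"
    using L_carrier[OF p, of m] unfolding L_space_def by simp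
  ultimately show ?thesis by (simp add: vectorspace_def class_field)
qed

section \<open>The extended representation\<close>

text \<open>The operator of \<open>g\<close> transports the coefficients along the action of \<open>g\<close> on the points. By linear
  independence a vector of \<open>L\<close> determines its coefficients; outside \<open>L\<close> the value is irrelevant.\<close>

definition ext_rep :: "nat \<Rightarrow> nat \<Rightarrow> complex mat \<Rightarrow> vfun set \<Rightarrow> vfun set" where
  "ext_rep p m g v = comb_class p m (push (act p m g) (the_inv_into (coeff_space p m) (comb_class p m) v))"

lemma ext_rep_comb:
  assumes "1 \<le> p" "c \<in> coeff_space p m"
  shows "ext_rep p m g (comb_class p m c) = comb_class p m (push (act p m g) c)"
  unfolding ext_rep_def the_inv_into_f_f[OF comb_class_inj[OF assms(1)] assms(2)] ..

lemma ext_rep_linear: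
  assumes p: "1 \<le> p" and g: "g \<in> U_group p (p + m)"
  shows "linear_map (class_ring :: complex ring) (L_space p (p + m)) (L_space p (p + m)) (ext_rep p m g)"
proof -
  have pc: "push (act p m g) c \<in> coeff_space p m" if "c \<in> coeff_space p m" for c
    by (rule push_coeff_space[OF that]) (rule act_siegel[OF g])
  have "ext_rep p m g \<in> module_hom (class_ring :: complex ring) (L_space p (p + m)) (L_space p (p + m))"
    unfolding module_hom_def L_carrier[OF p] L_add L_smult
  proof (intro CollectI conjI allI impI)
    show "ext_rep p m g \<in> comb_class p m ` coeff_space p m \<rightarrow> comb_class p m ` coeff_space p m"
      using pc by (auto simp: ext_rep_comb[OF p])
    fix x y assume "x \<in> comb_class p m ` coeff_space p m \<and> y \<in> comb_class p m ` coeff_space p m"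
    then obtain c d where c: "c \<in> coeff_space p m" "x = comb_class p m c" and d: "d \<in> coeff_space p m" "y = comb_class p m d" by blast
    have "finite (supp c)" "finite (supp d)" using c d unfolding coeff_space_def by auto
    then show "ext_rep p m g (x \<oplus>\<^bsub>L2_space p (p + m)\<^esub> y) = ext_rep p m g x \<oplus>\<^bsub>L2_space p (p + m)\<^esub> ext_rep p m g y"
      by (simp add: c(2) d(2) comb_class_add[OF p] ext_rep_comb[OF p] c(1) d(1) coeff_space_add pc push_add)
  next
    fix r :: complex and x assume "r \<in> carrier class_ring \<and> x \<in> comb_class p m ` coeff_space p m"
    then obtain c where c: "c \<in> coeff_space p m" "x = comb_class p m c" by blast
    have "finite (supp c)" using c unfolding coeff_space_def by auto
    then show "ext_rep p m g (r \<odot>\<^bsub>L2_space p (p + m)\<^esub> x) = r \<odot>\<^bsub>L2_space p (p + m)\<^esub> ext_rep p m g x"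
      by (simp add: c(2) comb_class_smult[OF p] ext_rep_comb[OF p] c(1) coeff_space_cmult pc push_cmult)
  qed
  then show ?thesis
    using L_vectorspace[OF p, of m] unfolding linear_map_def mod_hom_def mod_hom_axioms_def vectorspace_def by simp
qed

text \<open>On \<open>P\<close> the operators agree. Translation invariance of the measure class shows that the
  given operators may be evaluated on any representative.\<close>

lemma ext_rep_P:
  assumes p: "1 \<le> p" and g: "g \<in> P_group p (p + m)" and c: "c \<in> coeff_space p m"
  shows "ext_rep p m g (comb_class p m c) = T_rep p (p + m) g (comb_class p m c)"
proof -
  obtain s0 n z0 where s0: "s0 \<in> S_group p" and h: "(n, z0) \<in> N_group p m" and g_eq: "g = S_embed p m s0 * N_embed p m (n, z0)"
    by (rule P_group_obtain[OF g]) (metis prod.exhaust)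
  have z0: "z0 \<in> carrier_mat p m" using h unfolding N_group_def by auto
  have fin: "finite (supp c)" "supp c \<subseteq> siegel p m" using c unfolding coeff_space_def by auto
  have T_comb: "T_fun p (p + m) g (comb p m c) s z = comb p m (push (act p m g) c) s z"
    if s: "s \<in> carrier_mat p p" and z: "z \<in> carrier_mat p m" for s z
  proof -
    have "T_fun p (p + m) g (comb p m c) s z = (\<Sum>v\<in>supp c. c v * T_fun p (p + m) g (phi p m v) s z)"
      unfolding g_eq T_fun_SN[OF s0 h] by (simp add: comb_def sum_distrib_left mult.left_commute)
    also have "\<dots> = (\<Sum>v\<in>supp c. c v * phi p m (act p m g v) s z)"
    proof (intro sum.cong refl)
      fix v assume "v \<in> supp c"
      then have v: "v \<in> siegel p m" using fin by auto
      show "c v * T_fun p (p + m) g (phi p m v) s z = c v * phi p m (act p m g v) s z"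
        unfolding g_eq T_fun_phi[OF s0 h siegel_carrier[OF v] siegel_E1[OF v] s z] ..
    qed
    also have "\<dots> = comb p m (push (act p m g) c) s z"
      unfolding comb_def by (rule sum_push[OF fin(1), symmetric])
    finally show ?thesis .
  qed
  have rep: "ae_class p (p + m) (T_fun p (p + m) g F) = comb_class p m (push (act p m g) c)"
    if F: "F \<in> comb_class p m c" for F
    unfolding comb_class_def
  proof (rule ae_class_cong)
    have "AE s in nu_measure p. \<forall>z \<in> carrier_mat p m. F s z = comb p m c s z"
      using F unfolding comb_class_def ae_class_iff ae_eq_def by simp
    then have "AE s in nu_measure p. \<forall>z \<in> carrier_mat p m. F (s * s0) z = comb p m c (s * s0) z"
      by (rule nu_right_mult[OF p s0])
    then show "ae_eq p (p + m) (T_fun p (p + m) g F) (comb p m (push (act p m g) c))"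
      unfolding ae_eq_def
    proof (rule AE_mp, intro AE_I2 impI ballI)
      fix s z :: "complex mat" assume "s \<in> space (nu_measure p)" and eq: "\<forall>z \<in> carrier_mat p m. F (s * s0) z = comb p m c (s * s0) z"
        and "z \<in> carrier_mat p (p + m - p)"
      then have s: "s \<in> carrier_mat p p" and z: "z \<in> carrier_mat p m" using S_group_carrier by auto
      have "z + s * s0 * z0 \<in> carrier_mat p m" using z z0 s S_group_carrier[OF s0] by auto
      then have "T_fun p (p + m) g F s z = T_fun p (p + m) g (comb p m c) s z"
        unfolding g_eq T_fun_SN[OF s0 h] using eq by simp
      then show "comb p m (push (act p m g) c) s z = T_fun p (p + m) g F s z" using T_comb[OF s z] by simp
    qed
  qed
  have "T_rep p (p + m) g (comb_class p m c) = comb_class p m (push (act p m g) c)"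
    unfolding T_rep_def
    by (rule UN_constant_eq[where a = "comb p m c"])
      (use rep ae_class_self[OF comb_square_int[OF p c]] in \<open>auto simp: comb_class_def\<close>)
  then show ?thesis using ext_rep_comb[OF p c] by simp
qed

text \<open>The cocycle is the coboundary of the base point, which is a point of the domain but not a vector
  of the space.\<close>

definition ext_cocycle :: "nat \<Rightarrow> nat \<Rightarrow> complex mat \<Rightarrow> vfun set" where
  "ext_cocycle p m g = comb_class p m (\<lambda>x. delta (act p m g (base p m)) x - delta (base p m) x)"

theorem theorem11:
  fixes p q :: nat
  assumes "1 \<le> p" and "p \<le> q"
  shows "\<exists>(Tt :: complex mat \<Rightarrow> vfun set \<Rightarrow> vfun set) (bt :: complex mat \<Rightarrow> vfun set).
    (\<forall>g \<in> U_group p q. linear_map class_ring (L_space p q) (L_space p q) (Tt g)) \<and>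
    (\<forall>v \<in> carrier (L_space p q). Tt (1\<^sub>m (p + q)) v = v) \<and>
    (\<forall>g1 \<in> U_group p q. \<forall>g2 \<in> U_group p q. \<forall>v \<in> carrier (L_space p q).
       Tt (g1 * g2) v = Tt g1 (Tt g2 v)) \<and>
    (\<forall>g \<in> P_group p q. \<forall>v \<in> carrier (L_space p q). Tt g v = T_rep p q g v) \<and>
    (\<forall>g \<in> U_group p q. bt g \<in> carrier (L_space p q)) \<and>
    (\<forall>g1 \<in> U_group p q. \<forall>g2 \<in> U_group p q.
       bt (g1 * g2) = Tt g1 (bt g2) \<oplus>\<^bsub>L_space p q\<^esub> bt g1) \<and>
    (\<forall>g \<in> P_group p q. bt g = b_cocycle p q g)"
proof -
  note p = assms(1)
  obtain m where q: "q = p + m" using assms(2) le_Suc_ex by blast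
  note L = L_carrier[OF p, of m]
  note o = base_siegel[of p m]
  have ao: "act p m g (base p m) \<in> siegel p m" if "g \<in> U_group p (p + m)" for g
    by (rule act_siegel[OF that o])
  show ?thesis
    unfolding q
  proof (intro exI[of _ "ext_rep p m"] exI[of _ "ext_cocycle p m"] conjI ballI)
    show "linear_map class_ring (L_space p (p + m)) (L_space p (p + m)) (ext_rep p m g)"
      if "g \<in> U_group p (p + m)" for g by (rule ext_rep_linear[OF p that])
    show "ext_rep p m (1\<^sub>m (p + (p + m))) v = v" if "v \<in> carrier (L_space p (p + m))" for v
    proof -
      from that obtain c where c: "c \<in> coeff_space p m" "v = comb_class p m c" unfolding L by blast
      have "1\<^sub>m (p + (p + m)) = (1\<^sub>m (p + m + p) :: complex mat)" by (simp add: ac_simps)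
      then show ?thesis
        unfolding c(2) ext_rep_comb[OF p c(1)] by (simp add: push_id[OF c(1)] act_one)
    qed
    show "ext_rep p m (g1 * g2) v = ext_rep p m g1 (ext_rep p m g2 v)"
      if g: "g1 \<in> U_group p (p + m)" "g2 \<in> U_group p (p + m)" and v: "v \<in> carrier (L_space p (p + m))" for g1 g2 v
    proof -
      from v obtain c where c: "c \<in> coeff_space p m" "v = comb_class p m c" unfolding L by blast
      have c2: "push (act p m g2) c \<in> coeff_space p m" by (rule push_coeff_space[OF c(1) act_siegel[OF g(2)]])
      have "push (act p m (g1 * g2)) c = push (act p m g1) (push (act p m g2) c)"
        by (rule push_comp[OF c(1)]) (rule act_comp[OF g])
      then show ?thesis unfolding c(2) ext_rep_comb[OF p c(1)] ext_rep_comb[OF p c2] by simp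
    qed
    show "ext_rep p m g v = T_rep p (p + m) g v"
      if g: "g \<in> P_group p (p + m)" and v: "v \<in> carrier (L_space p (p + m))" for g v
    proof -
      from v obtain c where "c \<in> coeff_space p m" "v = comb_class p m c" unfolding L by blast
      then show ?thesis using ext_rep_P[OF p g] by simp
    qed
    show "ext_cocycle p m g \<in> carrier (L_space p (p + m))" if "g \<in> U_group p (p + m)" for g
      unfolding L ext_cocycle_def by (intro imageI delta_diff_coeff_space ao that o)
    show "ext_cocycle p m (g1 * g2) = ext_rep p m g1 (ext_cocycle p m g2) \<oplus>\<^bsub>L_space p (p + m)\<^esub> ext_cocycle p m g1"
      if g: "g1 \<in> U_group p (p + m)" "g2 \<in> U_group p (p + m)" for g1 g2
    proof -
      have d: "(\<lambda>x. delta (act p m g2 (base p m)) x - delta (base p m) x) \<in> coeff_space p m"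
        by (intro delta_diff_coeff_space ao g o)
      have d1: "(\<lambda>x. delta (act p m g1 (act p m g2 (base p m))) x - delta (act p m g1 (base p m)) x) \<in> coeff_space p m"
        by (intro delta_diff_coeff_space act_siegel[OF g(1)] ao g o)
      have d2: "(\<lambda>x. delta (act p m g1 (base p m)) x - delta (base p m) x) \<in> coeff_space p m"
        by (intro delta_diff_coeff_space ao g o)
      show ?thesis
        unfolding ext_cocycle_def ext_rep_comb[OF p d] push_delta_diff L_add comb_class_add[OF p d1 d2] act_comp[OF g o]
        by simp
    qed
    show "ext_cocycle p m g = b_cocycle p (p + m) g" if "g \<in> P_group p (p + m)" for g
      unfolding ext_cocycle_def by (rule b_cocycle_eq[OF p that, symmetric])
  qed
qed

end
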